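(* Let $(X_n)_{n\in\mathbb{N}}$ be a Marchenko-Pastur scheme defined on a probability space $(\Omega,\mathcal{A},\mathbb{P})$, where $X_n$ is of size $p_n\times n$, and let $y=\lim_{n\to\infty}p_n/n\in(0,\infty)$. For all $n\in\mathbb{N}$ define the $p_n\times p_n$ random matrix $V_n=\frac1n X_nX_n^T$. Then the Marchenko-Pastur law holds for $(V_n)_n$ almost surely; that is, the empirical spectral distributions $\mu_n$ of $V_n$ converge weakly almost surely to the Marchenko-Pastur distribution $\mu^y$.
   Context: Marchenko-Pastur scheme: for every $n\in\mathbb{N}$ there is $p=p_n\in\mathbb{N}$ and a family $X_n=(X_n(i,j))_{1\le i\le p,\,1\le j\le n}$ of real-valued random variables such that (i) for all $q\in\mathbb{N}$ there is a constant $L_q\in(0,\infty)$ with $\mathbb{E}|X_n(i,j)|^q\le L_q$ for all $n,i,j$; (ii) $\mathbb{E}X_n(i,j)=0$ and $\mathrm{Var}(X_n(i,j))=1$ for all $n,i,j$; (iii) for each $n$ the family $(X_n(i,j))_{1\le i\le p,1\le j\le n}$ is independent; (iv) there is a constant $y\in(0,\infty)$ with $p_n/n\to y$ as $n\to\infty$. Marchenko-Pastur distribution with ratio index $y\in(0,\infty)$: with $y_\pm=(1\pm\sqrt y)^2$, it is the probability measure on $\mathbb{R}$ $$\mu^y(dx)=\frac{1}{2\pi xy}\sqrt{(y_+-x)(x-y_-)}\,\mathbf{1}_{(y_-,y_+)}(x)\,dx+\Big(1-\frac1y\Big)\mathbf{1}_{y>1}\,\delta_0(dx).$$ Empirical spectral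 distribution (ESD) of a self-adjoint $m\times m$ random matrix $V$ with real eigenvalues $\lambda_1^V\le\ldots\le\lambda_m^V$ (with multiplicity): the random probability measure $\frac1m\sum_{l=1}^m\delta_{\lambda_l^V}$. Weak convergence almost surely: for $\mathbb{P}$-almost all $\omega\in\Omega$, $\mu_n(\omega)\to\mu^y$ weakly, i.e. $\int f\,d\mu_n(\omega)\to\int f\,d\mu^y$ for all bounded continuous $f:\mathbb{R}\to\mathbb{R}$. *)

theory Defs
  imports "HOL-Probability.Probability" "Jordan_Normal_Form.Char_Poly"
begin

text \<open>
  Matrix indices are 0-based, so the entries of the \<open>p n \<times> n\<close> matrix are \<open>X n i j\<close> with
  \<open>i < p n\<close> and \<open>j < n\<close>. All conditions concern \<open>n \<ge> 1\<close> only (for \<open>n = 0\<close> there are no entries).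
  Integrability is part of the moment condition because the Bochner integral of a
  non-integrable function is 0; measurability is part of the independence condition.
\<close>

locale marchenko_pastur_scheme = prob_space M
  for M :: "'a measure" +
  fixes p :: "nat \<Rightarrow> nat"
    and X :: "nat \<Rightarrow> nat \<Rightarrow> nat \<Rightarrow> 'a \<Rightarrow> real"
    and y :: real
  assumes size_pos: "\<And>n. 1 \<le> n \<Longrightarrow> 1 \<le> p n"
    and moments: "\<And>q::nat. \<exists>L>0. \<forall>n. \<forall>i<p n. \<forall>j<n.
          integrable M (\<lambda>\<omega>. \<bar>X n i j \<omega>\<bar> ^ q) \<and> expectation (\<lambda>\<omega>. \<bar>X n i j \<omega>\<bar> ^ q) \<le> L"
    and mean: "\<And>n i j. i < p n \<Longrightarrow> j < n \<Longrightarrow> expectation (X n i j) = 0"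
    and var: "\<And>n i j. i < p n \<Longrightarrow> j < n \<Longrightarrow> variance (X n i j) = 1"
    and indep: "\<And>n. indep_vars (\<lambda>_. borel) (\<lambda>(i, j). X n i j) ({..<p n} \<times> {..<n})"
    and ratio_pos: "0 < y"
    and ratio_lim: "(\<lambda>n. real (p n) / real n) \<longlonglongrightarrow> y"

definition data_matrix ::
    "(nat \<Rightarrow> nat) \<Rightarrow> (nat \<Rightarrow> nat \<Rightarrow> nat \<Rightarrow> 'a \<Rightarrow> real) \<Rightarrow> nat \<Rightarrow> 'a \<Rightarrow> real mat" where
  "data_matrix p X n \<omega> = Matrix.mat (p n) n (\<lambda>(i, j). X n i j \<omega>)"

definition covariance_matrix ::
    "(nat \<Rightarrow> nat) \<Rightarrow> (nat \<Rightarrow> nat \<Rightarrow> nat \<Rightarrow> 'a \<Rightarrow> real) \<Rightarrow> nat \<Rightarrow> 'a \<Rightarrow> real mat" where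
  "covariance_matrix p X n \<omega> =
     (1 / real n) \<cdot>\<^sub>m (data_matrix p X n \<omega> * transpose_mat (data_matrix p X n \<omega>))"

definition spectrum_list :: "real mat \<Rightarrow> real list" where
  "spectrum_list V = sorted_list_of_multiset (proots (char_poly V))"

text \<open>
  The image of the uniform distribution on the index set under \<open>l \<mapsto> \<lambda>\<^sub>l\<close>, that is
  \<open>(1/m) \<Sum>\<^sub>l \<delta>(\<lambda>\<^sub>l)\<close>. It is meant for symmetric \<open>V\<close>, whose spectrum list has length \<open>m\<close>
  (\<open>length_spectrum_list\<close> below).
\<close>

definition esd :: "real mat \<Rightarrow> real measure" where
  "esd V = distr (uniform_count_measure {..<dim_row V}) borel (\<lambda>l. spectrum_list V ! l)"

definition marchenko_pastur_density :: "real \<Rightarrow> real \<Rightarrow> real" where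
  "marchenko_pastur_density y x =
     (let a = (1 - sqrt y)\<^sup>2; b = (1 + sqrt y)\<^sup>2
      in 1 / (2 * pi * x * y) * sqrt ((b - x) * (x - a)) * indicator {a<..<b} x)"

text \<open>
  The library has no sum of measures, so the absolutely continuous part and the atom at 0 are
  added setwise; \<open>emeasure_marchenko_pastur\<close> below confirms that this is a measure.
\<close>

definition marchenko_pastur :: "real \<Rightarrow> real measure" where
  "marchenko_pastur y = measure_of UNIV (sets borel)
     (\<lambda>A. emeasure (density lborel (\<lambda>x. ennreal (marchenko_pastur_density y x))) A
          + ennreal (if y > 1 then 1 - 1 / y else 0) * emeasure (return borel 0) A)"

definition converges_weakly :: "(nat \<Rightarrow> real measure) \<Rightarrow> real measure \<Rightarrow> bool" where
  "converges_weakly \<mu> \<nu> \<longleftrightarrow>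
     (\<forall>f::real \<Rightarrow> real. continuous_on UNIV f \<longrightarrow> bounded (range f) \<longrightarrow>
        (\<lambda>n. \<integral>x. f x \<partial>\<mu> n) \<longlonglongrightarrow> (\<integral>x. f x \<partial>\<nu>))"

lemma sets_marchenko_pastur [simp]: "sets (marchenko_pastur y) = sets borel"
  unfolding marchenko_pastur_def
  using sets.sets_measure_of_eq[of "borel :: real measure"] by simp

lemma emeasure_marchenko_pastur:
  assumes A: "A \<in> sets borel"
  shows "emeasure (marchenko_pastur y) A =
    emeasure (density lborel (\<lambda>x. ennreal (marchenko_pastur_density y x))) A
    + ennreal (if y > 1 then 1 - 1 / y else 0) * indicator A 0"
proof -
  let ?D = "density lborel (\<lambda>x. ennreal (marchenko_pastur_density y x))"
  let ?c = "ennreal (if y > 1 then 1 - 1 / y else 0)"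
  let ?\<mu> = "\<lambda>A. emeasure ?D A + ?c * emeasure (return borel 0) A"
  have "countably_additive (sets (borel :: real measure)) ?\<mu>"
  proof (rule countably_additiveI)
    fix F :: "nat \<Rightarrow> real set"
    assume F: "range F \<subseteq> sets borel" "disjoint_family F"
    have 1: "(\<Sum>i. emeasure ?D (F i)) = emeasure ?D (\<Union>i. F i)"
      using F by (intro suminf_emeasure) auto
    have 2: "(\<Sum>i. emeasure (return borel (0::real)) (F i)) = emeasure (return borel 0) (\<Union>i. F i)"
      using F by (intro suminf_emeasure) auto
    show "(\<Sum>i. ?\<mu> (F i)) = ?\<mu> (\<Union>i. F i)"
      by (simp add: suminf_add[symmetric] 1 2 del: emeasure_return)
  qed
  moreover have "positive (sets (borel :: real measure)) ?\<mu>"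
    by (simp add: positive_def)
  moreover have "sigma_algebra UNIV (sets (borel :: real measure))"
    using sets.sigma_algebra_axioms[of "borel :: real measure"] by simp
  ultimately have "emeasure (marchenko_pastur y) A = ?\<mu> A"
    unfolding marchenko_pastur_def using A by (intro emeasure_measure_of_sigma) auto
  with A show ?thesis by simp
qed

lemma length_spectrum_list:
  assumes V: "V \<in> carrier_mat m m" and sym: "transpose_mat V = V"
  shows "length (spectrum_list V) = m"
proof -
  let ?c = "of_real :: real \<Rightarrow> complex"
  let ?W = "map_mat ?c V"
  have W: "?W \<in> carrier_mat m m" using V by simp
  have symij: "V $$ (i, j) = V $$ (j, i)" if "i < m" "j < m" for i j
    using that V sym by (metis carrier_matD index_transpose_mat(1))
  have real_root: "z \<in> \<real>" if z: "poly (char_poly ?W) z = 0" for z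
  proof -
    from z eigenvalue_root_char_poly[OF W] obtain v where "eigenvector ?W v z"
      unfolding eigenvalue_def by blast
    then have v: "v \<in> carrier_vec m" "v \<noteq> 0\<^sub>v m" and ev: "?W *\<^sub>v v = z \<cdot>\<^sub>v v"
      using V by (auto simp: eigenvector_def)
    have comp: "(\<Sum>j<m. ?c (V $$ (i, j)) * vec_index v j) = z * vec_index v i" if "i < m" for i
    proof -
      have "vec_index (?W *\<^sub>v v) i = vec_index (z \<cdot>\<^sub>v v) i" using ev by simp
      then show ?thesis using that V v
        by (simp add: scalar_prod_def atLeast0LessThan)
    qed
    let ?q = "\<Sum>i<m. \<Sum>j<m. cnj (vec_index v i) * (?c (V $$ (i, j)) * vec_index v j)"
    let ?N = "\<Sum>i<m. (cmod (vec_index v i))\<^sup>2"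
    have q: "?q = z * ?c ?N"
    proof -
      have "?q = (\<Sum>i<m. cnj (vec_index v i) * (z * vec_index v i))"
        by (intro sum.cong refl) (simp add: sum_distrib_left[symmetric] comp)
      also have "\<dots> = z * (\<Sum>i<m. vec_index v i * cnj (vec_index v i))"
        by (simp add: sum_distrib_left mult_ac)
      also have "\<dots> = z * ?c ?N" by (simp only: complex_norm_square of_real_sum)
      finally show ?thesis .
    qed
    have "cnj ?q = (\<Sum>i<m. \<Sum>j<m. cnj (vec_index v j) * (?c (V $$ (i, j)) * vec_index v i))"
      by (simp add: mult_ac)
    also have "\<dots> = (\<Sum>j<m. \<Sum>i<m. cnj (vec_index v j) * (?c (V $$ (i, j)) * vec_index v i))"
      by (rule sum.swap)
    also have "\<dots> = ?q" by (intro sum.cong refl) (simp add: symij)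
    finally have "cnj ?q = ?q" .
    then have "cnj z * ?c ?N = z * ?c ?N" unfolding q by simp
    moreover have "?N \<noteq> 0"
    proof
      assume "?N = 0"
      then have "\<forall>i<m. vec_index v i = 0" by (simp add: sum_nonneg_eq_0_iff)
      with v show False by (auto intro!: eq_vecI)
    qed
    then have "?c ?N \<noteq> 0" by (simp only: of_real_eq_0_iff not_False_eq_True)
    ultimately have "cnj z = z" by (metis mult_cancel_right)
    then show ?thesis by (simp add: Reals_cnj_iff)
  qed
  obtain zs where zs: "char_poly ?W = (\<Prod>a\<leftarrow>zs. [:- a, 1:])" "length zs = m"
    using char_poly_factorized[OF W] by blast
  have "z \<in> \<real>" if "z \<in> set zs" for z
    using that by (intro real_root) (force simp: zs poly_prod_list prod_list_zero_iff)
  then have zs_re: "map (\<lambda>z. ?c (Re z)) zs = zs"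
    by (intro map_idI) simp
  define rs where "rs = map Re zs"
  have "map_poly ?c (char_poly V) = char_poly ?W"
    by (rule of_real_hom.char_poly_hom[OF V, symmetric])
  also have "\<dots> = (\<Prod>r\<leftarrow>rs. [:- ?c r, 1:])"
    unfolding zs(1) rs_def by (subst zs_re[symmetric]) (simp add: o_def)
  also have "\<dots> = map_poly ?c (\<Prod>r\<leftarrow>rs. [:- r, 1:])"
    by (induction rs) (auto intro!: poly_eqI simp: coeff_map_poly coeff_pCons split: nat.split)
  finally have eq: "map_poly ?c (char_poly V) = map_poly ?c (\<Prod>r\<leftarrow>rs. [:- r, 1:])" .
  have "char_poly V = (\<Prod>r\<leftarrow>rs. [:- r, 1:])"
  proof (rule poly_eqI)
    fix k
    from eq have "coeff (map_poly ?c (char_poly V)) k = coeff (map_poly ?c (\<Prod>r\<leftarrow>rs. [:- r, 1:])) k"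
      by simp
    then show "coeff (char_poly V) k = coeff (\<Prod>r\<leftarrow>rs. [:- r, 1:]) k"
      by (simp add: coeff_map_poly)
  qed
  moreover have "size (proots (\<Prod>r\<leftarrow>rs. [:- r, 1:])) = length rs"
  proof (induction rs)
    case (Cons r rs)
    have "(\<Prod>r\<leftarrow>rs. [:- r, 1:]) \<noteq> 0" by (auto simp: prod_list_zero_iff)
    with Cons show ?case by (simp add: proots_mult del: mult_pCons_left)
  qed simp
  ultimately have "size (proots (char_poly V)) = length rs" by simp
  then show ?thesis
    unfolding spectrum_list_def rs_def using zs(2) by (metis length_map mset_sorted_list_of_multiset size_mset)
qed

end

theory Submission
  imports Defs "Jordan_Normal_Form.Schur_Decomposition"
begin

text \<open>
  The spectra lie in \<open>[0, \<infinity>)\<close>, so weak convergence follows from convergence of the Stieltjes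
  transforms \<open>s\<^sub>n(t) = tr (V\<^sub>n + t)\<^sup>-\<^sup>1 / p\<^sub>n\<close> at countably many real \<open>t > 0\<close>; no complex resolvents are
  needed. Let \<open>c\<^sub>j\<close> be the columns of \<open>X\<^sub>n\<close> and \<open>R\<^sub>j\<close> the resolvent without the \<open>j\<close>-th column. By the
  Sherman--Morrison formula, \<open>t p\<^sub>n s\<^sub>n + \<Sum>\<^sub>j q\<^sub>j / (1 + q\<^sub>j) = p\<^sub>n\<close> with \<open>q\<^sub>j = c\<^sub>j\<^sup>T R\<^sub>j c\<^sub>j / n\<close>. Since \<open>c\<^sub>j\<close> is
  independent of \<open>R\<^sub>j\<close>, the fourth moment of \<open>q\<^sub>j - tr R\<^sub>j / n\<close> is \<open>O(n\<^sup>-\<^sup>2)\<close>, which is summable, while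
  \<open>tr R\<^sub>j\<close> and \<open>p\<^sub>n s\<^sub>n\<close> differ by at most \<open>1 / t\<close>. Hence almost surely every limit \<open>s\<close> of \<open>s\<^sub>n(t)\<close> solves
  \<open>t s + s / (1 + y s) = 1\<close>, whose only nonnegative root is the transform of \<open>\<mu>\<^sup>y\<close>.
\<close>

section \<open>Weak convergence from Stieltjes transforms on the half-line\<close>

text \<open>Arrays with different n are not related to each other, so almost sure convergence has to
  come from expectations that are summable in n. For q_j - tr R_j / n the second moment is only
  O(1/n), the fourth is O(n^-2). Even this suffices only for the average over j, since a maximum
  over n columns would cost a factor n; hence the equation is perturbed by an average of deviations.
  Fourth moments of quadratic forms in turn consume eighth moments of the entries. Real t > 0 bounds
  every resolvent by 1 / t without control of the largest eigenvalue, so neither truncation nor a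
  norm bound for X_n enters. In exchange the transforms are known only at points of the half-line,
  and complex inversion is replaced by approximation in the variable 1 / (1 + x). The points t = 1 +
  1 / (m + 1) accumulate at 1, where the kernel is that variable itself. No mass escapes to infinity
  because the limit is a probability measure, which replaces a separate proof of tightness.\<close>

definition integrals_converge :: "(nat \<Rightarrow> real measure) \<Rightarrow> real measure \<Rightarrow> (real \<Rightarrow> real) \<Rightarrow> bool" where
  "integrals_converge \<mu> \<nu> g \<longleftrightarrow> g \<in> borel_measurable borel \<and> bounded (range g) \<and>
     (\<lambda>n. \<integral>x. g x \<partial>\<mu> n) \<longlonglongrightarrow> (\<integral>x. g x \<partial>\<nu>)"

lemma integrable_bounded_real_distribution:
  fixes g :: "real \<Rightarrow> real"
  assumes "real_distribution \<mu>" "g \<in> borel_measurable borel" "bounded (range g)"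
  shows "integrable \<mu> g"
proof -
  interpret real_distribution \<mu> by fact
  obtain B where "\<And>x. \<bar>g x\<bar> \<le> B" using assms(3) by (auto simp: bounded_iff)
  then show ?thesis using assms(2) by (intro integrable_const_bound[where B = B]) auto
qed

context
  fixes \<mu> :: "nat \<Rightarrow> real measure" and \<nu> :: "real measure"
  assumes \<mu>: "\<And>n. real_distribution (\<mu> n)" and \<nu>: "real_distribution \<nu>"
begin

private lemma int_\<mu>: "g \<in> borel_measurable borel \<Longrightarrow> bounded (range g) \<Longrightarrow> integrable (\<mu> n) g"
  for g :: "real \<Rightarrow> real"
  using integrable_bounded_real_distribution \<mu> by blast

private lemma int_\<nu>: "g \<in> borel_measurable borel \<Longrightarrow> bounded (range g) \<Longrightarrow> integrable \<nu> g"
  for g :: "real \<Rightarrow> real"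
  using integrable_bounded_real_distribution \<nu> by blast

section \<open>Closure properties of the class of test functions\<close>

lemma integrals_converge_const: "integrals_converge \<mu> \<nu> (\<lambda>_. c)"
proof -
  have "measure \<rho> (space \<rho>) = 1" if "real_distribution \<rho>" for \<rho>
    using that by (simp add: real_distribution_def prob_space.prob_space)
  from this[OF \<mu>] this[OF \<nu>] show ?thesis
    by (simp only: integrals_converge_def lebesgue_integral_const) simp
qed

lemma integrals_converge_linear:
  assumes "integrals_converge \<mu> \<nu> f" "integrals_converge \<mu> \<nu> g"
  shows "integrals_converge \<mu> \<nu> (\<lambda>x. a * f x + b * g x)"
proof -
  have f: "f \<in> borel_measurable borel" "bounded (range f)"
    and g: "g \<in> borel_measurable borel" "bounded (range g)"
    using assms by (auto simp: integrals_converge_def)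
  have "bounded (range (\<lambda>x. a * f x + b * g x))"
    using bounded_plus_comp[OF bounded_scaleR_comp[OF f(2), of a] bounded_scaleR_comp[OF g(2), of b]]
    by simp
  moreover have "(\<integral>x. a * f x + b * g x \<partial>\<mu> n) = a * (\<integral>x. f x \<partial>\<mu> n) + b * (\<integral>x. g x \<partial>\<mu> n)" for n
    using int_\<mu>[OF f, of n] int_\<mu>[OF g, of n] by simp
  moreover have "(\<integral>x. a * f x + b * g x \<partial>\<nu>) = a * (\<integral>x. f x \<partial>\<nu>) + b * (\<integral>x. g x \<partial>\<nu>)"
    using int_\<nu>[OF f] int_\<nu>[OF g] by simp
  ultimately show ?thesis
    using assms f(1) g(1) unfolding integrals_converge_def
    by (auto intro!: tendsto_add tendsto_mult tendsto_const)
qed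

text \<open>The error \<open>k\<close> need not be uniformly small. Its integrals converge as well,
  so smallness under the single measure \<nu> carries over to \<open>\<mu> n\<close> for large n.
  This takes the place of tightness.\<close>

lemma integrals_converge_sandwich:
  assumes g: "g \<in> borel_measurable borel" "bounded (range g)"
    and approx: "\<And>e. e > 0 \<Longrightarrow> \<exists>h k. integrals_converge \<mu> \<nu> h \<and> integrals_converge \<mu> \<nu> k \<and>
        (\<forall>x. \<bar>g x - h x\<bar> \<le> k x) \<and> (\<integral>x. k x \<partial>\<nu>) < e"
  shows "integrals_converge \<mu> \<nu> g"
proof -
  have "(\<lambda>n. \<integral>x. g x \<partial>\<mu> n) \<longlonglongrightarrow> (\<integral>x. g x \<partial>\<nu>)"
  proof (rule tendstoI)
    fix e :: real assume "e > 0"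
    \<comment> \<open>The integral of \<open>k\<close> under \<open>\<mu> n\<close> accounts for e /
      2, namely e / 4 under \<nu> and e / 4 from its convergence; the convergence for
      \<open>h\<close> and the integral of \<open>k\<close> under \<nu> account for e / 4
      each.\<close>
    then have "e / 4 > 0" by simp
    from approx[OF this] obtain h k where hk: "integrals_converge \<mu> \<nu> h \<and> integrals_converge \<mu> \<nu> k \<and>
        (\<forall>x. \<bar>g x - h x\<bar> \<le> k x) \<and> (\<integral>x. k x \<partial>\<nu>) < e / 4"
      by (elim exE)
    then have h: "integrals_converge \<mu> \<nu> h" and k: "integrals_converge \<mu> \<nu> k"
      and le: "\<And>x. \<bar>g x - h x\<bar> \<le> k x" and small: "(\<integral>x. k x \<partial>\<nu>) < e / 4"
      by simp_all
    have close: "\<bar>(\<integral>x. g x \<partial>\<rho>) - (\<integral>x. h x \<partial>\<rho>)\<bar> \<le> (\<integral>x. k x \<partial>\<rho>)" if "real_distribution \<rho>" for \<rho>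
    proof -
      have I: "integrable \<rho> g" "integrable \<rho> h" "integrable \<rho> k"
        by (rule integrable_bounded_real_distribution[OF that];
            use g h k in \<open>simp add: integrals_converge_def\<close>)+
      have "\<bar>\<integral>x. g x - h x \<partial>\<rho>\<bar> \<le> (\<integral>x. \<bar>g x - h x\<bar> \<partial>\<rho>)"
        using integral_abs_bound by blast
      also have "\<dots> \<le> (\<integral>x. k x \<partial>\<rho>)" using I le by (intro integral_mono) auto
      finally show ?thesis using I by simp
    qed
    have "eventually (\<lambda>n. \<bar>(\<integral>x. h x \<partial>\<mu> n) - (\<integral>x. h x \<partial>\<nu>)\<bar> < e / 4) sequentially"
      using tendstoD[of _ "\<integral>x. h x \<partial>\<nu>" sequentially "e / 4"] h \<open>e > 0\<close>
      by (auto simp: integrals_converge_def dist_real_def)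
    moreover have "eventually (\<lambda>n. \<bar>(\<integral>x. k x \<partial>\<mu> n) - (\<integral>x. k x \<partial>\<nu>)\<bar> < e / 4) sequentially"
      using tendstoD[of _ "\<integral>x. k x \<partial>\<nu>" sequentially "e / 4"] k \<open>e > 0\<close>
      by (auto simp: integrals_converge_def dist_real_def)
    ultimately show "eventually (\<lambda>n. dist (\<integral>x. g x \<partial>\<mu> n) (\<integral>x. g x \<partial>\<nu>) < e) sequentially"
    proof eventually_elim
      case (elim n)
      then show ?case using close[OF \<mu>[of n]] close[OF \<nu>] small
        unfolding dist_real_def abs_less_iff abs_le_iff by linarith
    qed
  qed
  then show ?thesis using g by (simp add: integrals_converge_def)
qed

lemma integrals_converge_uniform:
  assumes g: "g \<in> borel_measurable borel" "bounded (range g)"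
    and approx: "\<And>e. e > 0 \<Longrightarrow> \<exists>h. integrals_converge \<mu> \<nu> h \<and> (\<forall>x. \<bar>g x - h x\<bar> \<le> e)"
  shows "integrals_converge \<mu> \<nu> g"
proof (rule integrals_converge_sandwich[OF g])
  fix e :: real assume "e > 0"
  then have "e / 2 > 0" by simp
  from approx[OF this]
  obtain h where h: "integrals_converge \<mu> \<nu> h" "\<forall>x. \<bar>g x - h x\<bar> \<le> e / 2"
    by blast
  have "(\<integral>x. e / 2 \<partial>\<nu>) < e"
    using prob_space.prob_space[of \<nu>] \<nu> \<open>e > 0\<close> by (simp add: real_distribution_def)
  then show "\<exists>h k. integrals_converge \<mu> \<nu> h \<and> integrals_converge \<mu> \<nu> k \<and>
        (\<forall>x. \<bar>g x - h x\<bar> \<le> k x) \<and> (\<integral>x. k x \<partial>\<nu>) < e"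
    using h integrals_converge_const[of "e / 2"] by (intro exI[of _ h] exI[of _ "\<lambda>_. e / 2"] conjI) simp_all
qed

text \<open>The map \<open>x \<mapsto> 1 / (1 + x)\<close> compactifies \<open>[0, \<infinity>)\<close> to \<open>[0, 1]\<close>; Cauchy kernels become
  power series in \<open>u\<close>, from which the powers of \<open>u\<close> are extracted one at a time.\<close>

private definition u :: "real \<Rightarrow> real" where "u x = 1 / (1 + max 0 x)"

private lemma u_pos: "0 < u x" and u_le: "u x \<le> 1"
  by (auto simp: u_def divide_simps)

private lemma u_cont: "continuous_on UNIV u"
  unfolding u_def by (intro continuous_intros) (simp add: add_nonneg_eq_0_iff)

private lemma u_meas [measurable]: "u \<in> borel_measurable borel"
  using u_cont by (rule borel_measurable_continuous_onI)

private lemma comp_u_ok: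
  assumes "continuous_on {0..1} \<phi>"
  shows "(\<lambda>x. \<phi> (u x)) \<in> borel_measurable borel" "bounded (range (\<lambda>x. \<phi> (u x) :: real))"
proof -
  have "continuous_on UNIV (\<lambda>x. \<phi> (u x))"
    by (rule continuous_on_compose2[OF assms u_cont]) (auto simp: u_pos u_le less_imp_le)
  then show "(\<lambda>x. \<phi> (u x)) \<in> borel_measurable borel" by (rule borel_measurable_continuous_onI)
  have "bounded (\<phi> ` {0..1})"
    by (intro compact_imp_bounded compact_continuous_image assms) auto
  then show "bounded (range (\<lambda>x. \<phi> (u x)))"
    by (rule bounded_subset) (auto simp: u_pos u_le less_imp_le)
qed

text \<open>\<open>g k m\<close> tends to \<open>u ^ Suc k\<close> uniformly as \<epsilon> m tends
  to 0, and \<open>u x ^ Suc k - g k m x = \<epsilon> m * g (Suc k) m x\<close>. So convergence for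
  all \<open>g k m\<close> yields the power \<open>Suc k\<close>, and both together yield all
  \<open>g (Suc k) m\<close>. Dividing by \<epsilon> m is harmless because m is fixed while n
  grows.\<close>

private lemma u_powers:
  fixes \<epsilon> :: "nat \<Rightarrow> real"
  assumes \<epsilon>: "\<And>m. 0 < \<epsilon> m" "\<epsilon> \<longlonglongrightarrow> 0"
    and kernel: "\<And>m. integrals_converge \<mu> \<nu> (\<lambda>x. u x / (1 + \<epsilon> m * u x))"
  shows "integrals_converge \<mu> \<nu> (\<lambda>x. u x ^ k)"
proof -
  define g where "g k m x = u x ^ Suc k / (1 + \<epsilon> m * u x)" for k m x
  have pos: "1 + \<epsilon> m * u x > 0" for m x
    using \<epsilon>(1)[of m] u_pos[of x] by (simp add: add_pos_pos)
  have power_if: "integrals_converge \<mu> \<nu> (\<lambda>x. u x ^ Suc k)"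
    if "\<And>m. integrals_converge \<mu> \<nu> (g k m)" for k
  proof (rule integrals_converge_uniform)
    have "continuous_on {0..1} (\<lambda>v::real. v ^ Suc k)" by (intro continuous_intros)
    from comp_u_ok[OF this]
    show "(\<lambda>x. u x ^ Suc k) \<in> borel_measurable borel" "bounded (range (\<lambda>x. u x ^ Suc k))" .
    fix e :: real assume "e > 0"
    then obtain m where m: "\<epsilon> m < e"
      using order_tendstoD(2)[OF \<epsilon>(2)] by (auto simp: eventually_sequentially)
    have "\<bar>u x ^ Suc k - g k m x\<bar> \<le> e" for x
    proof -
      have "u x ^ Suc k - g k m x = \<epsilon> m * (u x ^ Suc (Suc k) / (1 + \<epsilon> m * u x))"
        using pos[of m x] by (simp add: g_def field_simps)
      moreover have "0 \<le> u x ^ Suc (Suc k) / (1 + \<epsilon> m * u x)"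
        using pos[of m x] u_pos[of x] by (intro divide_nonneg_nonneg zero_le_power) auto
      moreover have "u x ^ Suc (Suc k) / (1 + \<epsilon> m * u x) \<le> 1 / 1"
        using \<epsilon>(1)[of m] u_pos[of x] u_le[of x] pos[of m x]
        by (intro frac_le power_le_one) auto
      ultimately have "0 \<le> u x ^ Suc k - g k m x" "u x ^ Suc k - g k m x \<le> \<epsilon> m"
        using \<epsilon>(1)[of m] mult_left_le[of "u x ^ Suc (Suc k) / (1 + \<epsilon> m * u x)" "\<epsilon> m"]
        by (simp_all only: mult_nonneg_nonneg less_imp_le)
      then show ?thesis using m by linarith
    qed
    then show "\<exists>h. integrals_converge \<mu> \<nu> h \<and> (\<forall>x. \<bar>u x ^ Suc k - h x\<bar> \<le> e)"
      using that[of m] by blast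
  qed
  have "\<forall>m. integrals_converge \<mu> \<nu> (g k m)" for k
  proof (induction k)
    case 0
    show ?case using kernel by (simp add: g_def[abs_def])
  next
    case (Suc k)
    have eq: "g (Suc k) m = (\<lambda>x. (1 / \<epsilon> m) * u x ^ Suc k + (- 1 / \<epsilon> m) * g k m x)" for m
    proof
      fix x
      show "g (Suc k) m x = (1 / \<epsilon> m) * u x ^ Suc k + (- 1 / \<epsilon> m) * g k m x"
        using pos[of m x] \<epsilon>(1)[of m] by (simp add: g_def divide_simps) (simp add: algebra_simps)
    qed
    have "integrals_converge \<mu> \<nu> (\<lambda>x. u x ^ Suc k)" using power_if Suc.IH by blast
    then show ?case unfolding eq using integrals_converge_linear Suc.IH by blast
  qed
  then show ?thesis using power_if integrals_converge_const[of 1] by (cases k) auto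
qed

private lemma u_continuous:
  assumes powers: "\<And>k. integrals_converge \<mu> \<nu> (\<lambda>x. u x ^ k)" and \<phi>: "continuous_on {0..1} \<phi>"
  shows "integrals_converge \<mu> \<nu> (\<lambda>x. \<phi> (u x))"
proof (rule integrals_converge_uniform[OF comp_u_ok[OF \<phi>]])
  fix e :: real assume "e > 0"
  obtain P where P: "real_polynomial_function P" "\<And>x. x \<in> {0..1} \<Longrightarrow> \<bar>\<phi> x - P x\<bar> < e"
    using Stone_Weierstrass_real_polynomial_function[of "{0..1}" \<phi> e] \<phi> \<open>e > 0\<close> by auto
  obtain a N where a: "P = (\<lambda>x. \<Sum>i\<le>N. a i * x ^ i)"
    using P(1) by (auto simp: real_polynomial_function_iff_sum)
  have "integrals_converge \<mu> \<nu> (\<lambda>x. \<Sum>i\<le>N. a i * u x ^ i)" for N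
  proof (induction N)
    case 0
    then show ?case using integrals_converge_const by simp
  next
    case (Suc N)
    then show ?case using integrals_converge_linear[OF Suc powers[of "Suc N"], of 1 "a (Suc N)"] by simp
  qed
  then have "integrals_converge \<mu> \<nu> (\<lambda>x. P (u x))" unfolding a by simp
  moreover have "\<forall>x. \<bar>\<phi> (u x) - P (u x)\<bar> \<le> e"
    using P(2) u_pos u_le by (simp add: less_imp_le)
  ultimately show "\<exists>h. integrals_converge \<mu> \<nu> h \<and> (\<forall>x. \<bar>\<phi> (u x) - h x\<bar> \<le> e)" by blast
qed

text \<open>The kernel at t = 1 + \<epsilon> is u / (1 + \<epsilon> u), which starts the extraction
  of powers. This settles continuous functions of u on [0, 1], but a bounded continuous f need not
  have a limit as u tends to 0, that is, at infinity. It is therefore damped by the factor u / (u +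
  \<epsilon>), and the error near u = 0 is controlled under \<nu>.\<close>

lemma converges_weakly_if_stieltjes_converges:
  fixes \<epsilon> :: "nat \<Rightarrow> real"
  assumes nonneg: "\<And>n. AE x in \<mu> n. 0 \<le> x" "AE x in \<nu>. 0 \<le> x"
    and \<epsilon>: "\<And>m. 0 < \<epsilon> m" "\<epsilon> \<longlonglongrightarrow> 0"
    and conv: "\<And>m. (\<lambda>n. \<integral>x. 1 / (x + (1 + \<epsilon> m)) \<partial>\<mu> n) \<longlonglongrightarrow> (\<integral>x. 1 / (x + (1 + \<epsilon> m)) \<partial>\<nu>)"
  shows "converges_weakly \<mu> \<nu>"
  unfolding converges_weakly_def
proof (intro allI impI)
  fix f :: "real \<Rightarrow> real" assume f: "continuous_on UNIV f" "bounded (range f)"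
  obtain B where B: "\<And>x. \<bar>f x\<bar> \<le> B" using f(2) by (auto simp: bounded_iff)
  have "B \<ge> 0" using B[of 0] by linarith
  have sets: "sets (\<mu> n) = sets borel" "sets \<nu> = sets borel" for n
    using \<mu> \<nu> by (simp_all add: real_distribution_def real_distribution_axioms_def)
  note [measurable_cong] = sets
  have [measurable]: "f \<in> borel_measurable borel" using f(1) by (rule borel_measurable_continuous_onI)
  have kernel: "integrals_converge \<mu> \<nu> (\<lambda>x. u x / (1 + \<epsilon> m * u x))" for m
  proof -
    have pos: "1 + \<epsilon> m * v \<noteq> 0" if "0 \<le> v" for v
      using \<epsilon>(1)[of m] that by (simp add: add_nonneg_eq_0_iff)
    have eq: "u x / (1 + \<epsilon> m * u x) = 1 / (x + (1 + \<epsilon> m))" if "0 \<le> x" for x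
      using that \<epsilon>(1)[of m] by (simp add: u_def field_simps)
    have 1: "(\<integral>x. u x / (1 + \<epsilon> m * u x) \<partial>\<mu> n) = (\<integral>x. 1 / (x + (1 + \<epsilon> m)) \<partial>\<mu> n)" for n
      by (intro integral_cong_AE) (use nonneg(1)[of n] in \<open>auto simp: eq\<close>)
    have 2: "(\<integral>x. u x / (1 + \<epsilon> m * u x) \<partial>\<nu>) = (\<integral>x. 1 / (x + (1 + \<epsilon> m)) \<partial>\<nu>)"
      by (intro integral_cong_AE) (use nonneg(2) in \<open>auto simp: eq\<close>)
    have "continuous_on {0..1} (\<lambda>v. v / (1 + \<epsilon> m * v))"
      using pos by (intro continuous_intros) auto
    from comp_u_ok[OF this] show ?thesis using conv by (simp add: integrals_converge_def 1 2)
  qed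
  note cont = u_continuous[OF u_powers[OF \<epsilon> kernel]]
  \<comment> \<open>\<open>F\<close> is \<open>u * f\<close> in the variable v = u: the factor v
    forces the limit 0 at v = 0 because f is bounded, and 1 / v - 1 inverts u.\<close>
  define F where "F v = (if v = 0 then 0 else v * f (1 / v - 1))" for v :: real
  have F0: "F 0 = 0" by (simp add: F_def)
  have F_cont: "continuous_on {0..1} F"
    unfolding continuous_on_eq_continuous_within
  proof
    fix v :: real assume v: "v \<in> {0..1}"
    show "continuous (at v within {0..1}) F"
    proof (cases "v = 0")
      case False
      have "continuous_on {0<..} (\<lambda>v. v * f (1 / v - 1))"
        by (intro continuous_intros continuous_on_compose2[OF f(1)]) auto
      then have "continuous_on {0<..} F"
        by (subst continuous_on_cong[OF refl, of _ F "\<lambda>v. v * f (1 / v - 1)"]) (auto simp: F_def)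
      then have "isCont F v"
        using v False by (auto simp: continuous_on_eq_continuous_at)
      then show ?thesis by (rule continuous_at_imp_continuous_within)
    next
      case True
      have "(F \<longlongrightarrow> 0) (at 0 within {0..1})"
      proof (rule Lim_null_comparison)
        show "eventually (\<lambda>v. norm (F v) \<le> B * v) (at 0 within {0..1})"
          using B by (auto simp: eventually_at F_def abs_mult mult.commute[of B] intro!: exI[of _ 1] mult_left_mono)
        show "((\<lambda>v. B * v) \<longlongrightarrow> 0) (at 0 within {0..1})" by (auto intro!: tendsto_eq_intros)
      qed
      then show ?thesis using True by (simp add: continuous_within F0)
    qed
  qed
  \<comment> \<open>The map u is constant on the negative half-line, so f is made constant there as
    well; all the measures ignore that half-line.\<close>
  define f' where "f' x = f (max 0 x)" for x
  have f'_cont: "continuous_on UNIV f'" unfolding f'_def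
    by (intro continuous_on_compose2[OF f(1)] continuous_intros) auto
  have F_u: "F (u x) = u x * f' x" for x
    using u_pos[of x] by (simp add: F_def f'_def) (simp add: u_def)
  have "integrals_converge \<mu> \<nu> f'"
  proof (rule integrals_converge_sandwich)
    show "f' \<in> borel_measurable borel" using f'_cont by (rule borel_measurable_continuous_onI)
    show "bounded (range f')" using f(2) by (rule bounded_subset) (auto simp: f'_def)
    fix e :: real assume "e > 0"
    \<comment> \<open>At every real x, u is positive, hence the integrand tends to 0 pointwise,
      dominated by B. This is where it matters that \<nu> has no mass at infinity.\<close>
    have lim: "(\<lambda>m. \<integral>x. B * (\<epsilon> m / (u x + \<epsilon> m)) \<partial>\<nu>) \<longlonglongrightarrow> (\<integral>x. 0 \<partial>\<nu>)"
    proof (rule integral_dominated_convergence[where w = "\<lambda>_. B"])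
      show "integrable \<nu> (\<lambda>_. B)" by (intro int_\<nu>) auto
      show "AE x in \<nu>. (\<lambda>m. B * (\<epsilon> m / (u x + \<epsilon> m))) \<longlonglongrightarrow> 0"
      proof (intro AE_I2)
        fix x
        show "(\<lambda>m. B * (\<epsilon> m / (u x + \<epsilon> m))) \<longlonglongrightarrow> 0"
          using u_pos[of x] by (auto intro!: tendsto_eq_intros \<epsilon>(2))
      qed
      show "AE x in \<nu>. norm (B * (\<epsilon> m / (u x + \<epsilon> m))) \<le> B" for m
      proof (intro AE_I2)
        fix x
        have "0 \<le> \<epsilon> m / (u x + \<epsilon> m)" "\<epsilon> m / (u x + \<epsilon> m) \<le> 1"
          using \<epsilon>(1)[of m] u_pos[of x] by (auto simp: divide_simps)
        then show "norm (B * (\<epsilon> m / (u x + \<epsilon> m))) \<le> B"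
          using \<open>B \<ge> 0\<close> mult_left_le[of "\<epsilon> m / (u x + \<epsilon> m)" B] by (simp only: real_norm_def abs_of_nonneg mult_nonneg_nonneg)
      qed
    qed (measurable)
    then have "eventually (\<lambda>m. (\<integral>x. B * (\<epsilon> m / (u x + \<epsilon> m)) \<partial>\<nu>) < e) sequentially"
      using \<open>e > 0\<close> by (intro order_tendstoD(2)[OF lim]) auto
    then obtain m where m: "(\<integral>x. B * (\<epsilon> m / (u x + \<epsilon> m)) \<partial>\<nu>) < e"
      by (auto simp: eventually_sequentially)
    have p: "v + \<epsilon> m \<noteq> 0" if "0 \<le> v" for v
      using \<epsilon>(1)[of m] that by (simp add: add_nonneg_eq_0_iff)
    have 1: "integrals_converge \<mu> \<nu> (\<lambda>x. F (u x) / (u x + \<epsilon> m))"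
      by (intro cont[of "\<lambda>v. F v / (v + \<epsilon> m)"] continuous_intros F_cont) (auto simp: p)
    have 2: "integrals_converge \<mu> \<nu> (\<lambda>x. B * (\<epsilon> m / (u x + \<epsilon> m)))"
      by (intro cont[of "\<lambda>v. B * (\<epsilon> m / (v + \<epsilon> m))"] continuous_intros) (auto simp: p)
    have 3: "\<bar>f' x - F (u x) / (u x + \<epsilon> m)\<bar> \<le> B * (\<epsilon> m / (u x + \<epsilon> m))" for x
    proof -
      have "f' x - F (u x) / (u x + \<epsilon> m) = f' x * (\<epsilon> m / (u x + \<epsilon> m))"
        using \<epsilon>(1)[of m] u_pos[of x] by (simp add: F_u field_simps)
      moreover have "0 \<le> \<epsilon> m / (u x + \<epsilon> m)" using \<epsilon>(1)[of m] u_pos[of x] by simp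
      ultimately show ?thesis using B[of "max 0 x"]
        by (simp only: abs_mult f'_def mult_right_mono abs_of_nonneg)
    qed
    show "\<exists>h k. integrals_converge \<mu> \<nu> h \<and> integrals_converge \<mu> \<nu> k \<and>
        (\<forall>x. \<bar>f' x - h x\<bar> \<le> k x) \<and> (\<integral>x. k x \<partial>\<nu>) < e"
      using 1 2 3 m by blast
  qed
  moreover have "(\<integral>x. f' x \<partial>\<mu> n) = (\<integral>x. f x \<partial>\<mu> n)" for n
    by (intro integral_cong_AE) (use nonneg(1)[of n] in \<open>auto simp: f'_def[abs_def] max_def\<close>)
  moreover have "(\<integral>x. f' x \<partial>\<nu>) = (\<integral>x. f x \<partial>\<nu>)"
    by (intro integral_cong_AE) (use nonneg(2) in \<open>auto simp: f'_def[abs_def] max_def\<close>)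
  ultimately show "(\<lambda>n. \<integral>x. f x \<partial>\<mu> n) \<longlonglongrightarrow> (\<integral>x. f x \<partial>\<nu>)"
    by (simp add: integrals_converge_def)
qed

end

section \<open>The Stieltjes transform of the Marchenko--Pastur distribution\<close>

text \<open>With Q = (b - x)(x - a), expanding in powers of x + t gives Q = -(x + t)^2 + 2 (m + t)(x
  + t) - (a + t)(b + t). Division by (x + t) sqrt Q leaves three elementary terms, whose primitives
  are \<open>sqrt (Q x)\<close> and the two arcsines in \<open>F\<close>. For a + t > 0 the Moebius
  map \<open>w\<close> sends a to -1 and b to 1. The boundary case a + t = 0 occurs at the hard
  edge, y = 1 and t = 0.\<close>

lemma has_integral_semicircle_over_linear:
  fixes a b t :: real
  assumes ab: "a < b" and at: "0 \<le> a + t"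
  shows "((\<lambda>x. sqrt ((b - x) * (x - a)) / (x + t)) has_integral
    pi * ((a + b) / 2 + t - sqrt ((a + t) * (b + t)))) {a..b}"
proof -
  define m r c where "m = (a + b) / 2" and "r = (b - a) / 2" and "c = sqrt ((a + t) * (b + t))"
  define Q where "Q x = (b - x) * (x - a)" for x
  define w where "w x = ((m + t) * (x + t) - (a + t) * (b + t)) / (r * (x + t))" for x
  define F where "F x = sqrt (Q x) + (m + t) * arcsin ((x - m) / r) - c * arcsin (w x)" for x
  have r: "r > 0" using ab by (simp add: r_def)
  have Q_pos: "Q x > 0" if "x \<in> {a<..<b}" for x using that by (simp add: Q_def)
  have d1: "1 - ((x - m) / r)\<^sup>2 = Q x / r\<^sup>2" for x
  proof -
    have "r\<^sup>2 - (x - m)\<^sup>2 = Q x"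
      unfolding r_def m_def Q_def power2_eq_square by (simp add: field_simps)
    moreover have "r\<^sup>2 / r\<^sup>2 = 1" using r by simp
    ultimately show ?thesis by (metis diff_divide_distrib power_divide)
  qed
  have d2: "1 - (w x)\<^sup>2 = (a + t) * (b + t) * Q x / (r * (x + t))\<^sup>2" if "x + t \<noteq> 0" for x
  proof -
    have "(r * (x + t))\<^sup>2 - ((m + t) * (x + t) - (a + t) * (b + t))\<^sup>2 = (a + t) * (b + t) * Q x"
      unfolding r_def m_def Q_def power2_eq_square by (simp add: field_simps)
    moreover have "(r * (x + t))\<^sup>2 / (r * (x + t))\<^sup>2 = 1" using r that by simp
    ultimately show ?thesis unfolding w_def by (metis diff_divide_distrib power_divide)
  qed
  have arg_less: "\<bar>v\<bar> < 1" if "1 - v\<^sup>2 > 0" for v :: real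
    using that by (simp add: abs_square_less_1)
  have arg_le: "-1 \<le> v \<and> v \<le> 1" if "1 - v\<^sup>2 \<ge> 0" for v :: real
  proof -
    have "\<bar>v\<bar> \<le> 1" using that by (simp add: abs_square_le_1)
    then show ?thesis by linarith
  qed
  have Q_nonneg: "Q x \<ge> 0" if "x \<in> {a..b}" for x using that by (simp add: Q_def)
  have cont: "continuous_on {a..b} F"
  proof (cases "a + t = 0")
    case True
    \<comment> \<open>Here c = 0 removes the arcsine of \<open>w\<close>, which jumps at x =
      a.\<close>
    then have "F = (\<lambda>x. sqrt (Q x) + (m + t) * arcsin ((x - m) / r))" by (simp add: F_def c_def fun_eq_iff)
    moreover have "continuous_on {a..b} (\<lambda>x. sqrt (Q x) + (m + t) * arcsin ((x - m) / r))"
      using r Q_nonneg by (intro continuous_intros ballI arg_le) (auto simp: Q_def d1 intro!: continuous_intros)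
    ultimately show ?thesis by simp
  next
    case False
    then have pos: "x + t > 0" if "x \<in> {a..b}" for x using that at by simp
    have w_cont: "continuous_on {a..b} w" unfolding w_def
      using r pos by (intro continuous_intros) (fastforce simp: less_imp_neq)
    have w_le: "-1 \<le> w x \<and> w x \<le> 1" if "x \<in> {a..b}" for x
    proof -
      have "0 \<le> (a + t) * (b + t)" using at ab by simp
      then have "0 \<le> 1 - (w x)\<^sup>2"
        using d2[of x] pos[OF that] Q_nonneg[OF that] by simp
      then show ?thesis by (rule arg_le)
    qed
    have c1: "continuous_on {a..b} (\<lambda>x. arcsin ((x - m) / r))"
      using r Q_nonneg by (intro continuous_intros ballI arg_le) (auto simp: d1)
    have c2: "continuous_on {a..b} (\<lambda>x. arcsin (w x))"
      by (intro continuous_on_arcsin w_cont ballI w_le)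
    have "continuous_on {a..b} Q" unfolding Q_def by (intro continuous_intros)
    then show ?thesis unfolding F_def by (intro continuous_intros c1 c2)
  qed
  have deriv: "(F has_vector_derivative sqrt (Q x) / (x + t)) (at x)" if x: "x \<in> {a<..<b}" for x
  proof -
    have xt: "x + t > 0" using x at by simp
    have Qx: "Q x > 0" "sqrt (Q x) > 0" using Q_pos[OF x] by auto
    have "\<bar>(x - m) / r\<bar> < 1" by (rule arg_less) (use d1 Qx r in simp)
    then have lt1: "- 1 < (x - m) / r" "(x - m) / r < 1" by linarith+
    have D0: "((\<lambda>x. sqrt (Q x)) has_real_derivative (m - x) / sqrt (Q x)) (at x)"
    proof -
      have "(Q has_real_derivative 2 * (m - x)) (at x)"
        unfolding Q_def by (auto intro!: derivative_eq_intros simp: m_def)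
      from DERIV_chain2[OF DERIV_real_sqrt[OF Qx(1)] this] show ?thesis
        by (rule back_subst[where P = "\<lambda>d. (_ has_real_derivative d) _"]) (use Qx in \<open>simp add: field_simps\<close>)
    qed
    have D1: "((\<lambda>x. arcsin ((x - m) / r)) has_real_derivative 1 / sqrt (Q x)) (at x)"
    proof -
      have "((\<lambda>x. arcsin ((x - m) / r)) has_real_derivative inverse (sqrt (1 - ((x - m) / r)\<^sup>2)) * (1 / r)) (at x)"
        by (rule DERIV_chain2[OF DERIV_arcsin])
          (use lt1 r in \<open>auto intro!: derivative_eq_intros simp del: less_divide_eq_1 divide_less_eq_1\<close>)
      also have "inverse (sqrt (1 - ((x - m) / r)\<^sup>2)) * (1 / r) = 1 / sqrt (Q x)"
        unfolding d1 using r by (simp add: real_sqrt_divide field_simps)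
      finally show ?thesis .
    qed
    have D2: "((\<lambda>x. c * arcsin (w x)) has_real_derivative ((a + t) * (b + t)) / ((x + t) * sqrt (Q x))) (at x)"
    proof (cases "a + t = 0")
      case True
      then show ?thesis by (simp add: c_def)
    next
      case False
      then have ab_pos: "(a + t) * (b + t) > 0" using at ab by simp
      then have c: "c > 0" "c * c = (a + t) * (b + t)" by (auto simp: c_def)
      have lt: "\<bar>w x\<bar> < 1" by (rule arg_less) (use d2[of x] ab_pos Qx r xt in simp)
      have sq: "sqrt (1 - (w x)\<^sup>2) = c * sqrt (Q x) / (r * (x + t))"
        using d2[of x] xt r by (simp add: real_sqrt_divide real_sqrt_mult c_def)
      have Dw: "(w has_real_derivative (a + t) * (b + t) / (r * (x + t)\<^sup>2)) (at x)"
      proof -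
        have "(w has_real_derivative ((m + t) * (r * (x + t)) - ((m + t) * (x + t) - (a + t) * (b + t)) * r)
            / (r * (x + t) * (r * (x + t)))) (at x)"
          unfolding w_def using r xt by (auto intro!: derivative_eq_intros)
        moreover have "(m + t) * (r * (x + t)) - ((m + t) * (x + t) - (a + t) * (b + t)) * r
            = r * ((a + t) * (b + t))" by (simp add: algebra_simps)
        ultimately show ?thesis using r by (simp add: power2_eq_square mult_ac)
      qed
      have "((\<lambda>x. c * arcsin (w x)) has_real_derivative
          c * (inverse (sqrt (1 - (w x)\<^sup>2)) * ((a + t) * (b + t) / (r * (x + t)\<^sup>2)))) (at x)"
        by (intro DERIV_cmult DERIV_chain2[OF DERIV_arcsin] Dw) (use lt in linarith)+
      also have "c * (inverse (sqrt (1 - (w x)\<^sup>2)) * ((a + t) * (b + t) / (r * (x + t)\<^sup>2)))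
          = (a + t) * (b + t) / ((x + t) * sqrt (Q x))"
        unfolding sq using c(1) r xt Qx by (simp add: divide_simps power2_eq_square)
      finally show ?thesis .
    qed
    have "(F has_real_derivative (m - x) / sqrt (Q x) + (m + t) * (1 / sqrt (Q x))
        - ((a + t) * (b + t)) / ((x + t) * sqrt (Q x))) (at x)"
      unfolding F_def by (intro DERIV_diff DERIV_add DERIV_cmult D0 D1 D2)
    also have "(m - x) / sqrt (Q x) + (m + t) * (1 / sqrt (Q x)) - ((a + t) * (b + t)) / ((x + t) * sqrt (Q x))
        = sqrt (Q x) / (x + t)"
    proof -
      have "(m - x) * (x + t) + (m + t) * (x + t) - (a + t) * (b + t) = Q x"
        by (simp add: m_def Q_def field_simps)
      also have "\<dots> = sqrt (Q x) * sqrt (Q x)" using Qx by simp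
      finally show ?thesis using xt Qx(2) by (simp add: divide_simps) (simp add: algebra_simps)
    qed
    finally show ?thesis by (simp add: has_real_derivative_iff_has_vector_derivative)
  qed
  have "F b - F a = pi * (m + t - c)"
  proof -
    have Q0: "Q a = 0" "Q b = 0" by (simp_all add: Q_def)
    have m1: "(b - m) / r = 1" "(a - m) / r = -1" using ab by (simp_all add: m_def r_def field_simps)
    have W: "c * arcsin (w b) = c * (pi / 2)" "c * arcsin (w a) = - c * (pi / 2)"
    proof -
      have "w b = 1" using at ab
        by (simp add: w_def m_def r_def divide_simps) (simp add: algebra_simps)
      then show "c * arcsin (w b) = c * (pi / 2)" by (simp only: arcsin_1)
      show "c * arcsin (w a) = - c * (pi / 2)"
      proof (cases "a + t = 0")
        case False
        then have "w a = -1" using ab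
          by (simp add: w_def m_def r_def divide_simps) (simp add: algebra_simps)
        then show ?thesis by simp
      qed (simp add: c_def)
    qed
    then show ?thesis unfolding F_def Q0 m1 W by (simp add: algebra_simps)
  qed
  moreover have "((\<lambda>x. sqrt (Q x) / (x + t)) has_integral F b - F a) {a..b}"
    using ab cont deriv by (intro fundamental_theorem_of_calculus_interior) auto
  ultimately show ?thesis by (simp add: Q_def m_def c_def)
qed

text \<open>The measure is only given by its values on sets, so the splitting into density and atom
  is carried over to integrals by induction on the integrand.\<close>

lemma nn_integral_marchenko_pastur:
  assumes "f \<in> borel_measurable borel"
  shows "(\<integral>\<^sup>+x. f x \<partial>marchenko_pastur y) =
    (\<integral>\<^sup>+x. ennreal (marchenko_pastur_density y x) * f x \<partial>lborel) +
    ennreal (if y > 1 then 1 - 1 / y else 0) * f 0"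
proof -
  let ?c = "ennreal (if y > 1 then 1 - 1 / y else 0)"
  have [measurable]: "marchenko_pastur_density y \<in> borel_measurable borel"
    unfolding marchenko_pastur_density_def[abs_def] Let_def by measurable
  have [measurable_cong]: "sets (marchenko_pastur y) = sets borel" by simp
  let ?D = "\<lambda>f. (\<integral>\<^sup>+x. ennreal (marchenko_pastur_density y x) * f x \<partial>lborel)"
  from assms show ?thesis
  proof (induction f rule: borel_measurable_induct)
    case (cong f g)
    then show ?case by (simp cong: nn_integral_cong add: fun_eq_iff[symmetric])
  next
    case (set A)
    then show ?case
      by (simp add: emeasure_marchenko_pastur emeasure_density)
  next
    case (mult u r)
    then have [measurable]: "u \<in> borel_measurable borel" by simp
    have "?D (\<lambda>x. r * u x) = r * ?D u"
      by (subst nn_integral_cmult[symmetric]) (auto simp: mult_ac)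
    moreover have "(\<integral>\<^sup>+x. r * u x \<partial>marchenko_pastur y) = r * (\<integral>\<^sup>+x. u x \<partial>marchenko_pastur y)"
      by (rule nn_integral_cmult) measurable
    ultimately show ?case using mult.IH by (simp add: distrib_left mult_ac)
  next
    case (add u v)
    then have [measurable]: "u \<in> borel_measurable borel" "v \<in> borel_measurable borel" by simp_all
    have "?D (\<lambda>x. v x + u x) = ?D v + ?D u"
      by (subst nn_integral_add[symmetric]) (auto simp: distrib_left)
    moreover have "(\<integral>\<^sup>+x. v x + u x \<partial>marchenko_pastur y)
        = (\<integral>\<^sup>+x. v x \<partial>marchenko_pastur y) + (\<integral>\<^sup>+x. u x \<partial>marchenko_pastur y)"
      by (rule nn_integral_add) measurable
    ultimately show ?case using add.IH by (simp add: distrib_left add_ac)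
  next
    case (seq U)
    then have U [measurable]: "\<And>i. U i \<in> borel_measurable borel" by simp
    have Sup: "(SUP i. U i) x = (SUP i. U i x)" for x by (simp add: image_comp)
    have "?D (\<lambda>x. SUP i. U i x) = (SUP i. ?D (U i))"
      using seq(3) by (subst nn_integral_monotone_convergence_SUP[symmetric])
        (auto simp: SUP_mult_left_ennreal incseq_def le_fun_def intro!: mult_left_mono)
    moreover have "(\<integral>\<^sup>+x. (SUP i. U i x) \<partial>marchenko_pastur y) = (SUP i. (\<integral>\<^sup>+x. U i x \<partial>marchenko_pastur y))"
      using seq(3) by (intro nn_integral_monotone_convergence_SUP) auto
    moreover have "(SUP i. ?D (U i)) + (SUP i. ?c * U i 0) = (SUP i. ?D (U i) + ?c * U i 0)"
      using seq(3) by (intro ennreal_SUP_add[symmetric])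
        (auto simp: incseq_def le_fun_def intro!: mult_left_mono nn_integral_mono)
    ultimately show ?case using seq.IH unfolding Sup by (simp add: SUP_mult_left_ennreal)
  qed
qed

text \<open>The square root vanishes at both edges, so the support can be taken closed, which
  matches integration over \<open>{a..b}\<close>.\<close>

lemma marchenko_pastur_density_eq:
  assumes "y > 0"
  shows "marchenko_pastur_density y x = (if x \<in> {(1 - sqrt y)\<^sup>2..(1 + sqrt y)\<^sup>2}
    then sqrt (((1 + sqrt y)\<^sup>2 - x) * (x - (1 - sqrt y)\<^sup>2)) / (2 * pi * y * x) else 0)"
  unfolding marchenko_pastur_density_def Let_def
  by (cases "x = (1 - sqrt y)\<^sup>2 \<or> x = (1 + sqrt y)\<^sup>2") (auto simp: indicator_def mult_ac)

lemma marchenko_pastur_edges: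
  assumes "y > 0"
  shows "(1 - sqrt y)\<^sup>2 < (1 + sqrt y)\<^sup>2"
    and "(1 - sqrt y)\<^sup>2 + (1 + sqrt y)\<^sup>2 = 2 * (1 + y)"
    and "(1 - sqrt y)\<^sup>2 * (1 + sqrt y)\<^sup>2 = (1 - y)\<^sup>2"
proof -
  have s: "sqrt y > 0" "(sqrt y)\<^sup>2 = y" using assms by simp_all
  show "(1 - sqrt y)\<^sup>2 < (1 + sqrt y)\<^sup>2" using s by (simp add: power2_eq_square algebra_simps)
  show "(1 - sqrt y)\<^sup>2 + (1 + sqrt y)\<^sup>2 = 2 * (1 + y)"
    using s by (simp add: power2_sum power2_diff)
  have "(1 - sqrt y)\<^sup>2 * (1 + sqrt y)\<^sup>2 = (1 - (sqrt y)\<^sup>2)\<^sup>2"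
    by (simp add: power2_eq_square algebra_simps)
  then show "(1 - sqrt y)\<^sup>2 * (1 + sqrt y)\<^sup>2 = (1 - y)\<^sup>2" using s by simp
qed

lemma has_integral_marchenko_pastur_kernel:
  assumes y: "y > 0" and t: "0 \<le> t"
  shows "((\<lambda>x. sqrt (((1 + sqrt y)\<^sup>2 - x) * (x - (1 - sqrt y)\<^sup>2)) / (x + t)) has_integral
    pi * (1 + y + t - sqrt ((t + 1 - y)\<^sup>2 + 4 * y * t))) {(1 - sqrt y)\<^sup>2..(1 + sqrt y)\<^sup>2}"
proof -
  let ?a = "(1 - sqrt y)\<^sup>2" and ?b = "(1 + sqrt y)\<^sup>2"
  note e = marchenko_pastur_edges[OF y]
  have "(?a + t) * (?b + t) = ?a * ?b + (?a + ?b) * t + t\<^sup>2"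
    by (simp add: power2_eq_square algebra_simps)
  also have "\<dots> = (t + 1 - y)\<^sup>2 + 4 * y * t"
    unfolding e by (simp add: power2_eq_square algebra_simps)
  finally have prod: "(?a + t) * (?b + t) = (t + 1 - y)\<^sup>2 + 4 * y * t" .
  have half: "(?a + ?b) / 2 = 1 + y" unfolding e by simp
  show ?thesis
    using has_integral_semicircle_over_linear[OF e(1), of t] t
    unfolding prod half by simp
qed

lemma marchenko_pastur_density_nonneg:
  assumes "y > 0"
  shows "0 \<le> marchenko_pastur_density y x"
  using assms order_trans[OF zero_le_power2[of "1 - sqrt y"], of x]
  by (auto simp: marchenko_pastur_density_eq intro!: divide_nonneg_nonneg mult_nonneg_nonneg)

lemma borel_measurable_marchenko_pastur [simp]:
  "borel_measurable (marchenko_pastur y) = borel_measurable borel"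
  by (rule measurable_cong_sets) simp_all

lemma nn_integral_lborel_interval:
  fixes f g :: "real \<Rightarrow> real"
  assumes "g \<in> borel_measurable borel" "(f has_integral I) {a..b}"
    and "\<And>x. x \<in> {a..b} \<Longrightarrow> g x = f x" "\<And>x. x \<notin> {a..b} \<Longrightarrow> g x = 0"
    and "\<And>x. 0 \<le> g x"
  shows "(\<integral>\<^sup>+x. ennreal (g x) \<partial>lborel) = ennreal I"
proof (rule nn_integral_has_integral_lborel)
  have "(g has_integral I) {a..b}" using assms(2,3) has_integral_cong[of "{a..b}" g f I] by blast
  then have "((\<lambda>x. if x \<in> {a..b} then g x else 0) has_integral I) UNIV"
    by (simp only: has_integral_restrict_UNIV)
  moreover have "(\<lambda>x. if x \<in> {a..b} then g x else 0) = g" using assms(4) by auto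
  ultimately show "(g has_integral I) UNIV" by simp
qed (use assms in auto)

text \<open>The kernel integral at t = 0 gives the continuous part the mass (1 + y - |1 - y|) / (2
  y), which is 1 for y <= 1 and 1 / y otherwise; the atom supplies the rest.\<close>

lemma real_distribution_marchenko_pastur:
  assumes y: "y > 0"
  shows "real_distribution (marchenko_pastur y)"
proof -
  have m: "marchenko_pastur_density y \<in> borel_measurable borel"
    unfolding marchenko_pastur_density_def[abs_def] Let_def by measurable
  have "((\<lambda>x. (1 / (2 * pi * y)) * (sqrt (((1 + sqrt y)\<^sup>2 - x) * (x - (1 - sqrt y)\<^sup>2)) / (x + 0))) has_integral
    (1 / (2 * pi * y)) * (pi * (1 + y + 0 - sqrt ((0 + 1 - y)\<^sup>2 + 4 * y * 0))))
      {(1 - sqrt y)\<^sup>2..(1 + sqrt y)\<^sup>2}"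
    by (intro has_integral_mult_right has_integral_marchenko_pastur_kernel y) simp
  moreover have "(1 / (2 * pi * y)) * (pi * (1 + y + 0 - sqrt ((0 + 1 - y)\<^sup>2 + 4 * y * 0)))
      = (1 + y - \<bar>1 - y\<bar>) / (2 * y)" using y by simp
  ultimately have hi: "((\<lambda>x. (1 / (2 * pi * y)) * (sqrt (((1 + sqrt y)\<^sup>2 - x) * (x - (1 - sqrt y)\<^sup>2)) / (x + 0)))
      has_integral (1 + y - \<bar>1 - y\<bar>) / (2 * y)) {(1 - sqrt y)\<^sup>2..(1 + sqrt y)\<^sup>2}" by simp
  have "(\<integral>\<^sup>+x. ennreal (marchenko_pastur_density y x) \<partial>lborel) = ennreal ((1 + y - \<bar>1 - y\<bar>) / (2 * y))"
  proof (rule nn_integral_lborel_interval[OF m hi])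
    show "0 \<le> marchenko_pastur_density y x" for x
      using y by (rule marchenko_pastur_density_nonneg)
  qed (use y in \<open>auto simp: marchenko_pastur_density_eq\<close>)
  then have "emeasure (marchenko_pastur y) UNIV = ennreal ((1 + y - \<bar>1 - y\<bar>) / (2 * y))
      + ennreal (if y > 1 then 1 - 1 / y else 0)"
    using nn_integral_marchenko_pastur[of "\<lambda>_. 1" y] by (simp add: sets_eq_imp_space_eq[OF sets_marchenko_pastur])
  also have "\<dots> = 1"
    using y by (subst ennreal_plus[symmetric]) (auto simp: field_simps abs_if)
  finally show ?thesis
    by (auto intro!: real_distribution.intro prob_spaceI
      simp: real_distribution_axioms_def sets_eq_imp_space_eq[OF sets_marchenko_pastur])
qed

lemma AE_marchenko_pastur_nonneg:
  assumes y: "y > 0"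
  shows "AE x in marchenko_pastur y. 0 \<le> x"
proof -
  have "ennreal (marchenko_pastur_density y x) * indicator {..<0} x = 0" for x
    using order_trans[OF zero_le_power2[of "1 - sqrt y"], of x]
    by (auto simp: marchenko_pastur_density_eq[OF y] indicator_def)
  then have "(\<integral>\<^sup>+x. indicator {..<0} x \<partial>marchenko_pastur y) = 0"
    by (subst nn_integral_marchenko_pastur) (simp_all del: mult_eq_0_iff)
  then have "emeasure (marchenko_pastur y) {..<0} = 0"
    by (subst (asm) nn_integral_indicator) auto
  then show ?thesis
    by (intro AE_I[of _ _ "{..<0}"]) auto
qed

text \<open>The density contributes another 1 / x, and 1 / (x (x + t)) = (1 / x - 1 / (x + t)) / t
  reduces the integral to two kernel integrals, at 0 and at t. The absolute value in the proof makes
  the integrand nonnegative on the whole line, for the passage through \<open>ennreal\<close>; it is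
  dropped almost everywhere at the end.\<close>

lemma integral_marchenko_pastur_kernel:
  assumes y: "y > 0" and t: "t > 0"
  shows "(\<integral>x. 1 / (x + t) \<partial>marchenko_pastur y)
    = (sqrt ((t + 1 - y)\<^sup>2 + 4 * y * t) - (t + 1 - y)) / (2 * y * t)"
proof -
  let ?a = "(1 - sqrt y)\<^sup>2" and ?b = "(1 + sqrt y)\<^sup>2"
  let ?S = "\<lambda>x. sqrt ((?b - x) * (x - ?a))"
  let ?r = "sqrt ((t + 1 - y)\<^sup>2 + 4 * y * t)"
  let ?I = "(?r - t - \<bar>1 - y\<bar>) / (2 * y * t)"
  have m: "(\<lambda>x. marchenko_pastur_density y x * (1 / \<bar>x + t\<bar>)) \<in> borel_measurable borel"
    unfolding marchenko_pastur_density_def[abs_def] Let_def by measurable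
  \<comment> \<open>This keeps \<open>?I\<close> nonnegative, so that it can be added to the atom
    inside \<open>ennreal\<close>.\<close>
  have r: "?r \<ge> t + \<bar>1 - y\<bar>"
  proof (rule real_le_rsqrt)
    have "t * \<bar>1 - y\<bar> \<le> t * (1 + y)" using y t by (intro mult_left_mono) auto
    moreover have "\<bar>1 - y\<bar>\<^sup>2 = (1 - y)\<^sup>2" by simp
    ultimately show "(t + \<bar>1 - y\<bar>)\<^sup>2 \<le> (t + 1 - y)\<^sup>2 + 4 * y * t"
      by (simp add: power2_sum power2_diff algebra_simps)
  qed
  have "((\<lambda>x. (1 / (2 * pi * y * t)) * (?S x / (x + 0) - ?S x / (x + t))) has_integral
    (1 / (2 * pi * y * t)) * (pi * (1 + y + 0 - sqrt ((0 + 1 - y)\<^sup>2 + 4 * y * 0)) - pi * (1 + y + t - ?r))) {?a..?b}"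
    using t by (intro has_integral_mult_right has_integral_diff has_integral_marchenko_pastur_kernel y) simp_all
  moreover have "(1 / (2 * pi * y * t)) * (pi * (1 + y + 0 - sqrt ((0 + 1 - y)\<^sup>2 + 4 * y * 0)) - pi * (1 + y + t - ?r)) = ?I"
    using y t by (simp add: field_simps)
  ultimately have hi: "((\<lambda>x. (1 / (2 * pi * y * t)) * (?S x / (x + 0) - ?S x / (x + t))) has_integral ?I) {?a..?b}"
    by simp
  have "(\<integral>\<^sup>+x. ennreal (marchenko_pastur_density y x * (1 / \<bar>x + t\<bar>)) \<partial>lborel) = ennreal ?I"
  proof (rule nn_integral_lborel_interval[OF m hi])
    fix x
    show "0 \<le> marchenko_pastur_density y x * (1 / \<bar>x + t\<bar>)"
      using marchenko_pastur_density_nonneg[OF y] by simp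
    show "marchenko_pastur_density y x * (1 / \<bar>x + t\<bar>) = 1 / (2 * pi * y * t) * (?S x / (x + 0) - ?S x / (x + t))"
      if x: "x \<in> {?a..?b}"
    proof (cases "x = 0")
      \<comment> \<open>The point 0 is in the closed support only for y = 1; both sides are then 0,
        since division by 0 gives 0 and the root vanishes at the edge.\<close>
      case True
      then have "?a = 0" using x zero_le_power2[of "1 - sqrt y"] by auto
      then show ?thesis using True y by (simp add: marchenko_pastur_density_eq)
    next
      case False
      then have "x > 0" using x zero_le_power2[of "1 - sqrt y"] by (metis atLeastAtMost_iff order_less_le order_trans)
      then have "1 / (2 * pi * y * t) * (?S x / x - ?S x / (x + t)) = ?S x / (2 * pi * y * x) * (1 / (x + t))"
        using y t by (simp add: divide_simps) (simp add: algebra_simps)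
      then show ?thesis using y x t \<open>x > 0\<close> by (simp add: marchenko_pastur_density_eq)
    qed
  qed (use y in \<open>auto simp: marchenko_pastur_density_eq\<close>)
  moreover have "ennreal (marchenko_pastur_density y x * (1 / \<bar>x + t\<bar>))
      = ennreal (marchenko_pastur_density y x) * ennreal (1 / \<bar>x + t\<bar>)" for x
    using marchenko_pastur_density_nonneg[OF y] by (rule ennreal_mult')
  ultimately have "(\<integral>\<^sup>+x. ennreal (1 / \<bar>x + t\<bar>) \<partial>marchenko_pastur y) = ennreal ?I
      + ennreal (if y > 1 then 1 - 1 / y else 0) * ennreal (1 / t)"
    using t by (subst nn_integral_marchenko_pastur) (simp_all only: abs_of_pos add_0_left, measurable)
  also have "\<dots> = ennreal (?I + (if y > 1 then 1 - 1 / y else 0) * (1 / t))"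
    using r y t by (subst ennreal_mult[symmetric]) (auto simp: ennreal_plus[symmetric] simp del: ennreal_plus)
  also have "?I + (if y > 1 then 1 - 1 / y else 0) * (1 / t) = (?r - (t + 1 - y)) / (2 * y * t)"
    using y t by (simp add: field_simps abs_if)
  finally have "(\<integral>\<^sup>+x. ennreal (1 / \<bar>x + t\<bar>) \<partial>marchenko_pastur y) = ennreal ((?r - (t + 1 - y)) / (2 * y * t))" .
  moreover have "(?r - (t + 1 - y)) / (2 * y * t) \<ge> 0" using r y t by simp
  ultimately have "(\<integral>x. 1 / \<bar>x + t\<bar> \<partial>marchenko_pastur y) = (?r - (t + 1 - y)) / (2 * y * t)"
    by (subst integral_eq_nn_integral) auto
  moreover have "(\<integral>x. 1 / \<bar>x + t\<bar> \<partial>marchenko_pastur y) = (\<integral>x. 1 / (x + t) \<partial>marchenko_pastur y)"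
    by (intro integral_cong_AE) (use AE_marchenko_pastur_nonneg[OF y] t in auto)
  ultimately show ?thesis by simp
qed

section \<open>Spectrum and resolvent\<close>

lemma poly_eq_prod_mset_proots:
  fixes q :: "'a :: field poly"
  assumes "q \<noteq> 0" "size (proots q) = degree q"
  shows "q = Polynomial.smult (lead_coeff q) (\<Prod>x\<in>#proots q. [:- x, 1:])"
  using assms
proof (induction "degree q" arbitrary: q)
  case 0
  then obtain c where "q = [:c:]" by (metis degree_eq_zeroE)
  then show ?case by simp
next
  case (Suc d)
  then have "proots q \<noteq> {#}" by auto
  then obtain x where "x \<in># proots q" by blast
  then have "poly q x = 0" using Suc.prems by simp
  then obtain s where s: "q = [:- x, 1:] * s" by (metis dvd_def poly_eq_0_iff_dvd)
  then have "s \<noteq> 0" using Suc.prems by auto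
  have pq: "proots q = add_mset x (proots s)"
    unfolding s using \<open>s \<noteq> 0\<close> by (subst proots_mult) auto
  have dq: "degree q = Suc (degree s)"
    unfolding s using \<open>s \<noteq> 0\<close> by (subst degree_mult_eq) auto
  have "s = Polynomial.smult (lead_coeff s) (\<Prod>x\<in>#proots s. [:- x, 1:])"
    using Suc.hyps(1)[of s] Suc.hyps(2) Suc.prems(2) \<open>s \<noteq> 0\<close> pq dq by simp
  then have "[:- x, 1:] * s = [:- x, 1:] * Polynomial.smult (lead_coeff s) (\<Prod>x\<in>#proots s. [:- x, 1:])" by simp
  also have "\<dots> = Polynomial.smult (lead_coeff s) ([:- x, 1:] * (\<Prod>x\<in>#proots s. [:- x, 1:]))"
    by (rule mult_smult_right)
  also have "lead_coeff s = lead_coeff q" unfolding s lead_coeff_mult by simp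
  finally show ?case unfolding pq using s by simp
qed

text \<open>A Schur decomposition is obtained from a factorisation of the characteristic polynomial
  over an explicit list; choosing \<open>spectrum_list\<close> puts its entries on the diagonal in
  that order.\<close>

lemma char_poly_eq_prod_spectrum_list:
  assumes V: "V \<in> carrier_mat m m" "transpose_mat V = V"
  shows "char_poly V = (\<Prod>x\<leftarrow>spectrum_list V. [:- x, 1:])"
proof -
  have deg: "degree (char_poly V) = m" and monic: "lead_coeff (char_poly V) = 1"
    using degree_monic_char_poly[OF V(1)] by auto
  have mset: "mset (spectrum_list V) = proots (char_poly V)" by (simp add: spectrum_list_def)
  then have "size (proots (char_poly V)) = degree (char_poly V)"
    using length_spectrum_list[OF V] deg by (metis size_mset)
  moreover have "char_poly V \<noteq> 0" using monic by auto
  ultimately have "char_poly V = (\<Prod>x\<in>#proots (char_poly V). [:- x, 1:])"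
    using poly_eq_prod_mset_proots[of "char_poly V"] monic by simp
  then show ?thesis unfolding mset[symmetric] by (simp flip: prod_mset_prod_list)
qed

text \<open>The lower-left part of the inverse vanishes; this is shown column by column together with
  the formula for the diagonal.\<close>

lemma left_inverse_upper_triangular_diag:
  fixes B T :: "'a :: field mat"
  assumes B: "B \<in> carrier_mat m m" "upper_triangular B" and T: "T \<in> carrier_mat m m"
    and inv: "T * B = 1\<^sub>m m" and i: "i < m"
  shows "T $$ (i, i) * B $$ (i, i) = 1"
proof -
  have entry: "(\<Sum>k<m. T $$ (i, k) * B $$ (k, j)) = (if i = j then 1 else 0)" if "i < m" "j < m" for i j
  proof -
    have "(T * B) $$ (i, j) = (1\<^sub>m m :: 'a mat) $$ (i, j)" using inv by simp
    then show ?thesis using that B T by (simp add: scalar_prod_def atLeast0LessThan)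
  qed
  have "det T * det B = 1" using det_mult[OF T B(1)] inv by simp
  then have "prod_list (diag_mat B) \<noteq> 0" using det_upper_triangular[OF B(2,1)] by (metis mult_zero_right zero_neq_one)
  then have diag_nz: "B $$ (k, k) \<noteq> 0" if "k < m" for k
    using that B(1) by (auto simp: prod_list_zero_iff diag_mat_def)
  have main: "T $$ (i, j) * B $$ (j, j) = (if i = j then 1 else 0)" if "i < m" "j \<le> i" for i j
    using that
  proof (induction j rule: less_induct)
    case (less j)
    have "T $$ (i, k) * B $$ (k, j) = 0" if k: "k < m" "k \<noteq> j" for k
    proof (cases "k < j")
      case True
      then have "T $$ (i, k) * B $$ (k, k) = 0" using less by auto
      then show ?thesis using diag_nz[OF k(1)] by simp
    next
      case False
      then have "B $$ (k, j) = 0" using k B by (intro upper_triangularD) auto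
      then show ?thesis by simp
    qed
    then have "(\<Sum>k<m. T $$ (i, k) * B $$ (k, j)) = (\<Sum>k\<in>{j}. T $$ (i, k) * B $$ (k, j))"
      using less.prems by (intro sum.mono_neutral_right) auto
    then show ?case using entry[of i j] less.prems by simp
  qed
  show ?thesis using main[OF i order.refl] by simp
qed

lemma sum_diag_mult_comm:
  fixes A B :: "'a :: comm_semiring_0 mat"
  assumes "A \<in> carrier_mat m m" "B \<in> carrier_mat m m"
  shows "(\<Sum>i<m. (A * B) $$ (i, i)) = (\<Sum>i<m. (B * A) $$ (i, i))"
proof -
  have "(\<Sum>i<m. (A * B) $$ (i, i)) = (\<Sum>i<m. \<Sum>k<m. A $$ (i, k) * B $$ (k, i))"
    using assms by (intro sum.cong) (auto simp: scalar_prod_def atLeast0LessThan)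
  also have "\<dots> = (\<Sum>k<m. \<Sum>i<m. A $$ (i, k) * B $$ (k, i))" by (rule sum.swap)
  also have "\<dots> = (\<Sum>k<m. \<Sum>i<m. B $$ (k, i) * A $$ (i, k))" by (simp add: mult.commute)
  also have "\<dots> = (\<Sum>k<m. (B * A) $$ (k, k))"
    using assms by (intro sum.cong) (auto simp: scalar_prod_def atLeast0LessThan)
  finally show ?thesis .
qed

text \<open>In the Schur form V = P B Q the shift by t turns B into a triangular matrix with
  diagonal entries \<lambda>_l + t. Its left inverse Q R P has the reciprocals on the diagonal and
  the same trace as R. The second conclusion, that an invertible shift excludes the eigenvalue -t,
  later yields nonnegativity of the spectrum.\<close>

lemma sum_spectrum_list_resolvent:
  assumes V: "V \<in> carrier_mat m m" "transpose_mat V = V"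
    and R: "R \<in> carrier_mat m m" "R * (V + t \<cdot>\<^sub>m 1\<^sub>m m) = 1\<^sub>m m"
  shows "(\<Sum>l<m. 1 / (spectrum_list V ! l + t)) = (\<Sum>i<m. R $$ (i, i))"
    and "\<And>l. l < m \<Longrightarrow> spectrum_list V ! l + t \<noteq> 0"
proof -
  obtain B P Q where "schur_decomposition V (spectrum_list V) = (B, P, Q)" by (metis prod_cases3)
  from schur_decomposition[OF V(1) char_poly_eq_prod_spectrum_list[OF V] this]
  have sim: "similar_mat_wit V B P Q" and ut: "upper_triangular B"
    and diag: "diag_mat B = spectrum_list V" by auto
  note wit = similar_mat_witD2[OF V(1) sim]
  have [simp]: "P \<in> carrier_mat m m" "Q \<in> carrier_mat m m" "B \<in> carrier_mat m m"
    "V \<in> carrier_mat m m" "R \<in> carrier_mat m m" using wit V R by auto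
  note [simp] = mult_carrier_mat[of _ m m _ m] left_mult_one_mat[of _ m m] right_mult_one_mat[of _ m m]
  define B' where "B' = B + t \<cdot>\<^sub>m 1\<^sub>m m"
  define T where "T = Q * (R * P)"
  have B': "B' \<in> carrier_mat m m" "upper_triangular B'"
    using ut carrier_matD[OF \<open>B \<in> carrier_mat m m\<close>] by (auto simp: B'_def upper_triangular_def)
  have T: "T \<in> carrier_mat m m" by (simp add: T_def)
  have "P * B * Q * P = P * B * (Q * P)"
    by (rule assoc_mult_mat[of _ m m _ m _ m]) simp_all
  then have "P * B * Q * P = P * B" using wit(2) by simp
  then have VP: "V * P = P * B" using wit(3) by simp
  have PB: "P * B' = (V + t \<cdot>\<^sub>m 1\<^sub>m m) * P"
  proof -
    have 1: "t \<cdot>\<^sub>m 1\<^sub>m m \<in> carrier_mat m m" by simp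
    have "P * B' = P * B + P * (t \<cdot>\<^sub>m 1\<^sub>m m)"
      unfolding B'_def by (rule mult_add_distrib_mat[OF _ _ 1, of _ m]) simp_all
    also have "P * (t \<cdot>\<^sub>m 1\<^sub>m m) = (t \<cdot>\<^sub>m 1\<^sub>m m) * P"
      by (simp add: mult_smult_distrib[of P m m _ m] mult_smult_assoc_mat[of _ m m P m])
    also have "P * B + (t \<cdot>\<^sub>m 1\<^sub>m m) * P = (V + t \<cdot>\<^sub>m 1\<^sub>m m) * P"
      unfolding VP[symmetric] by (rule add_mult_distrib_mat[OF wit(4) 1 wit(6), symmetric])
    finally show ?thesis .
  qed
  have "T * B' = Q * (R * (P * B'))"
    unfolding T_def using B' by (simp add: assoc_mult_mat[of _ m m _ m _ m])
  also have "\<dots> = Q * (R * (V + t \<cdot>\<^sub>m 1\<^sub>m m) * P)"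
    unfolding PB by (subst assoc_mult_mat[of R m m _ m _ m]) simp_all
  also have "\<dots> = 1\<^sub>m m" using R(2) wit(2) by simp
  finally have TB: "T * B' = 1\<^sub>m m" .
  have spec: "spectrum_list V ! l = B $$ (l, l)" if "l < m" for l
    using that carrier_matD(1)[OF wit(5)] by (simp add: diag[symmetric] diag_mat_def)
  have inv: "T $$ (l, l) * (spectrum_list V ! l + t) = 1" if "l < m" for l
    using left_inverse_upper_triangular_diag[OF B' T TB that] that
    by (simp add: spec B'_def)
  show nz: "spectrum_list V ! l + t \<noteq> 0" if "l < m" for l
    using inv[OF that] by auto
  have "(\<Sum>l<m. 1 / (spectrum_list V ! l + t)) = (\<Sum>l<m. T $$ (l, l))"
    using inv nz by (intro sum.cong) (auto simp: divide_simps mult.commute)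
  also have "\<dots> = (\<Sum>i<m. ((R * P) * Q) $$ (i, i))"
    unfolding T_def by (rule sum_diag_mult_comm) simp_all
  also have "(R * P) * Q = R" using wit(1) by (simp add: assoc_mult_mat[of _ m m _ m _ m])
  finally show "(\<Sum>l<m. 1 / (spectrum_list V ! l + t)) = (\<Sum>i<m. R $$ (i, i))" .
qed

section \<open>Integration against empirical spectral distributions\<close>

lemma measurable_uniform_count_measure_borel: "f \<in> measurable (uniform_count_measure A) borel"
  by (auto simp: measurable_def sets_uniform_count_measure space_uniform_count_measure)

lemma real_distribution_esd:
  assumes "V \<in> carrier_mat m m" "0 < m"
  shows "real_distribution (esd V)"
proof -
  interpret U: prob_space "uniform_count_measure {..<dim_row V}"
    using assms by (intro prob_space_uniform_count_measure) auto
  show ?thesis unfolding esd_def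
    by (intro real_distribution.intro U.prob_space_distr measurable_uniform_count_measure_borel)
      (auto simp: real_distribution_axioms_def)
qed

lemma integral_esd:
  fixes f :: "real \<Rightarrow> real"
  assumes "V \<in> carrier_mat m m" "f \<in> borel_measurable borel"
  shows "(\<integral>x. f x \<partial>esd V) = (\<Sum>l<m. f (spectrum_list V ! l)) / m"
  using assms unfolding esd_def
  by (subst integral_distr[OF measurable_uniform_count_measure_borel])
    (auto simp: integral_uniform_count_measure)

lemma AE_esd:
  assumes "V \<in> carrier_mat m m" "\<And>l. l < m \<Longrightarrow> 0 \<le> spectrum_list V ! l"
  shows "AE x in esd V. 0 \<le> x"
  unfolding esd_def using assms
  by (subst AE_distr_iff[OF measurable_uniform_count_measure_borel])
    (auto simp: space_uniform_count_measure intro!: AE_I2)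

section \<open>Resolvents of Gram matrices and rank-one updates\<close>

unbundle no vec_syntax and no inner_syntax

text \<open>The adjugate formula exhibits the entries of the inverse as measurable functions of the
  entries; singular matrices get the junk value \<open>0\<close>.\<close>

definition inverse_mat :: "'a :: field mat \<Rightarrow> 'a mat" where
  "inverse_mat W = (1 / det W) \<cdot>\<^sub>m adj_mat W"

lemma inverse_mat:
  assumes W: "W \<in> carrier_mat m m" and det: "det W \<noteq> 0"
  shows "inverse_mat W \<in> carrier_mat m m" "W * inverse_mat W = 1\<^sub>m m" "inverse_mat W * W = 1\<^sub>m m"
proof -
  note adj = adj_mat[OF W]
  show "inverse_mat W \<in> carrier_mat m m" using adj by (simp add: inverse_mat_def)
  show "W * inverse_mat W = 1\<^sub>m m" "inverse_mat W * W = 1\<^sub>m m"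
    unfolding inverse_mat_def using adj W det
    by (auto simp: mult_smult_distrib[OF W adj(1)] mult_smult_assoc_mat[OF adj(1) W] intro!: eq_matI)
qed

section \<open>Bounds on the inverse of a coercive matrix\<close>

lemma scalar_prod_self_nonneg: "0 \<le> v \<bullet> v" for v :: "real vec"
  by (simp add: scalar_prod_def sum_nonneg)

lemma scalar_prod_self_eq_0:
  fixes v :: "real vec"
  assumes "v \<in> carrier_vec m" "v \<bullet> v = 0"
  shows "v = 0\<^sub>v m"
proof (rule eq_vecI)
  show "v $ i = 0\<^sub>v m $ i" if "i < dim_vec (0\<^sub>v m)" for i
    using assms that by (auto simp: scalar_prod_def sum_nonneg_eq_0_iff)
qed (use assms in auto)

lemma component_square_le:
  fixes v :: "real vec"
  assumes "v \<in> carrier_vec m" "i < m"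
  shows "(v $ i)\<^sup>2 \<le> v \<bullet> v"
proof -
  have "(v $ i)\<^sup>2 \<le> (\<Sum>i\<in>{0..<m}. (v $ i)\<^sup>2)"
    using assms by (intro member_le_sum) auto
  then show ?thesis using assms by (simp add: scalar_prod_def power2_eq_square)
qed

text \<open>Coercivity replaces spectral calculus: the bounds on the inverse come from testing the
  quadratic form on vectors \<open>R *\<^sub>v v\<close>, for which
  \<open>W *\<^sub>v (R *\<^sub>v v) = v\<close>.\<close>

locale coercive_mat =
  fixes m :: nat and t :: real and W :: "real mat"
  assumes t_pos: "0 < t"
    and W: "W \<in> carrier_mat m m" "transpose_mat W = W"
    and coercive: "v \<in> carrier_vec m \<Longrightarrow> t * (v \<bullet> v) \<le> v \<bullet> (W *\<^sub>v v)"
begin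

abbreviation "R \<equiv> inverse_mat W"

lemma det_nonzero: "det W \<noteq> 0"
proof
  assume "det W = 0"
  then obtain v where v: "v \<in> carrier_vec m" "v \<noteq> 0\<^sub>v m" "W *\<^sub>v v = 0\<^sub>v m"
    using det_0_iff_vec_prod_zero[OF W(1)] by auto
  then have "t * (v \<bullet> v) \<le> 0" using coercive[OF v(1)] by simp
  then have "v \<bullet> v = 0" using t_pos scalar_prod_self_nonneg[of v]
    by (simp add: mult_le_0_iff)
  then show False using scalar_prod_self_eq_0 v by blast
qed

lemma R: "R \<in> carrier_mat m m" "W * R = 1\<^sub>m m" "R * W = 1\<^sub>m m"
  using inverse_mat[OF W(1) det_nonzero] by auto

lemma dim_R [simp]: "dim_row R = m" "dim_col R = m"
  using R(1) by auto

lemma R_vec: "v \<in> carrier_vec m \<Longrightarrow> R *\<^sub>v v \<in> carrier_vec m"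
  using R(1) by simp

lemma W_R: "v \<in> carrier_vec m \<Longrightarrow> W *\<^sub>v (R *\<^sub>v v) = v"
  using R W by (simp flip: assoc_mult_mat_vec)

lemma R_W: "v \<in> carrier_vec m \<Longrightarrow> R *\<^sub>v (W *\<^sub>v v) = v"
  using R W by (simp flip: assoc_mult_mat_vec)

lemma R_sym: "transpose_mat R = R"
proof -
  have RT: "transpose_mat R \<in> carrier_mat m m" using R(1) by simp
  have "transpose_mat R * W = 1\<^sub>m m"
    using transpose_mult[OF W(1) R(1)] R(2) W(2) by simp
  then have "transpose_mat R * W * R = R" using R(1) by simp
  then show ?thesis using assoc_mult_mat[OF RT W(1) R(1)] R RT by simp
qed

lemma R_adjoint: "v \<in> carrier_vec m \<Longrightarrow> w \<in> carrier_vec m \<Longrightarrow> (R *\<^sub>v v) \<bullet> w = v \<bullet> (R *\<^sub>v w)"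
  using transpose_vec_mult_scalar[OF R(1)] R_sym by simp

lemma R_bound:
  assumes "v \<in> carrier_vec m"
  shows "t * ((R *\<^sub>v v) \<bullet> (R *\<^sub>v v)) \<le> v \<bullet> (R *\<^sub>v v)"
  using coercive[OF R_vec[OF assms]] W_R[OF assms] comm_scalar_prod[OF assms R_vec[OF assms]] by simp

lemma R_nonneg: "v \<in> carrier_vec m \<Longrightarrow> 0 \<le> v \<bullet> (R *\<^sub>v v)"
  using R_bound[of v] scalar_prod_self_nonneg[of "R *\<^sub>v v"] t_pos
  by (meson mult_nonneg_nonneg order_trans less_imp_le)

lemma R_unit_vec: "i < m \<Longrightarrow> k < m \<Longrightarrow> (R *\<^sub>v unit_vec m i) $ k = R $$ (k, i)"
  using R(1) by simp

lemma R_commute: "i < m \<Longrightarrow> k < m \<Longrightarrow> R $$ (k, i) = R $$ (i, k)"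
  using R(1) R_sym by (metis carrier_matD index_transpose_mat(1))

text \<open>For w = R e_i and N = |w|^2, testing gives t N <= w_i, while w_i^2 <= N; together (t
  N)^2 <= N. The bound is uniform in the dimension and becomes the row bound \<rho> of the
  quadratic-form estimate.\<close>

lemma R_row_norm:
  assumes "i < m"
  shows "(\<Sum>k<m. (R $$ (i, k))\<^sup>2) \<le> (1 / t)\<^sup>2"
proof -
  let ?w = "R *\<^sub>v unit_vec m i"
  let ?N = "?w \<bullet> ?w"
  have w: "?w \<in> carrier_vec m" using R_vec by simp
  have "R $$ (k, i) = R $$ (i, k)" if "k < m" for k using R_commute assms that by simp
  then have N: "?N = (\<Sum>k<m. (R $$ (i, k))\<^sup>2)"
    using w assms by (simp add: scalar_prod_def power2_eq_square R_unit_vec atLeast0LessThan del: index_mult_mat_vec)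
  have "t * ?N \<le> ?w $ i" using R_bound[of "unit_vec m i"] w assms by simp
  moreover have "0 \<le> t * ?N" using t_pos scalar_prod_self_nonneg[of ?w] by simp
  ultimately have "(t * ?N)\<^sup>2 \<le> (?w $ i)\<^sup>2" by (rule power_mono)
  also have "\<dots> \<le> ?N" using component_square_le[OF w assms] .
  finally have "t\<^sup>2 * ?N * ?N \<le> 1 * ?N" by (simp add: power2_eq_square mult_ac)
  then have "t\<^sup>2 * ?N \<le> 1" using scalar_prod_self_nonneg[of ?w] 
    by (cases "?N = 0") (auto simp: mult_le_cancel_right)
  then show ?thesis using t_pos unfolding N[symmetric] by (simp add: field_simps)
qed

text \<open>The same two inequalities in the other order: t w_i^2 <= t N <= w_i.\<close>

lemma R_diag:
  assumes "i < m"
  shows "0 \<le> R $$ (i, i)" "R $$ (i, i) \<le> 1 / t"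
proof -
  let ?w = "R *\<^sub>v unit_vec m i"
  have w: "?w \<in> carrier_vec m" using R_vec by simp
  have wi: "?w $ i = R $$ (i, i)" using assms R_unit_vec by simp
  have b: "t * (?w \<bullet> ?w) \<le> ?w $ i" using R_bound[of "unit_vec m i"] w assms by simp
  show nn: "0 \<le> R $$ (i, i)"
    using R_nonneg[of "unit_vec m i"] w assms wi by simp
  have "t * (?w $ i)\<^sup>2 \<le> ?w $ i"
    using b mult_left_mono[OF component_square_le[OF w assms], of t] t_pos by linarith
  then have "(t * R $$ (i, i)) * R $$ (i, i) \<le> 1 * R $$ (i, i)" unfolding wi by (simp add: power2_eq_square mult_ac)
  then have "t * R $$ (i, i) \<le> 1" using nn by (cases "R $$ (i, i) = 0") (auto simp: mult_le_cancel_right)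
  then show "R $$ (i, i) \<le> 1 / t" using t_pos by (simp add: field_simps)
qed

lemma quadratic_form_R:
  assumes "v \<in> carrier_vec m"
  shows "v \<bullet> (R *\<^sub>v v) = (\<Sum>i<m. \<Sum>k<m. R $$ (i, k) * v $ i * v $ k)"
  using assms R(1) by (simp add: scalar_prod_def sum_distrib_left mult_ac atLeast0LessThan)

end

text \<open>Sherman--Morrison: both resolvents are compared through the single vector \<open>R c\<close>.\<close>

locale rank_one_update = A: coercive_mat m t W + B: coercive_mat m t W' for m t W W' +
  fixes \<kappa> :: real and c :: "real vec"
  assumes c: "c \<in> carrier_vec m" and \<kappa>: "0 \<le> \<kappa>"
    and update: "v \<in> carrier_vec m \<Longrightarrow> W' *\<^sub>v v = W *\<^sub>v v + (\<kappa> * (c \<bullet> v)) \<cdot>\<^sub>v c"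
begin

abbreviation "q \<equiv> \<kappa> * (c \<bullet> (A.R *\<^sub>v c))"

lemma q_nonneg: "0 \<le> q" using A.R_nonneg[OF c] \<kappa> by simp

text \<open>With w the image of v under the inverse of \<open>W'\<close>, write v as the image of w
  under \<open>W'\<close>, expand by \<open>update\<close> and apply the inverse of
  \<open>W\<close>.\<close>

lemma resolvent_identity:
  assumes v: "v \<in> carrier_vec m"
  shows "A.R *\<^sub>v v = B.R *\<^sub>v v + (\<kappa> * (c \<bullet> (B.R *\<^sub>v v))) \<cdot>\<^sub>v (A.R *\<^sub>v c)"
proof -
  let ?w = "B.R *\<^sub>v v"
  have w: "?w \<in> carrier_vec m" using B.R_vec[OF v] .
  have Ww: "W *\<^sub>v ?w \<in> carrier_vec m" using A.W w by simp
  have "v = W *\<^sub>v ?w + (\<kappa> * (c \<bullet> ?w)) \<cdot>\<^sub>v c" using update[OF w] B.W_R[OF v] by simp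
  then have "A.R *\<^sub>v v = A.R *\<^sub>v (W *\<^sub>v ?w + (\<kappa> * (c \<bullet> ?w)) \<cdot>\<^sub>v c)" by simp
  also have "\<dots> = A.R *\<^sub>v (W *\<^sub>v ?w) + A.R *\<^sub>v ((\<kappa> * (c \<bullet> ?w)) \<cdot>\<^sub>v c)"
    using mult_add_distrib_mat_vec[OF A.R(1) Ww] c by simp
  also have "\<dots> = ?w + (\<kappa> * (c \<bullet> ?w)) \<cdot>\<^sub>v (A.R *\<^sub>v c)"
    using A.R_W[OF w] mult_mat_vec[OF A.R(1) c] by simp
  finally show ?thesis .
qed

text \<open>Pairing the identity for v = c with c gives q = b (1 + q), where b is the left-hand
  side.\<close>

lemma quadratic_form_update: "\<kappa> * (c \<bullet> (B.R *\<^sub>v c)) = q / (1 + q)"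
proof -
  let ?b = "c \<bullet> (B.R *\<^sub>v c)"
  have "c \<bullet> (A.R *\<^sub>v c) = ?b + (\<kappa> * ?b) * (c \<bullet> (A.R *\<^sub>v c))"
    using arg_cong[OF resolvent_identity[OF c], of "scalar_prod c"] c A.R_vec[OF c] B.R_vec[OF c]
    by (simp add: scalar_prod_add_distrib[of _ m])
  then have "q = \<kappa> * ?b * (1 + q)" by (metis distrib_left mult.assoc mult.right_neutral mult.left_commute)
  then show ?thesis using q_nonneg by (intro eq_divide_imp) auto
qed

lemma B_R_c: "B.R *\<^sub>v c = (1 / (1 + q)) \<cdot>\<^sub>v (A.R *\<^sub>v c)"
proof (rule eq_vecI)
  fix i assume "i < dim_vec ((1 / (1 + q)) \<cdot>\<^sub>v (A.R *\<^sub>v c))"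
  then have i: "i < m" using A.R_vec[OF c] by simp
  have "(A.R *\<^sub>v c) $ i = (B.R *\<^sub>v c) $ i + q / (1 + q) * (A.R *\<^sub>v c) $ i"
    using arg_cong[OF resolvent_identity[OF c], of "\<lambda>v. v $ i"] i A.R_vec[OF c] B.R_vec[OF c]
    unfolding quadratic_form_update by (simp del: index_mult_mat_vec)
  then show "(B.R *\<^sub>v c) $ i = ((1 / (1 + q)) \<cdot>\<^sub>v (A.R *\<^sub>v c)) $ i"
    using q_nonneg i A.R_vec[OF c] by (simp add: divide_simps del: index_mult_mat_vec) (simp add: algebra_simps del: index_mult_mat_vec)
qed (use A.R_vec[OF c] B.R_vec[OF c] in simp)

text \<open>The two inverses differ by \<kappa> / (1 + q) times the rank-one matrix r r^T with r =
  \<open>A.R *\<^sub>v c\<close>; the proof reads off its diagonal.\<close>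

lemma trace_diff:
  "(\<Sum>i<m. A.R $$ (i, i)) - (\<Sum>i<m. B.R $$ (i, i)) = \<kappa> * ((A.R *\<^sub>v c) \<bullet> (A.R *\<^sub>v c)) / (1 + q)"
proof -
  let ?r = "A.R *\<^sub>v c"
  have r: "?r \<in> carrier_vec m" using A.R_vec[OF c] .
  have "A.R $$ (i, i) - B.R $$ (i, i) = \<kappa> / (1 + q) * (?r $ i * ?r $ i)" if i: "i < m" for i
  proof -
    have e: "unit_vec m i \<in> carrier_vec m" by simp
    have "c \<bullet> (B.R *\<^sub>v unit_vec m i) = (B.R *\<^sub>v c) \<bullet> unit_vec m i"
      using B.R_adjoint[OF c e] by simp
    also have "\<dots> = (B.R *\<^sub>v c) $ i" using i by simp
    also have "\<dots> = 1 / (1 + q) * ?r $ i"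
      unfolding B_R_c using i r by (simp del: index_mult_mat_vec)
    finally have *: "c \<bullet> (B.R *\<^sub>v unit_vec m i) = 1 / (1 + q) * ?r $ i" .
    have "A.R $$ (i, i) = B.R $$ (i, i) + \<kappa> * (1 / (1 + q) * ?r $ i) * ?r $ i"
      using arg_cong[OF resolvent_identity[OF e], of "\<lambda>v. v $ i"] i r B.R_vec[OF e]
      unfolding * by (simp add: A.R_unit_vec B.R_unit_vec del: index_mult_mat_vec)
    then show ?thesis by simp
  qed
  then have "(\<Sum>i<m. A.R $$ (i, i)) - (\<Sum>i<m. B.R $$ (i, i)) = \<kappa> / (1 + q) * (\<Sum>i<m. ?r $ i * ?r $ i)"
    by (simp add: sum_subtractf[symmetric] sum_distrib_left)
  also have "(\<Sum>i<m. ?r $ i * ?r $ i) = ?r \<bullet> ?r" by (simp add: scalar_prod_def atLeast0LessThan del: index_mult_mat_vec)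
  finally show ?thesis by simp
qed

text \<open>Coercivity bounds \<kappa> t |r|^2 by q, hence by 1 + q. So deleting one column changes
  the trace by O(1), however long the column is.\<close>

lemma trace_diff_bounds:
  "0 \<le> (\<Sum>i<m. A.R $$ (i, i)) - (\<Sum>i<m. B.R $$ (i, i))"
  "(\<Sum>i<m. A.R $$ (i, i)) - (\<Sum>i<m. B.R $$ (i, i)) \<le> 1 / t"
proof -
  let ?N = "(A.R *\<^sub>v c) \<bullet> (A.R *\<^sub>v c)"
  show "0 \<le> (\<Sum>i<m. A.R $$ (i, i)) - (\<Sum>i<m. B.R $$ (i, i))"
    unfolding trace_diff using q_nonneg \<kappa> scalar_prod_self_nonneg[of "A.R *\<^sub>v c"] by simp
  have "\<kappa> * (t * ?N) \<le> q" using A.R_bound[OF c] \<kappa> by (rule mult_left_mono)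
  then have "t * (\<kappa> * ?N / (1 + q)) \<le> 1"
    using q_nonneg by (simp add: divide_simps mult_ac)
  then show "(\<Sum>i<m. A.R $$ (i, i)) - (\<Sum>i<m. B.R $$ (i, i)) \<le> 1 / t"
    unfolding trace_diff using A.t_pos by (simp only: pos_le_divide_eq mult.commute)
qed

end

text \<open>With J = \<open>{..<n}\<close> this is the shifted covariance matrix. Removing j from J
  gives the leave-one-out matrix with the normalisation \<kappa> = 1 / n unchanged, so that the two
  differ by exactly one rank-one term.\<close>

definition gram_mat :: "nat \<Rightarrow> real \<Rightarrow> real \<Rightarrow> (nat \<Rightarrow> nat \<Rightarrow> real) \<Rightarrow> nat set \<Rightarrow> real mat" where
  "gram_mat m \<kappa> t z J = Matrix.mat m m (\<lambda>(i, k). \<kappa> * (\<Sum>j\<in>J. z i j * z k j) + (if i = k then t else 0))"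

definition column :: "nat \<Rightarrow> (nat \<Rightarrow> nat \<Rightarrow> real) \<Rightarrow> nat \<Rightarrow> real vec" where
  "column m z j = Matrix.vec m (\<lambda>i. z i j)"

lemma column_carrier [simp]: "column m z j \<in> carrier_vec m" and dim_column [simp]: "dim_vec (column m z j) = m"
  and column_index [simp]: "i < m \<Longrightarrow> column m z j $ i = z i j"
  by (simp_all add: column_def)

lemma gram_mat_carrier [simp]: "gram_mat m \<kappa> t z J \<in> carrier_mat m m"
  by (simp add: gram_mat_def)

lemma gram_mat_mult_vec:
  assumes v: "v \<in> carrier_vec m" and i: "i < m"
  shows "(gram_mat m \<kappa> t z J *\<^sub>v v) $ i = \<kappa> * (\<Sum>j\<in>J. z i j * (column m z j \<bullet> v)) + t * v $ i"
proof -
  have "(gram_mat m \<kappa> t z J *\<^sub>v v) $ i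
      = (\<Sum>k<m. (\<kappa> * (\<Sum>j\<in>J. z i j * z k j)) * v $ k) + (\<Sum>k<m. (if i = k then t else 0) * v $ k)"
    using v i by (simp add: gram_mat_def scalar_prod_def atLeast0LessThan distrib_right sum.distrib)
  also have "(\<Sum>k<m. (if i = k then t else 0) * v $ k) = t * v $ i"
    using i by (simp add: if_distrib[of "\<lambda>x. x * _"] cong: if_cong)
  also have "(\<Sum>k<m. (\<kappa> * (\<Sum>j\<in>J. z i j * z k j)) * v $ k) = \<kappa> * (\<Sum>k<m. \<Sum>j\<in>J. z i j * (z k j * v $ k))"
    by (simp add: sum_distrib_left sum_distrib_right mult_ac)
  also have "(\<Sum>k<m. \<Sum>j\<in>J. z i j * (z k j * v $ k)) = (\<Sum>j\<in>J. z i j * (\<Sum>k<m. z k j * v $ k))"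
    unfolding sum_distrib_left by (rule sum.swap)
  also have "\<dots> = (\<Sum>j\<in>J. z i j * (column m z j \<bullet> v))"
    using v by (intro sum.cong) (auto simp: scalar_prod_def atLeast0LessThan)
  finally show ?thesis .
qed

text \<open>The quadratic form at v is \<kappa> times the sum of the squares of the products of v
  with the columns, plus t |v|^2.\<close>

lemma coercive_gram_mat:
  assumes "0 < t" "0 \<le> \<kappa>"
  shows "coercive_mat m t (gram_mat m \<kappa> t z J)"
proof
  show "transpose_mat (gram_mat m \<kappa> t z J) = gram_mat m \<kappa> t z J"
    by (rule eq_matI) (auto simp: gram_mat_def mult.commute)
  fix v :: "real vec" assume v: "v \<in> carrier_vec m"
  have "v \<bullet> (gram_mat m \<kappa> t z J *\<^sub>v v)
      = (\<Sum>i<m. v $ i * (\<kappa> * (\<Sum>j\<in>J. z i j * (column m z j \<bullet> v)) + t * v $ i))"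
    using v by (simp add: scalar_prod_def[of v] gram_mat_mult_vec atLeast0LessThan carrier_matD[OF gram_mat_carrier]
        del: index_mult_mat_vec)
  also have "\<dots> = \<kappa> * (\<Sum>i<m. \<Sum>j\<in>J. (z i j * v $ i) * (column m z j \<bullet> v)) + t * (\<Sum>i<m. v $ i * v $ i)"
    by (simp add: distrib_left sum.distrib sum_distrib_left mult_ac)
  also have "(\<Sum>i<m. \<Sum>j\<in>J. (z i j * v $ i) * (column m z j \<bullet> v)) = (\<Sum>j\<in>J. (\<Sum>i<m. z i j * v $ i) * (column m z j \<bullet> v))"
    unfolding sum_distrib_right by (rule sum.swap)
  also have "\<dots> = (\<Sum>j\<in>J. (column m z j \<bullet> v)\<^sup>2)"
    using v by (intro sum.cong) (auto simp: scalar_prod_def atLeast0LessThan power2_eq_square)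
  also have "(\<Sum>i<m. v $ i * v $ i) = v \<bullet> v" using v by (simp add: scalar_prod_def atLeast0LessThan)
  finally show "t * (v \<bullet> v) \<le> v \<bullet> (gram_mat m \<kappa> t z J *\<^sub>v v)"
    using assms by (simp add: sum_nonneg)
qed (use assms in simp_all)

lemma rank_one_update_gram_mat:
  assumes "0 < t" "0 \<le> \<kappa>" "finite J" "j \<in> J"
  shows "rank_one_update m t (gram_mat m \<kappa> t z (J - {j})) (gram_mat m \<kappa> t z J) \<kappa> (column m z j)"
proof -
  have "gram_mat m \<kappa> t z J *\<^sub>v v = gram_mat m \<kappa> t z (J - {j}) *\<^sub>v v + (\<kappa> * (column m z j \<bullet> v)) \<cdot>\<^sub>v column m z j"
    if v: "v \<in> carrier_vec m" for v
  proof (rule eq_vecI)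
    fix i assume "i < dim_vec (gram_mat m \<kappa> t z (J - {j}) *\<^sub>v v + (\<kappa> * (column m z j \<bullet> v)) \<cdot>\<^sub>v column m z j)"
    then have i: "i < m" by simp
    have "(\<Sum>j\<in>J. z i j * (column m z j \<bullet> v)) = z i j * (column m z j \<bullet> v) + (\<Sum>j\<in>J - {j}. z i j * (column m z j \<bullet> v))"
      using assms by (intro sum.remove)
    then show "(gram_mat m \<kappa> t z J *\<^sub>v v) $ i
        = (gram_mat m \<kappa> t z (J - {j}) *\<^sub>v v + (\<kappa> * (column m z j \<bullet> v)) \<cdot>\<^sub>v column m z j) $ i"
      using i v carrier_matD[OF gram_mat_carrier]
      by (simp add: gram_mat_mult_vec algebra_simps del: index_mult_mat_vec)
  qed (use carrier_matD[OF gram_mat_carrier] in simp)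
  then show ?thesis
    using assms by (intro rank_one_update.intro coercive_gram_mat rank_one_update_axioms.intro) auto
qed

abbreviation resolvent :: "nat \<Rightarrow> real \<Rightarrow> real \<Rightarrow> (nat \<Rightarrow> nat \<Rightarrow> real) \<Rightarrow> nat set \<Rightarrow> real mat" where
  "resolvent m \<kappa> t z J \<equiv> inverse_mat (gram_mat m \<kappa> t z J)"

text \<open>Take the trace of \<open>R * gram_mat m \<kappa> t z J = 1\<^sub>m m\<close> and split
  the Gram part into its columns.\<close>

lemma resolvent_trace_identity:
  assumes t: "0 < t" "0 \<le> \<kappa>"
  shows "t * (\<Sum>i<m. resolvent m \<kappa> t z J $$ (i, i))
    + (\<Sum>j\<in>J. \<kappa> * (column m z j \<bullet> (resolvent m \<kappa> t z J *\<^sub>v column m z j))) = m"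
proof -
  interpret coercive_mat m t "gram_mat m \<kappa> t z J" using coercive_gram_mat[OF t] .
  have "(\<Sum>i<m. (R * gram_mat m \<kappa> t z J) $$ (i, i)) = m" unfolding R(3) by simp
  also have "(\<Sum>i<m. (R * gram_mat m \<kappa> t z J) $$ (i, i))
      = (\<Sum>i<m. \<Sum>k<m. R $$ (i, k) * (\<kappa> * (\<Sum>j\<in>J. z k j * z i j) + (if k = i then t else 0)))"
    using R(1) by (intro sum.cong) (auto simp: scalar_prod_def atLeast0LessThan gram_mat_def)
  also have "\<dots> = (\<Sum>i<m. \<Sum>k<m. R $$ (i, k) * (\<kappa> * (\<Sum>j\<in>J. z k j * z i j)))
      + (\<Sum>i<m. \<Sum>k<m. (if k = i then R $$ (i, k) * t else 0))"
    by (simp add: distrib_left sum.distrib if_distrib[of "\<lambda>x. _ * x"] cong: if_cong)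
  also have "(\<Sum>i<m. \<Sum>k<m. (if k = i then R $$ (i, k) * t else 0)) = t * (\<Sum>i<m. R $$ (i, i))"
    by (simp add: sum_distrib_left mult.commute)
  also have "(\<Sum>i<m. \<Sum>k<m. R $$ (i, k) * (\<kappa> * (\<Sum>j\<in>J. z k j * z i j)))
      = (\<Sum>i<m. \<Sum>j\<in>J. \<Sum>k<m. \<kappa> * (R $$ (i, k) * z i j * z k j))"
  proof (rule sum.cong[OF refl])
    fix i
    have "(\<Sum>k<m. R $$ (i, k) * (\<kappa> * (\<Sum>j\<in>J. z k j * z i j)))
        = (\<Sum>k<m. \<Sum>j\<in>J. \<kappa> * (R $$ (i, k) * z i j * z k j))"
      by (simp add: sum_distrib_left mult_ac)
    also have "\<dots> = (\<Sum>j\<in>J. \<Sum>k<m. \<kappa> * (R $$ (i, k) * z i j * z k j))" by (rule sum.swap)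
    finally show "(\<Sum>k<m. R $$ (i, k) * (\<kappa> * (\<Sum>j\<in>J. z k j * z i j)))
        = (\<Sum>j\<in>J. \<Sum>k<m. \<kappa> * (R $$ (i, k) * z i j * z k j))" .
  qed
  also have "\<dots> = (\<Sum>j\<in>J. \<Sum>i<m. \<Sum>k<m. \<kappa> * (R $$ (i, k) * z i j * z k j))" by (rule sum.swap)
  also have "\<dots> = (\<Sum>j\<in>J. \<kappa> * (column m z j \<bullet> (R *\<^sub>v column m z j)))"
    by (intro sum.cong refl) (simp add: quadratic_form_R sum_distrib_left)
  finally show ?thesis by simp
qed

section \<open>The self-consistent equation\<close>

lemma div_one_plus_lipschitz:
  fixes x y :: real
  assumes "0 \<le> x" "0 \<le> y"
  shows "\<bar>x / (1 + x) - y / (1 + y)\<bar> \<le> \<bar>x - y\<bar>"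
proof -
  have "x / (1 + x) - y / (1 + y) = (x - y) / ((1 + x) * (1 + y))"
    using assms by (simp add: divide_simps) (simp add: algebra_simps)
  moreover have "1 * 1 \<le> (1 + x) * (1 + y)" using assms by (intro mult_mono) auto
  ultimately show ?thesis using assms by (simp add: abs_mult divide_le_eq mult_le_cancel_left1)
qed

text \<open>For fixed z and c with independent standardised entries, the trace is the mean of the
  quadratic form. The vector c is a separate argument so that the other columns can be
  frozen.\<close>

definition quadratic_deviation :: "nat \<Rightarrow> real \<Rightarrow> real \<Rightarrow> (nat \<Rightarrow> nat \<Rightarrow> real) \<Rightarrow> nat set \<Rightarrow> (nat \<Rightarrow> real) \<Rightarrow> real" where
  "quadratic_deviation m \<kappa> t z J c =
    (\<Sum>i<m. \<Sum>k<m. resolvent m \<kappa> t z J $$ (i, k) * c i * c k) - (\<Sum>i<m. resolvent m \<kappa> t z J $$ (i, i))"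

text \<open>A deterministic estimate, to be applied at each \<omega>. Each column contributes q_j /
  (1 + q_j) to the trace identity, and q_j is replaced by the common value \<sigma> = (m / n) s.
  This costs \<open>D j\<close> for the deviation and 1 / (n t) for exchanging the leave-one-out
  trace for the full one; the latter errors add up to 1 / t.\<close>

lemma self_consistent_equation_error:
  fixes z :: "nat \<Rightarrow> nat \<Rightarrow> real" and m n :: nat and t :: real
  assumes m: "0 < m" and n: "0 < n" and t: "0 < t"
  defines "s \<equiv> (\<Sum>i<m. resolvent m (1 / n) t z {..<n} $$ (i, i)) / m"
    and "D \<equiv> \<lambda>j. \<bar>quadratic_deviation m (1 / n) t z ({..<n} - {j}) (\<lambda>i. z i j)\<bar> / n"
  shows "0 \<le> s" "s \<le> 1 / t" "\<bar>t * s + s / (1 + m / n * s) - 1\<bar> \<le> ((\<Sum>j<n. D j) + 1 / t) / m"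
proof -
  let ?\<kappa> = "1 / real n"
  have \<kappa>: "0 \<le> ?\<kappa>" by simp
  interpret R: coercive_mat m t "gram_mat m ?\<kappa> t z {..<n}" by (rule coercive_gram_mat[OF t \<kappa>])
  define \<tau> where "\<tau> = (\<Sum>i<m. R.R $$ (i, i))"
  have \<tau>: "0 \<le> \<tau>" "\<tau> \<le> m / t"
    using R.R_diag sum_nonneg[of "{..<m}" "\<lambda>i. R.R $$ (i, i)"]
      sum_bounded_above[of "{..<m}" "\<lambda>i. R.R $$ (i, i)" "1 / t"] by (auto simp: \<tau>_def)
  have s: "s = \<tau> / m" by (simp add: s_def \<tau>_def)
  show "0 \<le> s" "s \<le> 1 / t" using \<tau> m t by (simp_all add: s divide_simps mult.commute)
  define \<sigma> where "\<sigma> = ?\<kappa> * \<tau>"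
  have \<sigma>0: "0 \<le> \<sigma>" using \<tau> by (simp add: \<sigma>_def)
  let ?f = "\<lambda>j. ?\<kappa> * (column m z j \<bullet> (R.R *\<^sub>v column m z j))"
  have close: "\<bar>?f j - \<sigma> / (1 + \<sigma>)\<bar> \<le> D j + ?\<kappa> / t" if j: "j < n" for j
  proof -
    interpret U: rank_one_update m t "gram_mat m ?\<kappa> t z ({..<n} - {j})" "gram_mat m ?\<kappa> t z {..<n}" ?\<kappa> "column m z j"
      using j by (intro rank_one_update_gram_mat t \<kappa>) auto
    let ?tr = "\<Sum>i<m. U.A.R $$ (i, i)"
    have q: "U.q = ?\<kappa> * (quadratic_deviation m ?\<kappa> t z ({..<n} - {j}) (\<lambda>i. z i j) + ?tr)"
      unfolding quadratic_deviation_def U.A.quadratic_form_R[OF column_carrier] by simp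
    have "\<bar>U.q - \<sigma>\<bar> = \<bar>?\<kappa> * quadratic_deviation m ?\<kappa> t z ({..<n} - {j}) (\<lambda>i. z i j) + ?\<kappa> * (?tr - \<tau>)\<bar>"
      unfolding q \<sigma>_def by (simp add: algebra_simps)
    also have "\<dots> \<le> \<bar>?\<kappa> * quadratic_deviation m ?\<kappa> t z ({..<n} - {j}) (\<lambda>i. z i j)\<bar> + \<bar>?\<kappa> * (?tr - \<tau>)\<bar>"
      by (rule abs_triangle_ineq)
    also have "\<bar>?\<kappa> * quadratic_deviation m ?\<kappa> t z ({..<n} - {j}) (\<lambda>i. z i j)\<bar> = D j"
      by (simp add: D_def abs_mult)
    also have "\<bar>?\<kappa> * (?tr - \<tau>)\<bar> \<le> ?\<kappa> / t"
    proof -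
      have "0 \<le> ?tr - \<tau>" "?tr - \<tau> \<le> 1 / t" using U.trace_diff_bounds by (simp_all add: \<tau>_def)
      then have "?\<kappa> * (?tr - \<tau>) \<le> ?\<kappa> * (1 / t)" "0 \<le> ?\<kappa> * (?tr - \<tau>)"
        by (intro mult_left_mono mult_nonneg_nonneg; simp)+
      then show ?thesis by simp
    qed
    finally have "\<bar>U.q - \<sigma>\<bar> \<le> D j + ?\<kappa> / t" by simp
    then show ?thesis
      unfolding U.quadratic_form_update using div_one_plus_lipschitz[OF U.q_nonneg \<sigma>0] by linarith
  qed
  have "\<bar>(\<Sum>j<n. ?f j) - n * (\<sigma> / (1 + \<sigma>))\<bar> = \<bar>\<Sum>j<n. (?f j - \<sigma> / (1 + \<sigma>))\<bar>"
    by (simp add: sum_subtractf)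
  also have "\<dots> \<le> (\<Sum>j<n. D j + ?\<kappa> / t)"
    by (rule order_trans[OF sum_abs sum_mono]) (use close in auto)
  also have "\<dots> = (\<Sum>j<n. D j) + 1 / t" using n by (simp add: sum.distrib)
  finally have bound: "\<bar>(\<Sum>j<n. ?f j) - n * (\<sigma> / (1 + \<sigma>))\<bar> \<le> (\<Sum>j<n. D j) + 1 / t" .
  have "t * \<tau> + (\<Sum>j<n. ?f j) = m"
    using resolvent_trace_identity[OF t \<kappa>, of m z "{..<n}"] by (simp add: \<tau>_def)
  then have "t * \<tau> + n * (\<sigma> / (1 + \<sigma>)) - m = - ((\<Sum>j<n. ?f j) - n * (\<sigma> / (1 + \<sigma>)))" by simp
  then have "\<bar>t * \<tau> + n * (\<sigma> / (1 + \<sigma>)) - m\<bar> \<le> (\<Sum>j<n. D j) + 1 / t"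
    using bound by (simp only: abs_minus_cancel)
  then have "\<bar>t * \<tau> + n * (\<sigma> / (1 + \<sigma>)) - m\<bar> / m \<le> ((\<Sum>j<n. D j) + 1 / t) / m"
    by (rule divide_right_mono) simp
  moreover have "t * s + s / (1 + m / n * s) - 1 = (t * \<tau> + n * (\<sigma> / (1 + \<sigma>)) - m) / m"
  proof -
    have "m / n * s = \<sigma>" "s = n * \<sigma> / m" using m n by (simp_all add: s \<sigma>_def)
    then have "s / (1 + m / n * s) = n * (\<sigma> / (1 + \<sigma>)) / m" by simp
    moreover have "t * s = t * \<tau> / m" by (simp add: s)
    ultimately show ?thesis using m by (simp add: add_divide_distrib diff_divide_distrib)
  qed
  ultimately show "\<bar>t * s + s / (1 + m / n * s) - 1\<bar> \<le> ((\<Sum>j<n. D j) + 1 / t) / m" by simp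
qed

text \<open>Clearing denominators leads to y t s^2 + (t + 1 - y) s = 1. Its roots have a negative
  product, and s is the positive one.\<close>

lemma marchenko_pastur_root:
  fixes t y :: real
  assumes t: "0 < t" and y: "0 < y"
  defines "s \<equiv> (sqrt ((t + 1 - y)\<^sup>2 + 4 * y * t) - (t + 1 - y)) / (2 * y * t)"
  shows "0 \<le> s" "t * s + s / (1 + y * s) = 1"
proof -
  define b where "b = t + 1 - y"
  define r where "r = sqrt (b\<^sup>2 + 4 * y * t)"
  have yt: "0 < y * t" using t y by simp
  have disc: "0 \<le> b\<^sup>2 + 4 * y * t" using t y by simp
  have r2: "r\<^sup>2 = b\<^sup>2 + 4 * y * t" using disc by (simp add: r_def)
  have "\<bar>b\<bar> \<le> r" unfolding r_def by (rule real_le_rsqrt) (use t y in simp)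
  then have "b \<le> r" by linarith
  then show s0: "0 \<le> s" using t y unfolding s_def b_def[symmetric] r_def[symmetric] by simp
  have rs: "r = 2 * (y * t) * s + b" using yt t y by (simp add: s_def r_def b_def)
  have "4 * (y * t) * ((y * t) * s\<^sup>2 + b * s) = 4 * (y * t) * 1"
    using r2 unfolding rs by (simp add: power2_eq_square algebra_simps)
  then have quad: "(y * t) * s\<^sup>2 + b * s = 1" using yt by (subst (asm) mult_left_cancel) auto
  have "(t * s) * (1 + y * s) + s = 1 + y * s"
    using quad by (simp add: b_def power2_eq_square algebra_simps)
  moreover have "1 + y * s > 0" using s0 y by (simp add: add_pos_nonneg)
  ultimately show "t * s + s / (1 + y * s) = 1" by (simp add: divide_simps)
qed

text \<open>Both sides of \<open>t s + s / (1 + y s) = 1\<close> are compared using that the left-hand side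
  grows at least as fast as \<open>t s\<close>.\<close>

lemma self_consistent_equation_limit:
  fixes s y e :: "nat \<Rightarrow> real" and t y0 s0 :: real
  assumes t: "0 < t" and y0: "0 < y0" and y: "y \<longlonglongrightarrow> y0" and y_nonneg: "\<And>n. 0 \<le> y n"
    and s: "\<And>n. 0 \<le> s n" "\<And>n. s n \<le> 1 / t"
    and err: "\<And>n. \<bar>t * s n + s n / (1 + y n * s n) - 1\<bar> \<le> e n" and e: "e \<longlonglongrightarrow> 0"
    and s0: "0 \<le> s0" "t * s0 + s0 / (1 + y0 * s0) = 1"
  shows "s \<longlonglongrightarrow> s0"
proof -
  have mono: "t * \<bar>a - b\<bar> \<le> \<bar>(t * a + a / (1 + y0 * a)) - (t * b + b / (1 + y0 * b))\<bar>"
    if "0 \<le> a" "0 \<le> b" for a b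
  proof -
    have p: "1 + y0 * a > 0" "1 + y0 * b > 0" using that y0 by (simp_all add: add_pos_nonneg)
    have "(t * a + a / (1 + y0 * a)) - (t * b + b / (1 + y0 * b))
        = (a - b) * (t + 1 / ((1 + y0 * a) * (1 + y0 * b)))"
      using p by (simp add: divide_simps) (simp add: algebra_simps)
    moreover have "t \<le> t + 1 / ((1 + y0 * a) * (1 + y0 * b))" using p by simp
    then have "t * \<bar>a - b\<bar> \<le> (t + 1 / ((1 + y0 * a) * (1 + y0 * b))) * \<bar>a - b\<bar>" by (rule mult_right_mono) simp
    ultimately show ?thesis using t p by (simp add: abs_mult mult.commute)
  qed
  have bound: "\<bar>s n - s0\<bar> \<le> (e n + \<bar>y n - y0\<bar> / t\<^sup>2) / t" for n
  proof -
    have p: "1 + y0 * s n \<ge> 1" "1 + y n * s n \<ge> 1" using s(1)[of n] y0 y_nonneg[of n] by simp_all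
    \<comment> \<open>The equation is approximately solved with \<open>y n\<close>; passing to
      \<open>y0\<close> costs at most |y n - y0| s^2, and s <= 1 / t.\<close>
    have "s n / (1 + y0 * s n) - s n / (1 + y n * s n)
        = (s n)\<^sup>2 * (y n - y0) / ((1 + y0 * s n) * (1 + y n * s n))"
      using p by (simp add: divide_simps power2_eq_square) (simp add: algebra_simps)
    then have "\<bar>s n / (1 + y0 * s n) - s n / (1 + y n * s n)\<bar>
        = (s n)\<^sup>2 * \<bar>y n - y0\<bar> / ((1 + y0 * s n) * (1 + y n * s n))"
      using p by (simp add: abs_mult)
    also have "\<dots> \<le> (1 / t)\<^sup>2 * \<bar>y n - y0\<bar> / (1 * 1)"
      using p s[of n] by (intro frac_le mult_mono power_mono) auto
    finally have 1: "\<bar>s n / (1 + y0 * s n) - s n / (1 + y n * s n)\<bar> \<le> \<bar>y n - y0\<bar> / t\<^sup>2"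
      by (simp add: power_divide)
    have "t * \<bar>s n - s0\<bar> \<le> \<bar>t * s n + s n / (1 + y0 * s n) - 1\<bar>"
      using mono[OF s(1)[of n] s0(1)] s0(2) by simp
    also have "\<dots> \<le> e n + \<bar>y n - y0\<bar> / t\<^sup>2" using 1 err[of n] by linarith
    finally show ?thesis using t by (simp add: pos_le_divide_eq mult.commute)
  qed
  have "(\<lambda>n. \<bar>y n - y0\<bar>) \<longlonglongrightarrow> 0" using y by (simp add: LIM_zero tendsto_rabs_zero)
  then have "(\<lambda>n. (e n + \<bar>y n - y0\<bar> / t\<^sup>2) / t) \<longlonglongrightarrow> (0 + 0 / t\<^sup>2) / t"
    using t by (intro tendsto_intros e) auto
  then have "(\<lambda>n. s n - s0) \<longlonglongrightarrow> 0"
    using bound by (intro Lim_null_comparison[where f = "\<lambda>n. s n - s0" and g = "\<lambda>n. (e n + \<bar>y n - y0\<bar> / t\<^sup>2) / t"])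
      simp_all
  then show ?thesis by (simp add: LIM_zero_iff)
qed

section \<open>Fourth moments of quadratic forms\<close>

lemma (in finite_measure) integrable_power_le:
  fixes f :: "'a \<Rightarrow> real"
  assumes f: "f \<in> borel_measurable M" and int: "integrable M (\<lambda>x. \<bar>f x\<bar> ^ n)" and j: "j \<le> n"
  shows "integrable M (\<lambda>x. f x ^ j)"
proof (rule Bochner_Integration.integrable_bound)
  show "integrable M (\<lambda>x. 1 + \<bar>f x\<bar> ^ n)" using int by simp
  show "AE x in M. norm (f x ^ j) \<le> norm (1 + \<bar>f x\<bar> ^ n)"
  proof (intro AE_I2)
    fix x
    have "\<bar>f x\<bar> ^ j \<le> 1 + \<bar>f x\<bar> ^ n"
    proof (cases "\<bar>f x\<bar> \<le> 1")
      case True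
      then have "\<bar>f x\<bar> ^ j \<le> 1" by (intro power_le_one) auto
      then show ?thesis by (simp add: add_increasing2)
    next
      case False
      then have "\<bar>f x\<bar> ^ j \<le> \<bar>f x\<bar> ^ n" using j by (intro power_increasing) auto
      then show ?thesis by simp
    qed
    then show "norm (f x ^ j) \<le> norm (1 + \<bar>f x\<bar> ^ n)" by (simp add: power_abs)
  qed
qed (use f in simp)

lemma integrable_between:
  fixes f g :: "'a \<Rightarrow> real"
  assumes "integrable M g" "f \<in> borel_measurable M" "\<And>x. 0 \<le> f x" "\<And>x. f x \<le> g x"
  shows "integrable M f"
proof (rule Bochner_Integration.integrable_bound[OF assms(1,2)])
  have "norm (f x) \<le> norm (g x)" for x using assms(3)[of x] assms(4)[of x] by simp
  then show "AE x in M. norm (f x) \<le> norm (g x)" by simp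
qed

text \<open>The term 4 s d^3 is absorbed by 2 s^2 d^2 + 2 d^4. The term 4 s^3 d stays because its
  mean vanishes for a centred increment, and s^4 keeps the coefficient 1, since a larger one would
  make an induction over increments grow exponentially.\<close>

lemma fourth_power_add_le: "(s + d) ^ 4 \<le> s ^ 4 + 4 * (s ^ 3 * d) + 8 * (s\<^sup>2 * d\<^sup>2) + 3 * d ^ 4"
  for s d :: real
proof -
  have "s ^ 4 + 4 * (s ^ 3 * d) + 8 * (s\<^sup>2 * d\<^sup>2) + 3 * d ^ 4 - (s + d) ^ 4 = 2 * d\<^sup>2 * (s - d)\<^sup>2"
    by (simp add: power2_eq_square power3_eq_cube power4_eq_xxxx algebra_simps)
  moreover have "0 \<le> 2 * d\<^sup>2 * (s - d)\<^sup>2" by simp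
  ultimately show ?thesis by linarith
qed

lemma fourth_power_sum_le: "(s + d) ^ 4 \<le> 8 * s ^ 4 + 8 * d ^ 4" for s d :: real
proof -
  have "(s + d)\<^sup>2 \<le> 2 * s\<^sup>2 + 2 * d\<^sup>2" using zero_le_power2[of "s - d"]
    by (simp add: power2_sum power2_diff)
  then have "((s + d)\<^sup>2)\<^sup>2 \<le> (2 * s\<^sup>2 + 2 * d\<^sup>2)\<^sup>2" by (intro power_mono) auto
  also have "\<dots> \<le> 8 * (s\<^sup>2)\<^sup>2 + 8 * (d\<^sup>2)\<^sup>2" using zero_le_power2[of "s\<^sup>2 - d\<^sup>2"]
    by (simp add: power2_sum power2_diff power_mult_distrib)
  finally show ?thesis by simp
qed

lemma weighted_young: "x * y \<le> \<theta> / 2 * x\<^sup>2 + y\<^sup>2 / (2 * \<theta>)" if "0 < \<theta>" for x y \<theta> :: real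
proof -
  have "0 \<le> (\<theta> * x - y)\<^sup>2 / (2 * \<theta>)" using that by simp
  also have "\<dots> = \<theta> / 2 * x\<^sup>2 + y\<^sup>2 / (2 * \<theta>) - x * y"
    using that by (simp add: power2_diff power_mult_distrib field_simps) (simp add: power2_eq_square)
  finally show ?thesis by simp
qed

text \<open>One step of a moment recursion: S is a partial sum and d an increment centred given the
  past, which is the source of \<open>zero\<close>.\<close>

lemma (in prob_space) expectation_fourth_power_add:
  fixes S d :: "'a \<Rightarrow> real"
  assumes [measurable]: "S \<in> borel_measurable M" "d \<in> borel_measurable M"
    and int: "integrable M (\<lambda>x. S x ^ 4)" "integrable M (\<lambda>x. d x ^ 4)"
      "integrable M (\<lambda>x. S x ^ 3 * d x)" "integrable M (\<lambda>x. (S x)\<^sup>2 * (d x)\<^sup>2)"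
    and zero: "expectation (\<lambda>x. S x ^ 3 * d x) = 0"
  shows "integrable M (\<lambda>x. (S x + d x) ^ 4)"
    and "expectation (\<lambda>x. (S x + d x) ^ 4) \<le> expectation (\<lambda>x. S x ^ 4)
      + 8 * expectation (\<lambda>x. (S x)\<^sup>2 * (d x)\<^sup>2) + 3 * expectation (\<lambda>x. d x ^ 4)"
proof -
  show int': "integrable M (\<lambda>x. (S x + d x) ^ 4)"
    by (rule integrable_between[OF _ _ _ fourth_power_sum_le]) (use int in simp_all)
  have "expectation (\<lambda>x. (S x + d x) ^ 4)
      \<le> expectation (\<lambda>x. S x ^ 4 + 4 * (S x ^ 3 * d x) + 8 * ((S x)\<^sup>2 * (d x)\<^sup>2) + 3 * d x ^ 4)"
    by (intro integral_mono int' Bochner_Integration.integrable_add integrable_mult_right int fourth_power_add_le)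
  also have "\<dots> = expectation (\<lambda>x. S x ^ 4) + 8 * expectation (\<lambda>x. (S x)\<^sup>2 * (d x)\<^sup>2) + 3 * expectation (\<lambda>x. d x ^ 4)"
    using int zero by simp
  finally show "expectation (\<lambda>x. (S x + d x) ^ 4) \<le> expectation (\<lambda>x. S x ^ 4)
      + 8 * expectation (\<lambda>x. (S x)\<^sup>2 * (d x)\<^sup>2) + 3 * expectation (\<lambda>x. d x ^ 4)" .
qed

text \<open>Here s is the variance of the linear form so far and b is the square of the new
  coefficient. The factor 4 makes the cross term 8 (L + 1) b s cover 8 b s, and leaves 4 against 3
  for b^2.\<close>

lemma linear_growth_step:
  fixes L s b :: real
  assumes "0 \<le> L" "0 \<le> s" "0 \<le> b"
  shows "4 * (L + 1) * s\<^sup>2 + 8 * (b * s) + 3 * (b\<^sup>2 * (L + 1)) \<le> 4 * (L + 1) * (s + b)\<^sup>2"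
proof -
  have "4 * (L + 1) * (s + b)\<^sup>2 - (4 * (L + 1) * s\<^sup>2 + 8 * (b * s) + 3 * (b\<^sup>2 * (L + 1)))
      = 8 * L * (b * s) + (L + 1) * b\<^sup>2"
    by (simp add: power2_eq_square algebra_simps)
  moreover have "0 \<le> 8 * L * (b * s) + (L + 1) * b\<^sup>2" using assms by simp
  ultimately show ?thesis by linarith
qed

text \<open>In units of K^2 \<rho>^2 the choice of \<theta> turns the recursion into \<open>\<phi>'
  \<le> \<phi> + \<phi> / (r + 1) + 5440 * (r + 1) + 1728\<close>, where 5440 = 8 * 17 * 40 and 1728
  = 3 * 576. With C = 7168 = 5440 + 1728 the second term is at most C r, and C r^2 + C r + 5440 r +
  C <= C (r + 1)^2.\<close>

lemma quadratic_growth_step: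
  fixes K \<rho> \<phi> \<phi>' \<theta> r :: real
  assumes K: "1 \<le> K" and r: "0 \<le> r" and \<theta>: "\<theta> = 1 / (40 * K * (r + 1))"
    and \<phi>: "\<phi> \<le> 7168 * K\<^sup>2 * r\<^sup>2 * \<rho>\<^sup>2"
    and \<phi>': "\<phi>' \<le> \<phi> + 8 * (5 * (K * (\<theta> * \<phi>)) + 17 * (K * \<rho>\<^sup>2 / \<theta>)) + 3 * (576 * K\<^sup>2 * \<rho>\<^sup>2)"
  shows "\<phi>' \<le> 7168 * K\<^sup>2 * (r + 1)\<^sup>2 * \<rho>\<^sup>2"
proof -
  define w z v where "w = K\<^sup>2 * \<rho>\<^sup>2" and "z = r * w" and "v = r\<^sup>2 * w"
  have pos: "0 \<le> w" "0 \<le> z" using r by (simp_all add: w_def z_def)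
  have \<phi>v: "\<phi> \<le> 7168 * v" using \<phi> by (simp add: v_def w_def mult_ac)
  also have "\<dots> \<le> 7168 * (v + z)" using pos by simp
  also have "\<dots> = 7168 * z * (r + 1)" by (simp add: v_def z_def power2_eq_square algebra_simps)
  finally have 1: "\<phi> / (r + 1) \<le> 7168 * z" using r by (subst pos_divide_le_eq) auto
  have "40 * (k * (1 / (40 * k * s) * x)) = x / s" if "k \<noteq> 0" for k s x :: real
    using that by simp
  then have 2: "40 * (K * (\<theta> * \<phi>)) = \<phi> / (r + 1)" unfolding \<theta> using K by (metis not_one_le_zero)
  have 3: "K * \<rho>\<^sup>2 / \<theta> = 40 * (z + w)"
    unfolding \<theta> z_def w_def by (simp add: power2_eq_square algebra_simps)
  have 4: "3 * (576 * K\<^sup>2 * \<rho>\<^sup>2) = 1728 * w" by (simp add: w_def)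
  have "\<phi>' \<le> 7168 * v + 2 * (7168 * z) + 7168 * w"
  proof -
    have "x' \<le> 7168 * v + 2 * (7168 * z) + 7168 * w"
      if "x' \<le> x + 8 * (5 * g + 17 * (40 * (z + w))) + 1728 * w" "x \<le> 7168 * v" "h \<le> 7168 * z" "40 * g = h"
      for x x' g h :: real
      using that pos by simp
    then show ?thesis using \<phi>' \<phi>v 1 2 unfolding 3 4 by blast
  qed
  also have "\<dots> = 7168 * ((r + 1)\<^sup>2 * w)" by (simp add: v_def z_def power2_sum algebra_simps)
  finally show ?thesis by (simp add: w_def mult_ac)
qed

lemma fourth_moment_step_mono:
  fixes x :: real
  assumes "x \<le> u + 8 * v + 3 * w" "u \<le> u'" "v = v'" "w \<le> w'"
  shows "x \<le> u' + 8 * v' + 3 * w'"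
  using assms by linarith

lemma fourth_moment_step_mono':
  fixes x :: real
  assumes "x \<le> u + 8 * v + 3 * w" "v \<le> v'" "w \<le> w'"
  shows "x \<le> u + 8 * v' + 3 * w'"
  using assms by linarith

text \<open>Eighth moments, because the diagonal part of a quadratic form contains (c_i)^2 - 1,
  whose fourth power has to be integrable.\<close>

locale standardized_independent = prob_space M for M :: "'a measure" +
  fixes c :: "nat \<Rightarrow> 'a \<Rightarrow> real" and N :: nat and L :: real
  assumes indep: "indep_vars (\<lambda>_. borel) c {..<N}"
    and moment8: "\<And>i. i < N \<Longrightarrow> integrable M (\<lambda>x. \<bar>c i x\<bar> ^ 8)"
    and moment8_le: "\<And>i. i < N \<Longrightarrow> expectation (\<lambda>x. \<bar>c i x\<bar> ^ 8) \<le> L"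
    and mean: "\<And>i. i < N \<Longrightarrow> expectation (c i) = 0"
    and second_moment: "\<And>i. i < N \<Longrightarrow> expectation (\<lambda>x. (c i x)\<^sup>2) = 1"
    and L_nonneg: "0 \<le> L"
begin

section \<open>Moment recursions along the natural filtration\<close>

lemma c_measurable: "i < N \<Longrightarrow> c i \<in> borel_measurable M"
  using indep by (auto simp: indep_vars_def)

lemma integrable_c_power: "i < N \<Longrightarrow> k \<le> 8 \<Longrightarrow> integrable M (\<lambda>x. c i x ^ k)"
  by (rule integrable_power_le[OF c_measurable moment8])

text \<open>Measurability at time m in the natural filtration of c, encoded by Borel functions of
  the restricted family. In this shape independence of disjoint blocks of indices applies
  directly.\<close>

definition past :: "nat \<Rightarrow> ('a \<Rightarrow> real) set" where
  "past m = {G. \<exists>g\<in>borel_measurable (PiM {..<m} (\<lambda>_. borel)). G = (\<lambda>x. g (\<lambda>i\<in>{..<m}. c i x))}"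

lemma past_const: "(\<lambda>_. a) \<in> past m"
  by (auto simp: past_def intro!: bexI[of _ "\<lambda>_. a"])

lemma past_component: "i < m \<Longrightarrow> c i \<in> past m"
  by (auto simp: past_def intro!: bexI[of _ "\<lambda>z. z i"] measurable_component_singleton)

lemma past_add: "F \<in> past m \<Longrightarrow> G \<in> past m \<Longrightarrow> (\<lambda>x. F x + G x) \<in> past m"
  unfolding past_def by (auto intro!: bexI[OF _ borel_measurable_add])

lemma past_mult: "F \<in> past m \<Longrightarrow> G \<in> past m \<Longrightarrow> (\<lambda>x. F x * G x) \<in> past m"
  unfolding past_def by (auto intro!: bexI[OF _ borel_measurable_times])

lemma past_diff: "F \<in> past m \<Longrightarrow> G \<in> past m \<Longrightarrow> (\<lambda>x. F x - G x) \<in> past m"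
  unfolding past_def by (auto intro!: bexI[OF _ borel_measurable_diff])

lemma past_power: "F \<in> past m \<Longrightarrow> (\<lambda>x. F x ^ k) \<in> past m"
  unfolding past_def by (auto intro!: bexI[OF _ borel_measurable_power])

lemma past_sum: "(\<And>i. i \<in> I \<Longrightarrow> F i \<in> past m) \<Longrightarrow> (\<lambda>x. \<Sum>i\<in>I. F i x) \<in> past m"
  by (induction I rule: infinite_finite_induct) (auto intro!: past_const past_add)

lemma past_measurable:
  assumes "G \<in> past m" "m \<le> N"
  shows "G \<in> borel_measurable M"
proof -
  from assms(1)[unfolded past_def mem_Collect_eq]
  obtain g where g: "g \<in> borel_measurable (PiM {..<m} (\<lambda>_. borel))" "G = (\<lambda>x. g (\<lambda>i\<in>{..<m}. c i x))"
    by (elim bexE)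
  have "(\<lambda>x. \<lambda>i\<in>{..<m}. c i x) \<in> measurable M (PiM {..<m} (\<lambda>_. borel))"
    using assms(2) by (intro measurable_restrict c_measurable) auto
  from measurable_compose[OF this g(1)] show ?thesis by (simp add: g(2))
qed

lemma past_indep:
  assumes G: "G \<in> past m" "integrable M G" and m: "m < N"
    and h: "h \<in> borel_measurable borel" and Z: "integrable M Z" "\<And>x. Z x = h (c m x)"
  shows "integrable M (\<lambda>x. G x * Z x)"
    and "expectation (\<lambda>x. G x * Z x) = expectation G * expectation Z"
proof -
  from G(1)[unfolded past_def mem_Collect_eq]
  obtain g where g: "g \<in> borel_measurable (PiM {..<m} (\<lambda>_. borel))" "G = (\<lambda>x. g (\<lambda>i\<in>{..<m}. c i x))"
    by (elim bexE)
  have "indep_var (PiM {..<m} (\<lambda>_. borel)) (\<lambda>x. \<lambda>i\<in>{..<m}. c i x)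
      (PiM {m} (\<lambda>_. borel)) (\<lambda>x. \<lambda>i\<in>{m}. c i x)"
    using m by (intro indep_var_restrict[OF indep]) auto
  moreover have "(\<lambda>z. z m) \<in> measurable (PiM {m} (\<lambda>_. borel :: real measure)) borel"
    using measurable_component_singleton[of m "{m}" "\<lambda>_. borel :: real measure"] by simp
  from measurable_compose[OF this h]
  have "(\<lambda>z. h (z m)) \<in> borel_measurable (PiM {m} (\<lambda>_. borel))" .
  ultimately have "indep_var borel (g \<circ> (\<lambda>x. \<lambda>i\<in>{..<m}. c i x)) borel ((\<lambda>z. h (z m)) \<circ> (\<lambda>x. \<lambda>i\<in>{m}. c i x))"
    by (rule indep_var_compose[OF _ g(1)])
  moreover have "g \<circ> (\<lambda>x. \<lambda>i\<in>{..<m}. c i x) = G" by (simp only: g(2) o_def)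
  moreover have "(\<lambda>z. h (z m)) \<circ> (\<lambda>x. \<lambda>i\<in>{m}. c i x) = Z" by (simp add: fun_eq_iff Z(2))
  ultimately have ind: "indep_var borel G borel Z" by (simp only:)
  show "integrable M (\<lambda>x. G x * Z x)" by (rule indep_var_integrable[OF ind G(2) Z(1)])
  show "expectation (\<lambda>x. G x * Z x) = expectation G * expectation Z"
    by (rule indep_var_lebesgue_integral[OF ind G(2) Z(1)])
qed

lemma past_indep_power:
  assumes "G \<in> past m" "integrable M G" "m < N" "l \<le> 8"
  shows "integrable M (\<lambda>x. G x * c m x ^ l)"
    and "expectation (\<lambda>x. G x * c m x ^ l) = expectation G * expectation (\<lambda>x. c m x ^ l)"
proof -
  have pow: "(\<lambda>x. x ^ l) \<in> borel_measurable (borel :: real measure)"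
    by (intro borel_measurable_continuous_onI continuous_intros)
  note P = past_indep[OF assms(1,2,3) pow integrable_c_power[OF assms(3,4)] refl]
  show "integrable M (\<lambda>x. G x * c m x ^ l)" by (rule P(1))
  show "expectation (\<lambda>x. G x * c m x ^ l) = expectation G * expectation (\<lambda>x. c m x ^ l)" by (rule P(2))
qed

lemma past_indep_centered_power:
  assumes "G \<in> past m" "integrable M G" "m < N" "integrable M (\<lambda>x. ((c m x)\<^sup>2 - 1) ^ l)"
  shows "integrable M (\<lambda>x. G x * ((c m x)\<^sup>2 - 1) ^ l)"
    and "expectation (\<lambda>x. G x * ((c m x)\<^sup>2 - 1) ^ l) = expectation G * expectation (\<lambda>x. ((c m x)\<^sup>2 - 1) ^ l)"
proof -
  have pow: "(\<lambda>x. (x\<^sup>2 - 1) ^ l) \<in> borel_measurable (borel :: real measure)"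
    by (intro borel_measurable_continuous_onI continuous_intros)
  note P = past_indep[OF assms(1,2,3) pow assms(4) refl]
  show "integrable M (\<lambda>x. G x * ((c m x)\<^sup>2 - 1) ^ l)" by (rule P(1))
  show "expectation (\<lambda>x. G x * ((c m x)\<^sup>2 - 1) ^ l) = expectation G * expectation (\<lambda>x. ((c m x)\<^sup>2 - 1) ^ l)"
    by (rule P(2))
qed

lemma fourth_moment_le: "i < N \<Longrightarrow> expectation (\<lambda>x. c i x ^ 4) \<le> L + 1"
proof -
  assume i: "i < N"
  have "expectation (\<lambda>x. c i x ^ 4) \<le> expectation (\<lambda>x. \<bar>c i x\<bar> ^ 8 + 1)"
  proof (intro integral_mono integrable_c_power[OF i] Bochner_Integration.integrable_add moment8[OF i])
    fix x
    have "2 * c i x ^ 4 \<le> (c i x ^ 4)\<^sup>2 + 1"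
      using zero_le_power2[of "c i x ^ 4 - 1"] by (simp add: power2_diff)
    moreover have "0 \<le> c i x ^ 4" by simp
    ultimately have "c i x ^ 4 \<le> (c i x ^ 4)\<^sup>2 + 1" by linarith
    then show "c i x ^ 4 \<le> \<bar>c i x\<bar> ^ 8 + 1" by (simp add: power_mult[symmetric])
  qed simp_all
  also have "\<dots> \<le> L + 1" using moment8_le[OF i] moment8[OF i] by (simp add: prob_space)
  finally show ?thesis .
qed

text \<open>Each increment is centred and independent of the past. The second moment is carried
  along in the induction because it is a factor of the mixed term S^2 d^2 in the fourth-moment
  recursion.\<close>

lemma linear_form_moments:
  fixes a :: "nat \<Rightarrow> real"
  assumes "m \<le> N"
  defines "S \<equiv> \<lambda>m x. \<Sum>k<m. a k * c k x"
  shows "integrable M (\<lambda>x. S m x ^ 4)" (is ?A)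
    and "expectation (\<lambda>x. (S m x)\<^sup>2) = (\<Sum>k<m. (a k)\<^sup>2)" (is ?B)
    and "expectation (\<lambda>x. S m x ^ 4) \<le> 4 * (L + 1) * (\<Sum>k<m. (a k)\<^sup>2)\<^sup>2" (is ?C)
proof -
  have *: "?A \<and> ?B \<and> ?C" using assms(1)
  proof (induction m)
    case 0
    then show ?case by (simp add: S_def)
  next
    case (Suc m)
    then have m: "m < N" and "m \<le> N" by simp_all
    note H = Suc.IH[OF \<open>m \<le> N\<close>]
    note IH = conjunct1[OF H] conjunct1[OF conjunct2[OF H]] conjunct2[OF conjunct2[OF H]]
    define \<sigma> where "\<sigma> = (\<Sum>k<m. (a k)\<^sup>2)"
    have "0 \<le> \<sigma>" by (simp add: \<sigma>_def sum_nonneg)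
    have S: "S m \<in> past m"
      unfolding S_def by (intro past_sum past_mult past_const past_component) auto
    have Sm [measurable]: "S m \<in> borel_measurable M" using past_measurable[OF S] m by simp
    have [measurable]: "c m \<in> borel_measurable M" using c_measurable m .
    have powS: "integrable M (\<lambda>x. S m x ^ k)" if "k \<le> 4" for k
      by (rule integrable_power_le[OF Sm _ that]) (simp add: IH(1))
    have powc: "integrable M (\<lambda>x. c m x ^ k)" if "k \<le> 8" for k
      using integrable_c_power[OF m that] .
    have prod: "integrable M (\<lambda>x. S m x ^ k * c m x ^ l)"
      "expectation (\<lambda>x. S m x ^ k * c m x ^ l) = expectation (\<lambda>x. S m x ^ k) * expectation (\<lambda>x. c m x ^ l)"
      if "k \<le> 4" "l \<le> 8" for k l
      by (rule past_indep_power past_power S powS m that)+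
    have eq: "S (Suc m) = (\<lambda>x. S m x + a m * c m x)" by (simp add: S_def)
    have i3: "integrable M (\<lambda>x. S m x ^ 3 * (a m * c m x))"
      "expectation (\<lambda>x. S m x ^ 3 * (a m * c m x)) = 0"
    proof -
      have e: "S m x ^ 3 * (a m * c m x) = a m * (S m x ^ 3 * c m x ^ 1)" for x by simp
      show "integrable M (\<lambda>x. S m x ^ 3 * (a m * c m x))"
        "expectation (\<lambda>x. S m x ^ 3 * (a m * c m x)) = 0"
        unfolding e using prod[of 3 1] mean[OF m] by simp_all
    qed
    have i2: "integrable M (\<lambda>x. (S m x)\<^sup>2 * (a m * c m x)\<^sup>2)"
      "expectation (\<lambda>x. (S m x)\<^sup>2 * (a m * c m x)\<^sup>2) = (a m)\<^sup>2 * \<sigma>"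
    proof -
      have e: "(S m x)\<^sup>2 * (a m * c m x)\<^sup>2 = (a m)\<^sup>2 * ((S m x)\<^sup>2 * (c m x)\<^sup>2)" for x
        by (simp add: power_mult_distrib)
      show "integrable M (\<lambda>x. (S m x)\<^sup>2 * (a m * c m x)\<^sup>2)"
        "expectation (\<lambda>x. (S m x)\<^sup>2 * (a m * c m x)\<^sup>2) = (a m)\<^sup>2 * \<sigma>"
        unfolding e using prod[of 2 2] second_moment[OF m] IH(2) by (simp_all add: \<sigma>_def)
    qed
    have i4: "integrable M (\<lambda>x. (a m * c m x) ^ 4)"
      "expectation (\<lambda>x. (a m * c m x) ^ 4) \<le> a m ^ 4 * (L + 1)"
      using powc[of 4] fourth_moment_le[OF m] by (simp_all add: power_mult_distrib mult_left_mono)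
    have acm: "(\<lambda>x. a m * c m x) \<in> borel_measurable M" by simp
    note step = expectation_fourth_power_add[OF Sm acm IH(1) i4(1) i3(1) i2(1) i3(2)]
    have 1: "integrable M (\<lambda>x. S (Suc m) x ^ 4)" unfolding eq by (rule step(1))
    have "expectation (\<lambda>x. (S (Suc m) x)\<^sup>2)
        = expectation (\<lambda>x. (S m x)\<^sup>2 + 2 * a m * (S m x ^ 1 * c m x ^ 1) + (a m)\<^sup>2 * (c m x)\<^sup>2)"
    proof (rule Bochner_Integration.integral_cong[OF refl])
      show "(S (Suc m) x)\<^sup>2 = (S m x)\<^sup>2 + 2 * a m * (S m x ^ 1 * c m x ^ 1) + (a m)\<^sup>2 * (c m x)\<^sup>2" for x
        unfolding eq power2_sum power_mult_distrib by simp
    qed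
    also have "\<dots> = expectation (\<lambda>x. (S m x)\<^sup>2) + 2 * a m * expectation (\<lambda>x. S m x ^ 1 * c m x ^ 1)
        + (a m)\<^sup>2 * expectation (\<lambda>x. (c m x)\<^sup>2)"
    proof -
      have "integrable M (\<lambda>x. (S m x)\<^sup>2)" "integrable M (\<lambda>x. S m x ^ 1 * c m x ^ 1)" "integrable M (\<lambda>x. (c m x)\<^sup>2)"
        by (rule powS prod(1) powc; simp)+
      then show ?thesis
        by (simp only: Bochner_Integration.integral_add integral_mult_right_zero integrable_mult_right Bochner_Integration.integrable_add)
    qed
    also have "expectation (\<lambda>x. S m x ^ 1 * c m x ^ 1) = 0"
      by (subst prod(2)) (simp_all add: mean[OF m])
    also have "expectation (\<lambda>x. (c m x)\<^sup>2) = 1" by (rule second_moment[OF m])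
    finally have 2: "expectation (\<lambda>x. (S (Suc m) x)\<^sup>2) = (\<Sum>k<Suc m. (a k)\<^sup>2)"
      unfolding IH(2) by simp
    have "expectation (\<lambda>x. S (Suc m) x ^ 4)
        \<le> 4 * (L + 1) * \<sigma>\<^sup>2 + 8 * ((a m)\<^sup>2 * \<sigma>) + 3 * (a m ^ 4 * (L + 1))"
      unfolding eq using IH(3)[folded \<sigma>_def] by (rule fourth_moment_step_mono[OF step(2) _ i2(2) i4(2)])
    also have "\<dots> \<le> 4 * (L + 1) * (\<sigma> + (a m)\<^sup>2)\<^sup>2"
      using linear_growth_step[OF L_nonneg \<open>0 \<le> \<sigma>\<close>, of "(a m)\<^sup>2"] by (simp flip: power_mult)
    also have "\<sigma> + (a m)\<^sup>2 = (\<Sum>k<Suc m. (a k)\<^sup>2)" by (simp add: \<sigma>_def)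
    finally show ?case using 1 2 by (intro conjI)
  qed
  show ?A by (rule conjunct1[OF *])
  show ?B by (rule conjunct1[OF conjunct2[OF *]])
  show ?C by (rule conjunct2[OF conjunct2[OF *]])
qed

text \<open>Adding the index m adds d = 2 b c_m + a (c_m^2 - 1), where b is the linear form of row m
  in the earlier variables. This is centred given the past, so the recursion applies. The order m^2
  \<rho>^2 is the square of m \<rho>, which bounds the sum of the squared entries. The obstacle is
  the mixed moment of Q and b, which are dependent.\<close>

lemma quadratic_form_fourth_moment:
  fixes A :: "nat \<Rightarrow> nat \<Rightarrow> real" and \<rho> :: real
  assumes "m \<le> N" and sym: "\<And>i k. i < N \<Longrightarrow> k < N \<Longrightarrow> A i k = A k i"
    and row: "\<And>i. i < N \<Longrightarrow> (\<Sum>k<N. (A i k)\<^sup>2) \<le> \<rho>"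
  defines "Q \<equiv> \<lambda>m x. (\<Sum>i<m. \<Sum>k<m. A i k * c i x * c k x) - (\<Sum>i<m. A i i)"
  shows "integrable M (\<lambda>x. Q m x ^ 4)" (is ?A)
    and "expectation (\<lambda>x. Q m x ^ 4) \<le> 7168 * (L + 1)\<^sup>2 * (real m)\<^sup>2 * \<rho>\<^sup>2" (is ?B)
proof -
  have *: "?A \<and> ?B" using assms(1)
  proof (induction m)
    case 0
    have "Q 0 = (\<lambda>_. 0)" by (simp add: Q_def)
    then show ?case by simp
  next
    case (Suc m)
    then have m: "m < N" and "m \<le> N" by simp_all
    note IH = conjunct1[OF Suc.IH[OF \<open>m \<le> N\<close>]] conjunct2[OF Suc.IH[OF \<open>m \<le> N\<close>]]
    define K where "K = L + 1"
    have K: "1 \<le> K" using L_nonneg by (simp add: K_def)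
    define b where "b x = (\<Sum>k<m. A m k * c k x)" for x
    define a where "a = A m m"
    define d where "d x = 2 * (b x * c m x) + a * ((c m x)\<^sup>2 - 1)" for x
    have row_m: "(\<Sum>k<m. (A m k)\<^sup>2) \<le> \<rho>"
      using sum_mono2[of "{..<N}" "{..<m}" "\<lambda>k. (A m k)\<^sup>2"] row[OF m] m by fastforce
    have a2: "a\<^sup>2 \<le> \<rho>"
      using member_le_sum[of m "{..<N}" "\<lambda>k. (A m k)\<^sup>2"] row[OF m] m by (auto simp: a_def)
    have \<rho>: "0 \<le> \<rho>" using a2 zero_le_power2[of a] by linarith
    \<comment> \<open>Symmetry of A merges the new row and the new column into the factor 2.\<close>
    have eq: "Q (Suc m) = (\<lambda>x. Q m x + d x)"
    proof
      fix x
      have "(\<Sum>i<m. A i m * c i x * c m x) = b x * c m x"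
        unfolding b_def sum_distrib_right using sym m by (intro sum.cong) auto
      moreover have "(\<Sum>k<m. A m k * c m x * c k x) = b x * c m x"
        unfolding b_def sum_distrib_right by (intro sum.cong) auto
      ultimately show "Q (Suc m) x = Q m x + d x"
        by (simp add: Q_def d_def a_def sum.distrib power2_eq_square algebra_simps)
    qed
    have Qp: "Q m \<in> past m" and bp: "b \<in> past m"
      unfolding Q_def b_def
      by (intro past_diff past_sum past_mult past_const past_component; simp)+
    have Qm [measurable]: "Q m \<in> borel_measurable M" and bm [measurable]: "b \<in> borel_measurable M"
      using past_measurable[OF Qp] past_measurable[OF bp] m by simp_all
    have [measurable]: "c m \<in> borel_measurable M" using c_measurable m .
    have dm [measurable]: "d \<in> borel_measurable M" unfolding d_def by measurable
    have powc: "integrable M (\<lambda>x. c m x ^ k)" if "k \<le> 8" for k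
      using integrable_c_power[OF m that] .
    have powQ: "integrable M (\<lambda>x. Q m x ^ k)" if "k \<le> 4" for k
      by (rule integrable_power_le[OF Qm _ that]) (simp add: IH(1))
    have b4: "integrable M (\<lambda>x. b x ^ 4)" "expectation (\<lambda>x. b x ^ 4) \<le> 4 * K * \<rho>\<^sup>2"
    proof -
      show "integrable M (\<lambda>x. b x ^ 4)" unfolding b_def using linear_form_moments(1) m by simp
      have "expectation (\<lambda>x. b x ^ 4) \<le> 4 * (L + 1) * (\<Sum>k<m. (A m k)\<^sup>2)\<^sup>2"
        unfolding b_def using linear_form_moments(3) m by simp
      also have "\<dots> \<le> 4 * (L + 1) * \<rho>\<^sup>2"
        using L_nonneg row_m by (intro mult_left_mono power_mono) (auto intro: sum_nonneg)
      finally show "expectation (\<lambda>x. b x ^ 4) \<le> 4 * K * \<rho>\<^sup>2" by (simp add: K_def)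
    qed
    have Q3b: "integrable M (\<lambda>x. Q m x ^ 3 * b x)"
    proof (rule Bochner_Integration.integrable_bound)
      show "integrable M (\<lambda>x. Q m x ^ 4 + b x ^ 4)" using IH(1) b4(1) by simp
      show "AE x in M. norm (Q m x ^ 3 * b x) \<le> norm (Q m x ^ 4 + b x ^ 4)"
      proof (intro AE_I2)
        fix x
        let ?q = "\<bar>Q m x\<bar>" and ?b = "\<bar>b x\<bar>"
        have "?q ^ 3 * ?b \<le> max ?q ?b ^ 3 * max ?q ?b"
          by (intro mult_mono power_mono) auto
        also have "\<dots> = max ?q ?b ^ 4" by (simp add: power3_eq_cube power4_eq_xxxx)
        also have "\<dots> \<le> ?q ^ 4 + ?b ^ 4" by (simp add: max_def)
        finally show "norm (Q m x ^ 3 * b x) \<le> norm (Q m x ^ 4 + b x ^ 4)"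
          by (simp add: abs_mult power_abs)
      qed
    qed measurable
    have Q2b2: "integrable M (\<lambda>x. (Q m x)\<^sup>2 * (b x)\<^sup>2)"
    proof (rule integrable_between)
      show "integrable M (\<lambda>x. (1 / 2) * Q m x ^ 4 + b x ^ 4 / 2)" using IH(1) b4(1) by simp
      show "(Q m x)\<^sup>2 * (b x)\<^sup>2 \<le> (1 / 2) * Q m x ^ 4 + b x ^ 4 / 2" for x
        using weighted_young[of 1 "(Q m x)\<^sup>2" "(b x)\<^sup>2"] by (simp flip: power_mult)
    qed simp_all
    have h1: "integrable M (\<lambda>x. (c m x)\<^sup>2 - 1)" "expectation (\<lambda>x. (c m x)\<^sup>2 - 1) = 0"
      using powc[of 2] second_moment[OF m] by (simp_all add: prob_space)
    have sq: "((c m x)\<^sup>2 - 1)\<^sup>2 = c m x ^ 4 - 2 * (c m x)\<^sup>2 + 1" for x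
      by (simp add: power2_diff power_mult_distrib)
    have h2: "integrable M (\<lambda>x. ((c m x)\<^sup>2 - 1)\<^sup>2)" "expectation (\<lambda>x. ((c m x)\<^sup>2 - 1)\<^sup>2) \<le> K"
      unfolding sq using powc[of 2] powc[of 4] second_moment[OF m] fourth_moment_le[OF m]
      by (simp_all add: prob_space K_def)
    have h4: "integrable M (\<lambda>x. ((c m x)\<^sup>2 - 1) ^ 4)" "expectation (\<lambda>x. ((c m x)\<^sup>2 - 1) ^ 4) \<le> 8 * K"
    proof -
      have le: "((c m x)\<^sup>2 - 1) ^ 4 \<le> 8 * \<bar>c m x\<bar> ^ 8 + 8" for x
        using fourth_power_sum_le[of "(c m x)\<^sup>2" "-1"] by (simp flip: power_mult)
      have int: "integrable M (\<lambda>x. 8 * \<bar>c m x\<bar> ^ 8 + 8)" using moment8[OF m] by simp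
      show int': "integrable M (\<lambda>x. ((c m x)\<^sup>2 - 1) ^ 4)"
        by (rule integrable_between[OF int _ _ le]) simp_all
      have "expectation (\<lambda>x. ((c m x)\<^sup>2 - 1) ^ 4) \<le> expectation (\<lambda>x. 8 * \<bar>c m x\<bar> ^ 8 + 8)"
        by (intro integral_mono int int' le)
      also have "\<dots> \<le> 8 * K" using moment8[OF m] moment8_le[OF m] by (simp add: prob_space K_def)
      finally show "expectation (\<lambda>x. ((c m x)\<^sup>2 - 1) ^ 4) \<le> 8 * K" .
    qed
    have i3: "integrable M (\<lambda>x. Q m x ^ 3 * d x)" "expectation (\<lambda>x. Q m x ^ 3 * d x) = 0"
    proof -
      note p1 = past_indep_power[OF past_mult[OF past_power[OF Qp] bp] Q3b m, of 1]
      note p2 = past_indep_centered_power[OF past_power[OF Qp] powQ m, of 3 1]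
      have e: "Q m x ^ 3 * d x = 2 * (Q m x ^ 3 * b x * c m x ^ 1) + a * (Q m x ^ 3 * ((c m x)\<^sup>2 - 1) ^ 1)" for x
        by (simp add: d_def algebra_simps)
      have i: "integrable M (\<lambda>x. Q m x ^ 3 * b x * c m x ^ 1)" "integrable M (\<lambda>x. Q m x ^ 3 * ((c m x)\<^sup>2 - 1) ^ 1)"
        by (rule p1 p2; simp add: h1)+
      have z1: "expectation (\<lambda>x. Q m x ^ 3 * b x * c m x ^ 1) = 0"
        by (subst p1(2)) (simp_all add: mean[OF m])
      have z2: "expectation (\<lambda>x. Q m x ^ 3 * ((c m x)\<^sup>2 - 1) ^ 1) = 0"
        by (subst p2(2)) (simp_all add: h1)
      show "integrable M (\<lambda>x. Q m x ^ 3 * d x)"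
        unfolding e by (intro Bochner_Integration.integrable_add integrable_mult_right i)
      show "expectation (\<lambda>x. Q m x ^ 3 * d x) = 0"
        unfolding e by (simp only: Bochner_Integration.integral_add integral_mult_right_zero integrable_mult_right i z1 z2)
    qed
    have Q2b2c2: "integrable M (\<lambda>x. (Q m x)\<^sup>2 * (b x)\<^sup>2 * (c m x)\<^sup>2)"
      "expectation (\<lambda>x. (Q m x)\<^sup>2 * (b x)\<^sup>2 * (c m x)\<^sup>2) = expectation (\<lambda>x. (Q m x)\<^sup>2 * (b x)\<^sup>2)"
      using past_indep_power[OF past_mult[OF past_power[OF Qp] past_power[OF bp]] Q2b2 m, of 2] second_moment[OF m]
      by simp_all
    have Q2h: "integrable M (\<lambda>x. (Q m x)\<^sup>2 * ((c m x)\<^sup>2 - 1)\<^sup>2)"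
      "expectation (\<lambda>x. (Q m x)\<^sup>2 * ((c m x)\<^sup>2 - 1)\<^sup>2)
        = expectation (\<lambda>x. (Q m x)\<^sup>2) * expectation (\<lambda>x. ((c m x)\<^sup>2 - 1)\<^sup>2)"
      by (rule past_indep_centered_power[OF past_power[OF Qp] powQ m h2(1)]; simp)+
    have b4c4: "integrable M (\<lambda>x. b x ^ 4 * c m x ^ 4)"
      "expectation (\<lambda>x. b x ^ 4 * c m x ^ 4) = expectation (\<lambda>x. b x ^ 4) * expectation (\<lambda>x. c m x ^ 4)"
      by (rule past_indep_power[OF past_power[OF bp] b4(1) m]; simp)+
    have d2_le: "(Q m x)\<^sup>2 * (d x)\<^sup>2 \<le> 8 * ((Q m x)\<^sup>2 * (b x)\<^sup>2 * (c m x)\<^sup>2)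
        + 2 * \<rho> * ((Q m x)\<^sup>2 * ((c m x)\<^sup>2 - 1)\<^sup>2)" for x
    proof -
      have "(u + v)\<^sup>2 \<le> 2 * u\<^sup>2 + 2 * v\<^sup>2" for u v :: real
        using zero_le_power2[of "u - v"] by (simp add: power2_sum power2_diff)
      from this[of "2 * (b x * c m x)" "a * ((c m x)\<^sup>2 - 1)"]
      have "(d x)\<^sup>2 \<le> 8 * ((b x)\<^sup>2 * (c m x)\<^sup>2) + 2 * (a\<^sup>2 * ((c m x)\<^sup>2 - 1)\<^sup>2)"
        by (simp add: d_def power_mult_distrib)
      also have "\<dots> \<le> 8 * ((b x)\<^sup>2 * (c m x)\<^sup>2) + 2 * (\<rho> * ((c m x)\<^sup>2 - 1)\<^sup>2)"
        using a2 by (simp add: mult_right_mono)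
      finally have "(Q m x)\<^sup>2 * (d x)\<^sup>2
          \<le> (Q m x)\<^sup>2 * (8 * ((b x)\<^sup>2 * (c m x)\<^sup>2) + 2 * (\<rho> * ((c m x)\<^sup>2 - 1)\<^sup>2))"
        by (rule mult_left_mono) simp
      then show ?thesis by (simp add: distrib_left mult_ac)
    qed
    define \<phi> where "\<phi> = expectation (\<lambda>x. Q m x ^ 4)"
    \<comment> \<open>The weight of Young's inequality, chosen so that the recursion
      \<open>\<phi>\<^sub>m\<^sub>+\<^sub>1 \<le> (1 + 1 / (m + 1)) \<phi>\<^sub>m + O(m)\<close> preserves \<open>\<phi>\<^sub>m = O(m\<^sup>2)\<close>.\<close>
    define \<theta> where "\<theta> = 1 / (40 * K * (real m + 1))"
    have \<theta>: "0 < \<theta>" using K by (simp add: \<theta>_def)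
    have \<phi>0: "0 \<le> \<phi>" unfolding \<phi>_def by simp
    have i2: "integrable M (\<lambda>x. (Q m x)\<^sup>2 * (d x)\<^sup>2)"
      by (rule integrable_between[OF _ _ _ d2_le]) (simp_all add: Q2b2c2(1) Q2h(1))
    \<comment> \<open>\<open>Q m\<close> and \<open>b\<close> depend on the same variables, so their
      mixed moment does not factorise. Young's inequality with the small weight \<theta> charges
      only a fraction of \<phi>, and the fourth moment of \<open>b\<close> is bounded independently
      of m.\<close>
    have y1: "expectation (\<lambda>x. (Q m x)\<^sup>2 * (b x)\<^sup>2) \<le> \<theta> / 2 * \<phi> + 4 * K * \<rho>\<^sup>2 / (2 * \<theta>)"
    proof -
      have "(Q m x)\<^sup>2 * (b x)\<^sup>2 \<le> \<theta> / 2 * Q m x ^ 4 + b x ^ 4 / (2 * \<theta>)" for x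
        using weighted_young[OF \<theta>, of "(Q m x)\<^sup>2" "(b x)\<^sup>2"] by (simp flip: power_mult)
      then have "expectation (\<lambda>x. (Q m x)\<^sup>2 * (b x)\<^sup>2) \<le> expectation (\<lambda>x. \<theta> / 2 * Q m x ^ 4 + b x ^ 4 / (2 * \<theta>))"
        using IH(1) b4(1) by (intro integral_mono Q2b2) simp_all
      also have "\<dots> \<le> \<theta> / 2 * \<phi> + 4 * K * \<rho>\<^sup>2 / (2 * \<theta>)"
      proof -
        have "expectation (\<lambda>x. b x ^ 4) / (2 * \<theta>) \<le> 4 * K * \<rho>\<^sup>2 / (2 * \<theta>)"
          using b4(2) \<theta> by (intro divide_right_mono) auto
        then show ?thesis using IH(1) b4(1) by (simp add: \<phi>_def)
      qed
      finally show ?thesis .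
    qed
    have y2: "\<rho> * expectation (\<lambda>x. (Q m x)\<^sup>2) \<le> \<theta> / 2 * \<phi> + \<rho>\<^sup>2 / (2 * \<theta>)"
    proof -
      have "(Q m x)\<^sup>2 * \<rho> \<le> \<theta> / 2 * Q m x ^ 4 + \<rho>\<^sup>2 / (2 * \<theta>)" for x
        using weighted_young[OF \<theta>, of "(Q m x)\<^sup>2" \<rho>] by (simp flip: power_mult)
      then have "expectation (\<lambda>x. (Q m x)\<^sup>2 * \<rho>) \<le> expectation (\<lambda>x. \<theta> / 2 * Q m x ^ 4 + \<rho>\<^sup>2 / (2 * \<theta>))"
        using IH(1) powQ[of 2] by (intro integral_mono) simp_all
      then show ?thesis using IH(1) powQ[of 2] by (simp add: \<phi>_def prob_space mult.commute)
    qed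
    have e2: "expectation (\<lambda>x. (Q m x)\<^sup>2 * (d x)\<^sup>2) \<le> 5 * (K * (\<theta> * \<phi>)) + 17 * (K * \<rho>\<^sup>2 / \<theta>)"
    proof -
      have "expectation (\<lambda>x. (Q m x)\<^sup>2 * (d x)\<^sup>2) \<le> expectation (\<lambda>x. 8 * ((Q m x)\<^sup>2 * (b x)\<^sup>2 * (c m x)\<^sup>2)
        + 2 * \<rho> * ((Q m x)\<^sup>2 * ((c m x)\<^sup>2 - 1)\<^sup>2))"
        by (intro integral_mono i2 d2_le Bochner_Integration.integrable_add integrable_mult_right Q2b2c2 Q2h)
      also have "\<dots> = 8 * expectation (\<lambda>x. (Q m x)\<^sup>2 * (b x)\<^sup>2)
          + 2 * (\<rho> * expectation (\<lambda>x. (Q m x)\<^sup>2)) * expectation (\<lambda>x. ((c m x)\<^sup>2 - 1)\<^sup>2)"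
        by (simp add: Q2b2c2 Q2h)
      also have "\<dots> \<le> 8 * (\<theta> / 2 * \<phi> + 4 * K * \<rho>\<^sup>2 / (2 * \<theta>)) + 2 * (\<theta> / 2 * \<phi> + \<rho>\<^sup>2 / (2 * \<theta>)) * K"
        using y1 y2 h2(2) \<rho> \<theta> \<phi>0 by (intro add_mono mult_mono mult_left_mono) auto
      \<comment> \<open>Here 17 = 16 + 1, and 4 + K will be bounded by 5 K.\<close>
      also have "\<dots> = 4 * (\<theta> * \<phi>) + K * (\<theta> * \<phi>) + 17 * (K * \<rho>\<^sup>2 / \<theta>)" by (simp add: field_simps)
      also have "\<dots> \<le> 5 * (K * (\<theta> * \<phi>)) + 17 * (K * \<rho>\<^sup>2 / \<theta>)"
      proof -
        have "1 * (\<theta> * \<phi>) \<le> K * (\<theta> * \<phi>)" using K \<theta> \<phi>0 by (intro mult_right_mono) auto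
        then show ?thesis by linarith
      qed
      finally show ?thesis .
    qed
    have d4_le: "d x ^ 4 \<le> 128 * (b x ^ 4 * c m x ^ 4) + 8 * \<rho>\<^sup>2 * ((c m x)\<^sup>2 - 1) ^ 4" for x
    proof -
      have "d x ^ 4 \<le> 128 * (b x ^ 4 * c m x ^ 4) + 8 * (a ^ 4 * ((c m x)\<^sup>2 - 1) ^ 4)"
        using fourth_power_sum_le[of "2 * (b x * c m x)" "a * ((c m x)\<^sup>2 - 1)"]
        by (simp add: d_def power_mult_distrib)
      moreover have "a ^ 4 \<le> \<rho>\<^sup>2" using power_mono[OF a2, of 2] by (simp flip: power_mult)
      then have "a ^ 4 * ((c m x)\<^sup>2 - 1) ^ 4 \<le> \<rho>\<^sup>2 * ((c m x)\<^sup>2 - 1) ^ 4" by (rule mult_right_mono) simp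
      ultimately show ?thesis by simp
    qed
    have int4: "integrable M (\<lambda>x. 128 * (b x ^ 4 * c m x ^ 4) + 8 * \<rho>\<^sup>2 * ((c m x)\<^sup>2 - 1) ^ 4)"
      by (intro Bochner_Integration.integrable_add integrable_mult_right b4c4(1) h4(1))
    have i4: "integrable M (\<lambda>x. d x ^ 4)"
    proof (rule integrable_between[OF int4 _ _ d4_le])
      show "(\<lambda>x. d x ^ 4) \<in> borel_measurable M" using dm by (rule borel_measurable_power)
      show "0 \<le> d x ^ 4" for x by simp
    qed
    have e4: "expectation (\<lambda>x. d x ^ 4) \<le> 576 * K\<^sup>2 * \<rho>\<^sup>2"
    proof -
      have "expectation (\<lambda>x. d x ^ 4)
          \<le> expectation (\<lambda>x. 128 * (b x ^ 4 * c m x ^ 4) + 8 * \<rho>\<^sup>2 * ((c m x)\<^sup>2 - 1) ^ 4)"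
        by (rule integral_mono[OF i4 int4 d4_le])
      also have "\<dots> = 128 * (expectation (\<lambda>x. b x ^ 4) * expectation (\<lambda>x. c m x ^ 4))
          + 8 * \<rho>\<^sup>2 * expectation (\<lambda>x. ((c m x)\<^sup>2 - 1) ^ 4)"
        by (simp only: Bochner_Integration.integral_add integral_mult_right_zero integrable_mult_right b4c4 h4(1))
      \<comment> \<open>In units of \<rho>^2: 512 K^2 from the off-diagonal part and 64 K <= 64 K^2
        from the diagonal make up 576 K^2.\<close>
      also have "\<dots> \<le> 128 * ((4 * K * \<rho>\<^sup>2) * K) + 8 * \<rho>\<^sup>2 * (8 * K)"
        using b4 h4 K fourth_moment_le[OF m]
        by (intro add_mono mult_mono mult_left_mono) (auto simp: K_def)
      also have "\<dots> \<le> 128 * ((4 * K * \<rho>\<^sup>2) * K) + 8 * \<rho>\<^sup>2 * (8 * (K * K))"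
        using K by (intro add_left_mono mult_left_mono) (auto simp: mult_le_cancel_left1)
      also have "\<dots> = 576 * K\<^sup>2 * \<rho>\<^sup>2" by (simp add: power2_eq_square)
      finally show ?thesis .
    qed
    note step = expectation_fourth_power_add[OF Qm dm IH(1) i4 i3(1) i2 i3(2)]
    have 1: "integrable M (\<lambda>x. Q (Suc m) x ^ 4)" unfolding eq by (rule step(1))
    have "expectation (\<lambda>x. Q (Suc m) x ^ 4)
        \<le> \<phi> + 8 * (5 * (K * (\<theta> * \<phi>)) + 17 * (K * \<rho>\<^sup>2 / \<theta>)) + 3 * (576 * K\<^sup>2 * \<rho>\<^sup>2)"
      unfolding eq \<phi>_def by (rule fourth_moment_step_mono'[OF step(2) e2[unfolded \<phi>_def] e4])
    moreover have "0 \<le> real m" by simp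
    moreover have "\<phi> \<le> 7168 * K\<^sup>2 * (real m)\<^sup>2 * \<rho>\<^sup>2" unfolding \<phi>_def K_def by (rule IH(2))
    ultimately have "expectation (\<lambda>x. Q (Suc m) x ^ 4) \<le> 7168 * K\<^sup>2 * (real m + 1)\<^sup>2 * \<rho>\<^sup>2"
      using quadratic_growth_step[OF K _ \<theta>_def] by blast
    then show ?case using 1 by (simp add: K_def add.commute)
  qed
  show ?A by (rule conjunct1[OF *])
  show ?B by (rule conjunct2[OF *])
qed

end

section \<open>Measurability and almost sure convergence\<close>

lemma borel_measurable_det:
  fixes A :: "'b \<Rightarrow> real mat"
  assumes A: "\<And>x. A x \<in> carrier_mat m m"
    and entries: "\<And>i j. i < m \<Longrightarrow> j < m \<Longrightarrow> (\<lambda>x. A x $$ (i, j)) \<in> borel_measurable M"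
  shows "(\<lambda>x. det (A x)) \<in> borel_measurable M"
proof -
  have eq: "(\<lambda>x. det (A x)) = (\<lambda>x. \<Sum>p | p permutes {0..<m}. signof p * (\<Prod>i = 0..<m. A x $$ (i, p i)))"
    using det_def'[OF A] by (simp add: fun_eq_iff)
  show ?thesis unfolding eq
  proof (intro borel_measurable_sum borel_measurable_times borel_measurable_const borel_measurable_prod)
    fix p i assume "p \<in> {p. p permutes {0..<m}}" "i \<in> {0..<m}"
    then have "i < m" "p i < m" using permutes_in_image[of p "{0..<m}" i] by auto
    then show "(\<lambda>x. A x $$ (i, p i)) \<in> borel_measurable M" by (rule entries)
  qed
qed

lemma borel_measurable_inverse_mat:
  fixes A :: "'b \<Rightarrow> real mat"
  assumes A: "\<And>x. A x \<in> carrier_mat m m"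
    and entries: "\<And>i j. i < m \<Longrightarrow> j < m \<Longrightarrow> (\<lambda>x. A x $$ (i, j)) \<in> borel_measurable M"
    and ij: "i < m" "j < m"
  shows "(\<lambda>x. inverse_mat (A x) $$ (i, j)) \<in> borel_measurable M"
proof -
  have dims: "dim_row (A x) = m" "dim_col (A x) = m" for x using A[of x] by auto
  have eq: "(\<lambda>x. inverse_mat (A x) $$ (i, j))
      = (\<lambda>x. 1 / det (A x) * ((- 1) ^ (j + i) * det (mat_delete (A x) j i)))"
    using ij dims by (simp add: fun_eq_iff inverse_mat_def adj_mat_def cofactor_def)
  have "(\<lambda>x. det (mat_delete (A x) j i)) \<in> borel_measurable M"
  proof (rule borel_measurable_det)
    show "mat_delete (A x) j i \<in> carrier_mat (m - 1) (m - 1)" for x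
      using mat_delete_carrier[OF A] .
    fix k l assume kl: "k < m - 1" "l < m - 1"
    have "(\<lambda>x. mat_delete (A x) j i $$ (k, l))
        = (\<lambda>x. A x $$ (if k < j then k else Suc k, if l < i then l else Suc l))"
      using kl dims by (simp add: mat_delete_def fun_eq_iff)
    then show "(\<lambda>x. mat_delete (A x) j i $$ (k, l)) \<in> borel_measurable M"
      using kl entries[of "if k < j then k else Suc k" "if l < i then l else Suc l"] by (auto split: if_splits)
  qed
  then show ?thesis unfolding eq
    using borel_measurable_det[OF A entries]
    by (intro borel_measurable_times borel_measurable_divide borel_measurable_const)
qed

lemma borel_measurable_resolvent:
  fixes Z :: "'b \<Rightarrow> nat \<Rightarrow> nat \<Rightarrow> real"
  assumes Z: "\<And>i j. i < m \<Longrightarrow> j \<in> J \<Longrightarrow> (\<lambda>x. Z x i j) \<in> borel_measurable M" and "i < m" "k < m"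
  shows "(\<lambda>x. resolvent m \<kappa> t (Z x) J $$ (i, k)) \<in> borel_measurable M"
proof (rule borel_measurable_inverse_mat[OF gram_mat_carrier _ assms(2,3)])
  fix i k assume ik: "i < m" "k < m"
  have "(\<lambda>x. gram_mat m \<kappa> t (Z x) J $$ (i, k))
      = (\<lambda>x. \<kappa> * (\<Sum>j\<in>J. Z x i j * Z x k j) + (if i = k then t else 0))"
    using ik by (simp add: gram_mat_def)
  also have "\<dots> \<in> borel_measurable M"
    using ik by (intro borel_measurable_add borel_measurable_times borel_measurable_const borel_measurable_sum Z)
  finally show "(\<lambda>x. gram_mat m \<kappa> t (Z x) J $$ (i, k)) \<in> borel_measurable M" .
qed

lemma gram_mat_cong:
  assumes "\<And>i j. i < m \<Longrightarrow> j \<in> J \<Longrightarrow> z i j = z' i j"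
  shows "gram_mat m \<kappa> t z J = gram_mat m \<kappa> t z' J"
  unfolding gram_mat_def by (rule cong_mat) (auto intro!: sum.cong simp: assms)

lemma quadratic_deviation_cong:
  assumes "\<And>i j. i < m \<Longrightarrow> j \<in> J \<Longrightarrow> z i j = z' i j" "\<And>i. i < m \<Longrightarrow> c i = c' i"
  shows "quadratic_deviation m \<kappa> t z J c = quadratic_deviation m \<kappa> t z' J c'"
  using gram_mat_cong[of m J z z', OF assms(1)] assms(2) unfolding quadratic_deviation_def by simp

lemma borel_measurable_quadratic_deviation:
  assumes "\<And>i j. i < m \<Longrightarrow> j \<in> J \<Longrightarrow> (\<lambda>x. Z x i j) \<in> borel_measurable M"
    and "\<And>i. i < m \<Longrightarrow> (\<lambda>x. c x i) \<in> borel_measurable M"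
  shows "(\<lambda>x. quadratic_deviation m \<kappa> t (Z x) J (c x)) \<in> borel_measurable M"
  unfolding quadratic_deviation_def
  by (intro borel_measurable_diff borel_measurable_sum borel_measurable_times borel_measurable_resolvent assms) auto

text \<open>By Fubini, a bound for each frozen value y of Y bounds the joint integral. With
  \<open>nn_integral\<close>, joint integrability comes out instead of going in.\<close>

lemma (in prob_space) nn_integral_indep_var_le:
  assumes ind: "indep_var S Y T Z" and F: "F \<in> borel_measurable (S \<Otimes>\<^sub>M T)"
    and le: "\<And>y. y \<in> space S \<Longrightarrow> (\<integral>\<^sup>+x. F (y, Z x) \<partial>M) \<le> B"
  shows "(\<integral>\<^sup>+x. F (Y x, Z x) \<partial>M) \<le> B"
proof -
  have Y: "Y \<in> measurable M S" and Z: "Z \<in> measurable M T"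
    and eq: "distr M S Y \<Otimes>\<^sub>M distr M T Z = distr M (S \<Otimes>\<^sub>M T) (\<lambda>x. (Y x, Z x))"
    using ind by (simp_all add: indep_var_distribution_eq)
  interpret DY: prob_space "distr M S Y" by (rule prob_space_distr[OF Y])
  interpret DZ: prob_space "distr M T Z" by (rule prob_space_distr[OF Z])
  have YZ: "(\<lambda>x. (Y x, Z x)) \<in> measurable M (S \<Otimes>\<^sub>M T)" using Y Z by (rule measurable_Pair)
  have "sets (distr M S Y \<Otimes>\<^sub>M distr M T Z) = sets (S \<Otimes>\<^sub>M T)"
    by (intro sets_pair_measure_cong) simp_all
  then have F': "F \<in> borel_measurable (distr M S Y \<Otimes>\<^sub>M distr M T Z)"
    using F measurable_cong_sets by blast
  have "(\<integral>\<^sup>+x. F (Y x, Z x) \<partial>M) = (\<integral>\<^sup>+w. F w \<partial>(distr M S Y \<Otimes>\<^sub>M distr M T Z))"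
    unfolding eq by (rule nn_integral_distr[OF YZ, symmetric]) (use F in simp)
  also have "\<dots> = (\<integral>\<^sup>+y. (\<integral>\<^sup>+z. F (y, z) \<partial>distr M T Z) \<partial>distr M S Y)"
    by (rule DZ.nn_integral_fst[OF F', symmetric])
  also have "\<dots> \<le> (\<integral>\<^sup>+y. B \<partial>distr M S Y)"
  proof (rule nn_integral_mono)
    fix y assume "y \<in> space (distr M S Y)"
    then have y: "y \<in> space S" by simp
    have "(\<lambda>z. F (y, z)) \<in> borel_measurable T" using F y by (rule measurable_Pair2)
    then have "(\<integral>\<^sup>+z. F (y, z) \<partial>distr M T Z) = (\<integral>\<^sup>+x. F (y, Z x) \<partial>M)"
      by (intro nn_integral_distr[OF Z]) simp
    then show "(\<integral>\<^sup>+z. F (y, z) \<partial>distr M T Z) \<le> B" using le[OF y] by simp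
  qed
  also have "\<dots> = B" using DY.emeasure_space_1 by simp
  finally show ?thesis .
qed

text \<open>The sum over n has finite expectation, so almost surely the series converges and its
  terms tend to 0. The joint law of the \<open>Z n\<close> is arbitrary, as is that of arrays with
  different n.\<close>

lemma (in prob_space) AE_tendsto_0_if_summable:
  fixes Z :: "nat \<Rightarrow> 'a \<Rightarrow> real"
  assumes Z: "\<And>n. Z n \<in> borel_measurable M" "\<And>n x. 0 \<le> Z n x"
    and le: "\<And>n. (\<integral>\<^sup>+x. ennreal (Z n x) \<partial>M) \<le> ennreal (b n)" "\<And>n. 0 \<le> b n" "summable b"
  shows "AE x in M. (\<lambda>n. Z n x) \<longlonglongrightarrow> 0"
proof -
  have m: "(\<lambda>x. ennreal (Z n x)) \<in> borel_measurable M" for n using Z(1) by simp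
  have "(\<integral>\<^sup>+x. (\<Sum>n. ennreal (Z n x)) \<partial>M) = (\<Sum>n. (\<integral>\<^sup>+x. ennreal (Z n x) \<partial>M))"
    by (rule nn_integral_suminf[OF m])
  also have "\<dots> \<le> (\<Sum>n. ennreal (b n))" by (intro suminf_le le) auto
  also have "\<dots> = ennreal (suminf b)" by (rule suminf_ennreal2[OF le(2,3)])
  also have "\<dots> < \<infinity>" by simp
  finally have "(\<integral>\<^sup>+x. (\<Sum>n. ennreal (Z n x)) \<partial>M) \<noteq> \<infinity>" by simp
  then have "AE x in M. (\<Sum>n. ennreal (Z n x)) \<noteq> \<infinity>"
    by (intro nn_integral_PInf_AE borel_measurable_suminf_order m)
  then show ?thesis
  proof eventually_elim
    case (elim x)
    then have "summable (\<lambda>n. Z n x)" using Z(2) by (intro summable_suminf_not_top) auto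
    then show ?case by (rule summable_LIMSEQ_zero)
  qed
qed

text \<open>Only the fourth powers of the deviations are summable in expectation; the means are
  recovered from \<open>d \<le> \<delta> + d\<^sup>4 / \<delta>\<^sup>3\<close>.\<close>

lemma le_add_fourth_power:
  fixes d \<delta> :: real
  assumes "0 \<le> d" "0 < \<delta>"
  shows "d \<le> \<delta> + d ^ 4 / \<delta> ^ 3"
proof (cases "d \<le> \<delta>")
  case True
  then show ?thesis using assms by (simp add: add_increasing2)
next
  case False
  then have "\<delta> ^ 3 \<le> d ^ 3" using assms by (intro power_mono) auto
  then have "d * \<delta> ^ 3 \<le> d * d ^ 3" using assms by (intro mult_left_mono) auto
  also have "\<dots> = d ^ 4" by (simp add: power3_eq_cube power4_eq_xxxx)
  finally have "d \<le> d ^ 4 / \<delta> ^ 3" using assms by (simp add: pos_le_divide_eq)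
  then show ?thesis using assms by simp
qed

lemma mean_tendsto_0_if_fourth_power_mean:
  fixes D :: "nat \<Rightarrow> nat \<Rightarrow> real"
  assumes D: "\<And>n j. 0 \<le> D n j" and lim: "(\<lambda>n. (\<Sum>j<n. D n j ^ 4) / n) \<longlonglongrightarrow> 0"
  shows "(\<lambda>n. (\<Sum>j<n. D n j) / n) \<longlonglongrightarrow> 0"
proof (rule tendstoI)
  fix e :: real assume e: "0 < e"
  define \<delta> where "\<delta> = e / 2"
  have \<delta>: "0 < \<delta>" using e by (simp add: \<delta>_def)
  have "(\<lambda>n. (\<Sum>j<n. D n j ^ 4) / n / \<delta> ^ 3) \<longlonglongrightarrow> 0 / \<delta> ^ 3"
    using \<delta> by (intro tendsto_divide lim tendsto_const) simp
  then have "eventually (\<lambda>n. (\<Sum>j<n. D n j ^ 4) / n / \<delta> ^ 3 < \<delta>) sequentially"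
    using \<delta> by (intro order_tendstoD(2)) simp_all
  then show "eventually (\<lambda>n. dist ((\<Sum>j<n. D n j) / n) 0 < e) sequentially"
    using eventually_gt_at_top[of 0]
  proof eventually_elim
    case (elim n)
    have "(\<Sum>j<n. D n j) \<le> (\<Sum>j<n. \<delta> + D n j ^ 4 / \<delta> ^ 3)"
      by (intro sum_mono le_add_fourth_power D \<delta>)
    also have "\<dots> = n * \<delta> + (\<Sum>j<n. D n j ^ 4) / \<delta> ^ 3" by (simp add: sum.distrib sum_divide_distrib)
    finally have "(\<Sum>j<n. D n j) / n \<le> (n * \<delta> + (\<Sum>j<n. D n j ^ 4) / \<delta> ^ 3) / n"
      by (rule divide_right_mono) simp
    also have "\<dots> = \<delta> + (\<Sum>j<n. D n j ^ 4) / n / \<delta> ^ 3" using elim by (simp add: add_divide_distrib)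
    also have "\<dots> < \<delta> + \<delta>" using elim(1) by (rule add_strict_left_mono)
    also have "\<dots> = e" by (simp add: \<delta>_def)
    finally show ?case using D by (simp add: sum_nonneg)
  qed
qed

section \<open>Marchenko--Pastur schemes\<close>

context marchenko_pastur_scheme
begin

lemma entry_measurable: "i < p n \<Longrightarrow> j < n \<Longrightarrow> X n i j \<in> borel_measurable M"
  using indep[of n] by (force simp: indep_vars_def)

lemma column_standardized:
  assumes L: "\<And>n i j. i < p n \<Longrightarrow> j < n \<Longrightarrow> integrable M (\<lambda>\<omega>. \<bar>X n i j \<omega>\<bar> ^ 8) \<and> expectation (\<lambda>\<omega>. \<bar>X n i j \<omega>\<bar> ^ 8) \<le> L"
    and "0 \<le> L" and j: "j < n"
  shows "standardized_independent M (\<lambda>i. X n i j) (p n) L"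
proof
  \<comment> \<open>Reindexing along i -> (i, j): restrict the family to the disjoint singletons
    {(i, j)}, then read off the only coordinate.\<close>
  have "indep_vars (\<lambda>i. PiM {(i, j)} (\<lambda>_. borel))
      (\<lambda>i \<omega>. restrict (\<lambda>l. (case l of (i, j) \<Rightarrow> X n i j) \<omega>) {(i, j)}) {..<p n}"
    using j by (intro indep_vars_restrict[OF indep]) (auto simp: disjoint_family_on_def)
  moreover have "(\<lambda>z. z (i, j)) \<in> measurable (PiM {(i, j)} (\<lambda>_. borel :: real measure)) borel" for i
    using measurable_component_singleton[of "(i, j)" "{(i, j)}" "\<lambda>_. borel :: real measure"] by simp
  ultimately have "indep_vars (\<lambda>_. borel)
      (\<lambda>i \<omega>. restrict (\<lambda>l. (case l of (i, j) \<Rightarrow> X n i j) \<omega>) {(i, j)} (i, j)) {..<p n}"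
    by (rule indep_vars_compose2)
  then show "indep_vars (\<lambda>_. borel) (\<lambda>i. X n i j) {..<p n}" by simp
next
  fix i assume i: "i < p n"
  show "expectation (X n i j) = 0" using mean i j .
  show "expectation (\<lambda>x. (X n i j x)\<^sup>2) = 1" using var[OF i j] mean[OF i j] by simp
qed (use L j assms(2) in auto)

definition deviation :: "real \<Rightarrow> nat \<Rightarrow> nat \<Rightarrow> 'a \<Rightarrow> real" where
  "deviation t n j \<omega> = quadratic_deviation (p n) (1 / n) t (\<lambda>i l. X n i l \<omega>) ({..<n} - {j}) (\<lambda>i. X n i j \<omega>)"

lemma deviation_measurable: "j < n \<Longrightarrow> deviation t n j \<in> borel_measurable M"
  unfolding deviation_def by (intro borel_measurable_quadratic_deviation entry_measurable) auto

text \<open>Freezing the other columns makes the resolvent a constant symmetric matrix. Gram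
  matrices are coercive for every array, so its row bound (1 / t)^2 holds for every frozen value,
  and the quadratic-form estimate applies to column j.\<close>

lemma deviation_fourth_moment:
  assumes L: "\<And>n i j. i < p n \<Longrightarrow> j < n \<Longrightarrow> integrable M (\<lambda>\<omega>. \<bar>X n i j \<omega>\<bar> ^ 8) \<and> expectation (\<lambda>\<omega>. \<bar>X n i j \<omega>\<bar> ^ 8) \<le> L"
    and L0: "0 \<le> L" and j: "j < n" and t: "0 < t"
  shows "(\<integral>\<^sup>+\<omega>. ennreal (deviation t n j \<omega> ^ 4) \<partial>M) \<le> ennreal (7168 * (L + 1)\<^sup>2 * (real (p n))\<^sup>2 * ((1 / t)\<^sup>2)\<^sup>2)"
proof -
  let ?I = "{..<p n} \<times> {..<n}" and ?C = "{..<p n} \<times> {j}"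
  let ?O = "{..<p n} \<times> ({..<n} - {j})"
  let ?X = "\<lambda>(i, j). X n i j"
  \<comment> \<open>Both arguments of \<open>F\<close> are arrays indexed by pairs; the restricted
    families agree with X at all entries that \<open>quadratic_deviation\<close> reads.\<close>
  define F where "F = (\<lambda>(y, c). ennreal (quadratic_deviation (p n) (1 / n) t (\<lambda>i l. y (i, l)) ({..<n} - {j}) (\<lambda>i. c (i, j)) ^ 4))"
  have ind: "indep_var (PiM ?O (\<lambda>_. borel)) (\<lambda>\<omega>. restrict (\<lambda>i. ?X i \<omega>) ?O) (PiM ?C (\<lambda>_. borel)) (\<lambda>\<omega>. restrict (\<lambda>i. ?X i \<omega>) ?C)"
    using j by (intro indep_var_restrict[OF indep[of n]]) auto
  have F: "F \<in> borel_measurable (PiM ?O (\<lambda>_. borel) \<Otimes>\<^sub>M PiM ?C (\<lambda>_. borel))"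
  proof -
    have 1: "(\<lambda>x. fst x (i, l)) \<in> borel_measurable (PiM ?O (\<lambda>_. borel) \<Otimes>\<^sub>M PiM ?C (\<lambda>_. borel :: real measure))"
      if "i < p n" "l \<in> {..<n} - {j}" for i l
      using measurable_compose[OF measurable_fst measurable_component_singleton[of "(i, l)" ?O "\<lambda>_. borel :: real measure"]] that
      by simp
    have 2: "(\<lambda>x. snd x (i, j)) \<in> borel_measurable (PiM ?O (\<lambda>_. borel) \<Otimes>\<^sub>M PiM ?C (\<lambda>_. borel :: real measure))"
      if "i < p n" for i
      using measurable_compose[OF measurable_snd measurable_component_singleton[of "(i, j)" ?C "\<lambda>_. borel :: real measure"]] that
      by simp
    show ?thesis unfolding F_def case_prod_beta
      by (intro measurable_compose[OF _ measurable_ennreal] borel_measurable_power borel_measurable_quadratic_deviation 1 2)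
  qed
  interpret C: standardized_independent M "\<lambda>i. X n i j" "p n" L
    by (rule column_standardized[OF L L0 j])
  have "(\<integral>\<^sup>+\<omega>. F (restrict (\<lambda>i. ?X i \<omega>) ?O, restrict (\<lambda>i. ?X i \<omega>) ?C) \<partial>M)
      \<le> ennreal (7168 * (L + 1)\<^sup>2 * (real (p n))\<^sup>2 * ((1 / t)\<^sup>2)\<^sup>2)"
  proof (rule nn_integral_indep_var_le[OF ind F])
    fix y :: "nat \<times> nat \<Rightarrow> real"
    let ?z = "\<lambda>i l. y (i, l)"
    interpret R: coercive_mat "p n" t "gram_mat (p n) (1 / n) t ?z ({..<n} - {j})"
      by (rule coercive_gram_mat[OF t]) simp
    define Q where "Q x = (\<Sum>i<p n. \<Sum>k<p n. R.R $$ (i, k) * X n i j x * X n k j x) - (\<Sum>i<p n. R.R $$ (i, i))" for x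
    have Q: "integrable M (\<lambda>x. Q x ^ 4)"
      "expectation (\<lambda>x. Q x ^ 4) \<le> 7168 * (L + 1)\<^sup>2 * (real (p n))\<^sup>2 * ((1 / t)\<^sup>2)\<^sup>2"
      unfolding Q_def
      by (rule C.quadratic_form_fourth_moment[OF order_refl R.R_commute R.R_row_norm]; assumption)+
    have "F (y, restrict (\<lambda>i. ?X i x) ?C) = ennreal (Q x ^ 4)" for x
      unfolding F_def Q_def quadratic_deviation_def by simp
    then have "(\<integral>\<^sup>+x. F (y, restrict (\<lambda>i. ?X i x) ?C) \<partial>M) = ennreal (expectation (\<lambda>x. Q x ^ 4))"
      using Q(1) by (simp add: nn_integral_eq_integral)
    also have "\<dots> \<le> ennreal (7168 * (L + 1)\<^sup>2 * (real (p n))\<^sup>2 * ((1 / t)\<^sup>2)\<^sup>2)"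
      using Q(2) by (rule ennreal_leI)
    finally show "(\<integral>\<^sup>+x. F (y, restrict (\<lambda>i. ?X i x) ?C) \<partial>M)
        \<le> ennreal (7168 * (L + 1)\<^sup>2 * (real (p n))\<^sup>2 * ((1 / t)\<^sup>2)\<^sup>2)" .
  qed
  moreover have "F (restrict (\<lambda>i. ?X i \<omega>) ?O, restrict (\<lambda>i. ?X i \<omega>) ?C) = ennreal (deviation t n j \<omega> ^ 4)" for \<omega>
    unfolding F_def deviation_def prod.case
    by (intro arg_cong[where f = "\<lambda>x. ennreal (x ^ 4)"] quadratic_deviation_cong) auto
  ultimately show ?thesis by simp
qed

section \<open>Averages of the deviations over the columns\<close>

lemma size_bound: "\<exists>B>0. \<forall>n. real (p (Suc n)) \<le> B * real (Suc n)"
proof -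
  have "(\<lambda>n. real (p (Suc n)) / real (Suc n)) \<longlonglongrightarrow> y" using ratio_lim by (rule LIMSEQ_Suc)
  then have "Bseq (\<lambda>n. real (p (Suc n)) / real (Suc n))" by (intro convergent_imp_Bseq convergentI)
  then obtain B where B: "B > 0" "\<forall>n. norm (real (p (Suc n)) / real (Suc n)) \<le> B" by (rule BseqE)
  have "real (p (Suc n)) \<le> B * real (Suc n)" for n
    using spec[OF B(2), of n] by (simp add: pos_divide_le_eq)
  then show ?thesis using B(1) by blast
qed

text \<open>Each fourth moment is O(p_n^2) = O(n^2). Scaling by n^-4 leaves O(n^-2), and averaging
  over the columns preserves this summable order.\<close>

lemma AE_mean_deviation:
  assumes t: "0 < t"
  shows "AE \<omega> in M. (\<lambda>n. (\<Sum>j<n. \<bar>deviation t n j \<omega>\<bar> / n) / n) \<longlonglongrightarrow> 0"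
proof -
  obtain L where L: "L > 0" "\<And>n i j. i < p n \<Longrightarrow> j < n \<Longrightarrow> integrable M (\<lambda>\<omega>. \<bar>X n i j \<omega>\<bar> ^ 8) \<and> expectation (\<lambda>\<omega>. \<bar>X n i j \<omega>\<bar> ^ 8) \<le> L"
    using moments[of 8] by blast
  obtain B where B: "B > 0" "\<And>n. real (p (Suc n)) \<le> B * real (Suc n)" using size_bound by blast
  define K where "K = 7168 * (L + 1)\<^sup>2 * ((1 / t)\<^sup>2)\<^sup>2"
  have K: "0 \<le> K" by (simp add: K_def)
  define Z where "Z n \<omega> = (\<Sum>j<Suc n. (\<bar>deviation t (Suc n) j \<omega>\<bar> / Suc n) ^ 4) / Suc n" for n \<omega>
  have "AE \<omega> in M. (\<lambda>n. Z n \<omega>) \<longlonglongrightarrow> 0"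
  proof (rule AE_tendsto_0_if_summable)
    show "Z n \<in> borel_measurable M" for n
      unfolding Z_def
      by (intro borel_measurable_divide borel_measurable_sum borel_measurable_power borel_measurable_abs
        borel_measurable_const deviation_measurable) simp
    show "0 \<le> Z n \<omega>" for n \<omega> by (simp add: Z_def sum_nonneg)
    show "0 \<le> K * B\<^sup>2 * inverse ((real (Suc n))\<^sup>2)" for n using K by simp
    show "summable (\<lambda>n. K * B\<^sup>2 * inverse ((real (Suc n))\<^sup>2))"
      using inverse_squares_sums by (intro summable_mult) (auto simp: sums_iff inverse_eq_divide)
    fix n
    let ?n = "real (Suc n)"
    have dm: "(\<lambda>\<omega>. ennreal (deviation t (Suc n) j \<omega> ^ 4)) \<in> borel_measurable M" if "j < Suc n" for j
      using deviation_measurable[OF that, of t] by (intro measurable_compose[OF _ measurable_ennreal] borel_measurable_power)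
    have "ennreal (Z n \<omega>) = ennreal (1 / ?n ^ 5) * (\<Sum>j<Suc n. ennreal (deviation t (Suc n) j \<omega> ^ 4))" for \<omega>
    proof -
      \<comment> \<open>Four of the five factors come from the fourth power, one from the average
        over columns.\<close>
      have "Z n \<omega> = 1 / ?n ^ 5 * (\<Sum>j<Suc n. deviation t (Suc n) j \<omega> ^ 4)"
      proof -
        have "s / N ^ 4 / N = 1 / N ^ 5 * s" for s N :: real by (simp add: eval_nat_numeral)
        then show ?thesis
          unfolding Z_def power_divide sum_divide_distrib[symmetric] power_even_abs_numeral[OF even_numeral] by blast
      qed
      then show ?thesis by (simp only: ennreal_mult' sum_ennreal zero_le_even_power' zero_le_power zero_le_divide_1_iff of_nat_0_le_iff
            zero_le_even_power even_numeral)
    qed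
    then have "(\<integral>\<^sup>+\<omega>. ennreal (Z n \<omega>) \<partial>M)
        = ennreal (1 / ?n ^ 5) * (\<Sum>j<Suc n. (\<integral>\<^sup>+\<omega>. ennreal (deviation t (Suc n) j \<omega> ^ 4) \<partial>M))"
    proof -
      have "(\<lambda>\<omega>. \<Sum>j<Suc n. ennreal (deviation t (Suc n) j \<omega> ^ 4)) \<in> borel_measurable M"
        by (intro borel_measurable_sum dm) simp
      from nn_integral_cmult[OF this]
      have "(\<integral>\<^sup>+\<omega>. ennreal (1 / ?n ^ 5) * (\<Sum>j<Suc n. ennreal (deviation t (Suc n) j \<omega> ^ 4)) \<partial>M)
          = ennreal (1 / ?n ^ 5) * (\<integral>\<^sup>+\<omega>. (\<Sum>j<Suc n. ennreal (deviation t (Suc n) j \<omega> ^ 4)) \<partial>M)" .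
      also have "(\<integral>\<^sup>+\<omega>. (\<Sum>j<Suc n. ennreal (deviation t (Suc n) j \<omega> ^ 4)) \<partial>M)
          = (\<Sum>j<Suc n. (\<integral>\<^sup>+\<omega>. ennreal (deviation t (Suc n) j \<omega> ^ 4) \<partial>M))"
        by (rule nn_integral_sum) (use dm in simp)
      finally show ?thesis by (simp only: \<open>\<And>\<omega>. ennreal (Z n \<omega>) = _\<close>)
    qed
    also have "\<dots> \<le> ennreal (1 / ?n ^ 5) * (\<Sum>j<Suc n. ennreal (K * (B * ?n)\<^sup>2))"
    proof (intro mult_left_mono sum_mono)
      fix j assume "j \<in> {..<Suc n}"
      then have j: "j < Suc n" by simp
      have "(real (p (Suc n)))\<^sup>2 \<le> (B * ?n)\<^sup>2" using B(2)[of n] by (intro power_mono) auto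
      then have "7168 * (L + 1)\<^sup>2 * (real (p (Suc n)))\<^sup>2 * ((1 / t)\<^sup>2)\<^sup>2 \<le> K * (B * ?n)\<^sup>2"
        using mult_left_mono[of "(real (p (Suc n)))\<^sup>2" "(B * ?n)\<^sup>2" K] K by (simp only: K_def mult_ac)
      moreover have "(\<integral>\<^sup>+\<omega>. ennreal (deviation t (Suc n) j \<omega> ^ 4) \<partial>M)
          \<le> ennreal (7168 * (L + 1)\<^sup>2 * (real (p (Suc n)))\<^sup>2 * ((1 / t)\<^sup>2)\<^sup>2)"
        using L(2) less_imp_le[OF L(1)] j t by (rule deviation_fourth_moment)
      ultimately show "(\<integral>\<^sup>+\<omega>. ennreal (deviation t (Suc n) j \<omega> ^ 4) \<partial>M) \<le> ennreal (K * (B * ?n)\<^sup>2)"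
        by (meson ennreal_leI order_trans)
    qed simp
    also have "(\<Sum>j<Suc n. ennreal (K * (B * ?n)\<^sup>2)) = ennreal (?n * (K * (B * ?n)\<^sup>2))"
      using K by (subst sum_ennreal) simp_all
    also have "ennreal (1 / ?n ^ 5) * \<dots> = ennreal (1 / ?n ^ 5 * (?n * (K * (B * ?n)\<^sup>2)))"
      using K by (intro ennreal_mult[symmetric]) simp_all
    also have "1 / ?n ^ 5 * (?n * (K * (B * ?n)\<^sup>2)) = K * B\<^sup>2 * inverse (?n\<^sup>2)"
    proof -
      have "1 / N ^ 5 * (N * (K * (B * N)\<^sup>2)) = K * B\<^sup>2 * inverse (N\<^sup>2)" if "N \<noteq> 0" for N :: real
        using that by (simp add: eval_nat_numeral field_simps)
      then show ?thesis by (metis of_nat_eq_0_iff nat.distinct(1))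
    qed
    finally show "(\<integral>\<^sup>+\<omega>. ennreal (Z n \<omega>) \<partial>M) \<le> ennreal (K * B\<^sup>2 * inverse (?n\<^sup>2))" .
  qed
  then show ?thesis
  proof eventually_elim
    case (elim \<omega>)
    then have "(\<lambda>n. (\<Sum>j<n. (\<bar>deviation t n j \<omega>\<bar> / n) ^ 4) / n) \<longlonglongrightarrow> 0"
      unfolding Z_def by (rule LIMSEQ_imp_Suc)
    then show ?case by (rule mean_tendsto_0_if_fourth_power_mean[rotated]) simp
  qed
qed

section \<open>From resolvents to the empirical spectral distributions\<close>

lemma covariance_matrix_eq:
  "covariance_matrix p X n \<omega> \<in> carrier_mat (p n) (p n)"
  "transpose_mat (covariance_matrix p X n \<omega>) = covariance_matrix p X n \<omega>"
  "covariance_matrix p X n \<omega> + t \<cdot>\<^sub>m 1\<^sub>m (p n) = gram_mat (p n) (1 / n) t (\<lambda>i j. X n i j \<omega>) {..<n}"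
proof -
  show c: "covariance_matrix p X n \<omega> \<in> carrier_mat (p n) (p n)"
    unfolding covariance_matrix_def data_matrix_def
    by (intro smult_carrier_mat mult_carrier_mat[of _ "p n" n]) simp_all
  show "transpose_mat (covariance_matrix p X n \<omega>) = covariance_matrix p X n \<omega>"
    by (rule eq_matI) (auto simp: covariance_matrix_def data_matrix_def scalar_prod_def mult.commute)
  show "covariance_matrix p X n \<omega> + t \<cdot>\<^sub>m 1\<^sub>m (p n) = gram_mat (p n) (1 / n) t (\<lambda>i j. X n i j \<omega>) {..<n}"
    by (rule eq_matI) (auto simp: covariance_matrix_def data_matrix_def gram_mat_def scalar_prod_def atLeast0LessThan)
qed

lemma stieltjes_esd:
  assumes t: "0 < t"
  shows "(\<integral>x. 1 / (x + t) \<partial>esd (covariance_matrix p X n \<omega>))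
    = (\<Sum>i<p n. resolvent (p n) (1 / n) t (\<lambda>i j. X n i j \<omega>) {..<n} $$ (i, i)) / p n"
proof -
  interpret coercive_mat "p n" t "gram_mat (p n) (1 / n) t (\<lambda>i j. X n i j \<omega>) {..<n}"
    by (rule coercive_gram_mat[OF t]) simp
  have "R * (covariance_matrix p X n \<omega> + t \<cdot>\<^sub>m 1\<^sub>m (p n)) = 1\<^sub>m (p n)"
    unfolding covariance_matrix_eq(3) by (rule R(3))
  from sum_spectrum_list_resolvent(1)[OF covariance_matrix_eq(1,2) R(1) this]
  show ?thesis by (subst integral_esd[OF covariance_matrix_eq(1)]) simp_all
qed

text \<open>If -t were an eigenvalue with t > 0, the shift by t would be singular although it is
  coercive.\<close>

lemma spectrum_covariance_nonneg:
  assumes l: "l < p n"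
  shows "0 \<le> spectrum_list (covariance_matrix p X n \<omega>) ! l"
proof (rule ccontr)
  assume neg: "\<not> 0 \<le> spectrum_list (covariance_matrix p X n \<omega>) ! l"
  define t where "t = - (spectrum_list (covariance_matrix p X n \<omega>) ! l)"
  have t: "0 < t" using neg by (simp add: t_def)
  interpret coercive_mat "p n" t "gram_mat (p n) (1 / n) t (\<lambda>i j. X n i j \<omega>) {..<n}"
    by (rule coercive_gram_mat[OF t]) simp
  have "R * (covariance_matrix p X n \<omega> + t \<cdot>\<^sub>m 1\<^sub>m (p n)) = 1\<^sub>m (p n)"
    unfolding covariance_matrix_eq(3) by (rule R(3))
  from sum_spectrum_list_resolvent(2)[OF covariance_matrix_eq(1,2) R(1) this l]
  show False by (simp add: t_def)
qed

lemma AE_stieltjes_converges: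
  assumes t: "0 < t"
  shows "AE \<omega> in M. (\<lambda>n. \<integral>x. 1 / (x + t) \<partial>esd (covariance_matrix p X (Suc n) \<omega>))
    \<longlonglongrightarrow> (\<integral>x. 1 / (x + t) \<partial>marchenko_pastur y)"
  using AE_mean_deviation[OF t]
proof eventually_elim
  case (elim \<omega>)
  let ?y = "\<lambda>n. real (p (Suc n)) / real (Suc n)"
  let ?D = "\<lambda>n. (\<Sum>j<n. \<bar>deviation t n j \<omega>\<bar> / n)"
  let ?s = "\<lambda>n. (\<integral>x. 1 / (x + t) \<partial>esd (covariance_matrix p X (Suc n) \<omega>))"
  let ?e = "\<lambda>n. (?D (Suc n) + 1 / t) / p (Suc n)"
  have p: "0 < p (Suc n)" for n using size_pos[of "Suc n"] by simp
  have y: "?y \<longlonglongrightarrow> y" using ratio_lim by (rule LIMSEQ_Suc)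
  \<comment> \<open>Numerator and denominator of \<open>?e\<close> are divided by the number of
    columns: a null sequence over the ratio \<open>?y\<close>, whose limit is positive.\<close>
  have "(\<lambda>n. ?D (Suc n) / Suc n) \<longlonglongrightarrow> 0" using elim by (rule LIMSEQ_Suc)
  moreover have "(\<lambda>n. 1 / t / real (Suc n)) \<longlonglongrightarrow> 0" by (rule LIMSEQ_Suc[OF lim_const_over_n])
  ultimately have "(\<lambda>n. (?D (Suc n) / Suc n + 1 / t / real (Suc n)) / ?y n) \<longlonglongrightarrow> (0 + 0) / y"
    using y ratio_pos by (intro tendsto_divide tendsto_add) auto
  moreover have "(?D (Suc n) / Suc n + 1 / t / real (Suc n)) / ?y n = ?e n" for n
  proof -
    have "(a / N + 1 / t / N) / (P / N) = (a + 1 / t) / P" if "N \<noteq> 0" for a N P :: real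
    proof -
      have "(a / N + 1 / t / N) / (P / N) = ((a + 1 / t) / N) / (P / N)" by (simp only: add_divide_distrib)
      also have "\<dots> = (a + 1 / t) / P" using that by simp
      finally show ?thesis .
    qed
    then show ?thesis by (metis of_nat_eq_0_iff nat.distinct(1))
  qed
  ultimately have "?e \<longlonglongrightarrow> (0 + 0) / y" by (simp only:)
  then have e: "?e \<longlonglongrightarrow> 0" by simp
  show ?case
    unfolding integral_marchenko_pastur_kernel[OF ratio_pos t]
  proof (rule self_consistent_equation_limit[OF t ratio_pos y _ _ _ _ e marchenko_pastur_root[OF t ratio_pos]])
    fix n
    note B = self_consistent_equation_error[OF p[of n] zero_less_Suc[of n] t, where z = "\<lambda>i j. X (Suc n) i j \<omega>"]
    show "0 \<le> ?y n" by simp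
    show "0 \<le> ?s n" "?s n \<le> 1 / t" unfolding stieltjes_esd[OF t] using B(1,2) by simp_all
    show "\<bar>t * ?s n + ?s n / (1 + ?y n * ?s n) - 1\<bar> \<le> ?e n"
      unfolding stieltjes_esd[OF t] deviation_def by (rule B(3))
  qed
qed

lemma AE_esd_converges_weakly:
  "AE \<omega> in M. converges_weakly (\<lambda>n. esd (covariance_matrix p X n \<omega>)) (marchenko_pastur y)"
proof -
  define \<epsilon> where "\<epsilon> m = inverse (real (Suc m))" for m
  have \<epsilon>: "0 < \<epsilon> m" "\<epsilon> \<longlonglongrightarrow> 0" for m
    unfolding \<epsilon>_def using LIMSEQ_inverse_real_of_nat by simp_all
  have "AE \<omega> in M. \<forall>m. (\<lambda>n. \<integral>x. 1 / (x + (1 + \<epsilon> m)) \<partial>esd (covariance_matrix p X (Suc n) \<omega>))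
    \<longlonglongrightarrow> (\<integral>x. 1 / (x + (1 + \<epsilon> m)) \<partial>marchenko_pastur y)"
    unfolding AE_all_countable using \<epsilon>(1) by (intro allI AE_stieltjes_converges add_pos_pos) simp_all
  then show ?thesis
  proof eventually_elim
    case (elim \<omega>)
    \<comment> \<open>Index 0 is dropped because \<open>p 0\<close> may be 0, and then the spectral
      distribution is not a probability measure.\<close>
    have "converges_weakly (\<lambda>n. esd (covariance_matrix p X (Suc n) \<omega>)) (marchenko_pastur y)"
    proof (rule converges_weakly_if_stieltjes_converges[OF _ _ _ _ \<epsilon>])
      fix n
      have p: "0 < p (Suc n)" using size_pos[of "Suc n"] by simp
      show "real_distribution (esd (covariance_matrix p X (Suc n) \<omega>))"
        by (rule real_distribution_esd[OF covariance_matrix_eq(1) p])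
      show "AE x in esd (covariance_matrix p X (Suc n) \<omega>). 0 \<le> x"
        by (rule AE_esd[OF covariance_matrix_eq(1) spectrum_covariance_nonneg])
    qed (use elim real_distribution_marchenko_pastur[OF ratio_pos] AE_marchenko_pastur_nonneg[OF ratio_pos] in simp_all)
    then show ?case unfolding converges_weakly_def by (intro allI impI, elim allE impE) (assumption+, rule LIMSEQ_imp_Suc)
  qed
qed

end

theorem theorem2p46:
  fixes M :: "'a measure"
    and p :: "nat \<Rightarrow> nat"
    and X :: "nat \<Rightarrow> nat \<Rightarrow> nat \<Rightarrow> 'a \<Rightarrow> real"
    and y :: real
  assumes "marchenko_pastur_scheme M p X y"
  shows "AE \<omega> in M. converges_weakly (\<lambda>n. esd (covariance_matrix p X n \<omega>)) (marchenko_pastur y)"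
  using assms by (rule marchenko_pastur_scheme.AE_esd_converges_weakly)

end
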